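(* Let $R$ be a finite valuation ring with residue field of odd size $q$ and with uniformizer of nilpotency degree $\ell$. Then: (i) For $n\geq 2$, the bipartite graph $\mathrm{Um}(R^n)$ has half-size $q^{n\ell}-q^{n(\ell-1)}$ and is regular of degree $q^{(n-1)\ell}$; for $n\geq 3$, the bipartite graph $\mathrm{Um}_0(R^n)$ has half-size $q^{(n-1)(\ell-1)}(q^n-1)/(q-1)$ and is regular of degree $q^{(n-2)(\ell-1)}(q^{n-1}-1)/(q-1)$. (ii) Both $\mathrm{Um}(R^n)$ and $\mathrm{Um}_0(R^n)$ are Cayley graphs. (iii) The diameter of $\mathrm{Um}(R^n)$ is $4$, and the diameter of $\mathrm{Um}_0(R^n)$ is $3$.
   Context: Rings are commutative with identity. A finite valuation ring is a finite local principal ring; its maximal ideal is $(\pi)$ for a uniformizer $\pi$, $q=|R/(\pi)|$, and $\ell$ is the smallest positive integer with $\pi^\ell=0$. An $n$-tuple in $R^n$ is unimodular if its entries generate $R$ as an ideal; $R^{n,u}$ denotes the set of unimodular $n$-tuples and $R^\times$ the unit group. Dot product: $a\cdot b=\sum_i a_ib_i$. For $n\geq 2$, $\mathrm{Um}(R^n)$ is the bipartite graph on two copies $\{a_\bullet\},\{b_\circ\}$ of $R^{n,u}$ with $a_\bullet\sim b_\circ$ iff $a\cdot b=1$. For $n\geq3$, $\mathrm{Um}_0(R^n)$ is the bipartite graph on two copies of $R^{n,u}/R^\times$ with $[a]_\bullet\sim[b]_\circ$ iff $a\cdot b=0$. The half-size of such a bipartite graph is the number of vertices in one of the two copies. *)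

theory Defs
  imports "HOL-Algebra.QuotRing" "Graph_Theory.Graph_Theory"
begin

section \<open>Finite valuation rings\<close>

locale finite_valuation_ring = cring R for R (structure) +
  assumes finite_carrier: "finite (carrier R)"
    and local_ring: "\<exists>!M. maximalideal M R"
    and principal_ring: "\<And>I. ideal I R \<Longrightarrow> principalideal I R"

definition uniformizer :: "('a, 'm) ring_scheme \<Rightarrow> 'a \<Rightarrow> bool" where
  "uniformizer R p \<longleftrightarrow> p \<in> carrier R \<and> maximalideal (PIdl\<^bsub>R\<^esub> p) R"

definition nilpotency_degree :: "('a, 'm) ring_scheme \<Rightarrow> 'a \<Rightarrow> nat" where
  "nilpotency_degree R p = (LEAST k. 0 < k \<and> p [^]\<^bsub>R\<^esub> k = \<zero>\<^bsub>R\<^esub>)"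

section \<open>Unimodular tuples\<close>

definition dot :: "('a, 'm) ring_scheme \<Rightarrow> nat \<Rightarrow> (nat \<Rightarrow> 'a) \<Rightarrow> (nat \<Rightarrow> 'a) \<Rightarrow> 'a" where
  "dot R n a b = (\<Oplus>\<^bsub>R\<^esub>i\<in>{..<n}. a i \<otimes>\<^bsub>R\<^esub> b i)"

definition unimodular :: "('a, 'm) ring_scheme \<Rightarrow> nat \<Rightarrow> (nat \<Rightarrow> 'a) set" where
  "unimodular R n = {a \<in> {..<n} \<rightarrow>\<^sub>E carrier R. Idl\<^bsub>R\<^esub> (a ` {..<n}) = carrier R}"

definition unit_multiples :: "('a, 'm) ring_scheme \<Rightarrow> nat \<Rightarrow> (nat \<Rightarrow> 'a) rel" where
  "unit_multiples R n =
     {(a, b). a \<in> unimodular R n \<and> b \<in> unimodular R n \<and>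
              (\<exists>u\<in>Units R. b = (\<lambda>i\<in>{..<n}. u \<otimes>\<^bsub>R\<^esub> a i))}"

section \<open>Bipartite graphs\<close>

text \<open>Undirected graphs are symmetric digraphs. The two copies of the vertex set
  are tagged by \<^const>\<open>Inl\<close> (for the bullet copy) and \<^const>\<open>Inr\<close> (for the circle copy).\<close>

definition bipartite_graph :: "'v set \<Rightarrow> 'v rel \<Rightarrow> ('v + 'v) pair_pre_digraph" where
  "bipartite_graph V E =
     \<lparr>pverts = V <+> V,
      parcs = {(Inl a, Inr b) | a b. (a, b) \<in> E} \<union> {(Inr b, Inl a) | a b. (a, b) \<in> E}\<rparr>"

definition half_size :: "('v + 'v) pair_pre_digraph \<Rightarrow> nat" where
  "half_size G = card {a. Inl a \<in> pverts G}"

definition Um :: "('a, 'm) ring_scheme \<Rightarrow> nat \<Rightarrow>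
    ((nat \<Rightarrow> 'a) + (nat \<Rightarrow> 'a)) pair_pre_digraph" where
  "Um R n = bipartite_graph (unimodular R n)
     {(a, b). a \<in> unimodular R n \<and> b \<in> unimodular R n \<and> dot R n a b = \<one>\<^bsub>R\<^esub>}"

definition Um0 :: "('a, 'm) ring_scheme \<Rightarrow> nat \<Rightarrow>
    ((nat \<Rightarrow> 'a) set + (nat \<Rightarrow> 'a) set) pair_pre_digraph" where
  "Um0 R n = bipartite_graph (unimodular R n // unit_multiples R n)
     {(unit_multiples R n `` {a}, unit_multiples R n `` {b}) | a b.
        a \<in> unimodular R n \<and> b \<in> unimodular R n \<and> dot R n a b = \<zero>\<^bsub>R\<^esub>}"

section \<open>Regularity, diameter, Cayley graphs\<close>

definition regular_of_degree :: "'v pair_pre_digraph \<Rightarrow> nat \<Rightarrow> bool" where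
  "regular_of_degree G d \<longleftrightarrow> (\<forall>v\<in>pverts G. out_degree (with_proj G) v = d)"

text \<open>With all arc weights equal to 1, the cost of a walk is its length, so the shortest-path
  cost is the graph distance; it is infinite between different components.\<close>

definition graph_diameter :: "'v pair_pre_digraph \<Rightarrow> ereal" where
  "graph_diameter G =
     (SUP u\<in>pverts G. SUP v\<in>pverts G. wf_digraph.\<mu> (with_proj G) (\<lambda>_. 1) u v)"

definition cayley_graph :: "('g, 'm) monoid_scheme \<Rightarrow> 'g set \<Rightarrow> 'g pair_pre_digraph" where
  "cayley_graph H S =
     \<lparr>pverts = carrier H,
      parcs = {(x, y). x \<in> carrier H \<and> y \<in> carrier H \<and> inv\<^bsub>H\<^esub> x \<otimes>\<^bsub>H\<^esub> y \<in> S}\<rparr>"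

text \<open>Taking the elements of the group from the vertex type is no restriction: a group structure
  can be transported along the bijection with the vertex set. The connection set is not required
  to generate the group; requiring it would amount to connectedness of the graph.\<close>

definition is_cayley_graph :: "'v pair_pre_digraph \<Rightarrow> bool" where
  "is_cayley_graph G \<longleftrightarrow>
     (\<exists>(H :: 'v monoid) S. group H \<and> S \<subseteq> carrier H \<and> \<one>\<^bsub>H\<^esub> \<notin> S \<and> (\<forall>s\<in>S. inv\<^bsub>H\<^esub> s \<in> S) \<and>
        digraph_iso (with_proj G) (with_proj (cayley_graph H S)))"

end

theory Submission
  imports Defs "HOL-Algebra.Algebraic_Closure" "HOL-Algebra.Multiplicative_Group"
begin

text \<open>Counting is done by solving \<open>a \<bullet> b = t\<close> for a coordinate of \<open>b\<close> at which \<open>a\<close> is a unit,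
  and the distances come from explicit tuples supported on at most three coordinates.

  For the Cayley property, lift a monic irreducible polynomial \<open>f\<close> of degree \<open>n\<close> over the residue
  field to \<open>R\<close>. The ring \<open>S = R[X]/(f)\<close> is \<open>R\<^sup>n\<close> as a module, and since \<open>S/\<pi>S\<close> is a field, the unit
  group of \<open>S\<close> is exactly the set of unimodular tuples. The dot product becomes \<open>\<phi>(a y)\<close> for
  a linear functional \<open>\<phi>\<close>, after a linear change of coordinates in the second argument. Hence the
  generalized dihedral group of \<open>S\<^sup>\<times>\<close> acts regularly on the vertices of \<open>Um\<close>, the reflections
  exchanging the two sides, and that of \<open>S\<^sup>\<times>/R\<^sup>\<times>\<close> acts regularly on the vertices of \<open>Um\<^sub>0\<close>.\<close>

section \<open>Finite fields of prescribed degree\<close>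

text \<open>The residue field is the only source for \<open>f\<close>: it is the minimal polynomial
  of a generator of the multiplicative group of the fixed field of x^(q^n) in an algebraic closure.
  One consequence of irreducibility carries the argument: the product of two unimodular tuples is
  unimodular. The rest follows from finiteness and from writing each nonzero tuple as \<pi>^k times
  a unimodular one. Multiplication by a unimodular tuple is injective, hence bijective, which
  provides inverses; and the form "constant coefficient of a y" is nondegenerate, because y =
  \<pi>^k u is detected by the inverse of u. The dihedral group reconciles two shapes: an edge is a
  condition on a product a y, whereas a Cayley graph looks at x^(-1) y. Inverting the elements on
  one side matches them, and reflections are involutions, so the connection set is closed under
  inverses. Oddness of q enters as 1 != -1: two opposite basis tuples are then distinct vertices of
  \<open>Um\<close> without a common neighbour, which rules out diameter below 4.\<close>

text \<open>The index bounds the degree strictly: \<open>poly_fun d f\<close> means that \<open>f\<close> is given by a polynomial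
  of degree less than \<open>d\<close>.\<close>

primrec (in ring) poly_fun :: "nat \<Rightarrow> ('a \<Rightarrow> 'a) \<Rightarrow> bool" where
  "poly_fun 0 f \<longleftrightarrow> (\<forall>x\<in>carrier R. f x = \<zero>)"
| "poly_fun (Suc d) f \<longleftrightarrow>
     (\<exists>c\<in>carrier R. \<exists>g. poly_fun d g \<and> (\<forall>x\<in>carrier R. f x = c \<oplus> x \<otimes> g x))"

section \<open>Arithmetic of polynomial functions\<close>

context cring
begin

lemma poly_fun_closed:
  "poly_fun d f \<Longrightarrow> x \<in> carrier R \<Longrightarrow> f x \<in> carrier R"
  by (induction d arbitrary: f) auto

lemma poly_fun_cong:
  "poly_fun d f \<Longrightarrow> (\<And>x. x \<in> carrier R \<Longrightarrow> g x = f x) \<Longrightarrow> poly_fun d g"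
  by (cases d) auto

lemma poly_fun_Suc: "poly_fun d f \<Longrightarrow> poly_fun (Suc d) f"
proof (induction d arbitrary: f)
  case 0
  then show ?case by (auto intro!: bexI[of _ \<zero>] exI[of _ "\<lambda>_. \<zero>"])
next
  case (Suc d)
  then obtain c g where "c \<in> carrier R" "poly_fun d g" "\<forall>x\<in>carrier R. f x = c \<oplus> x \<otimes> g x"
    by auto
  with Suc.IH[of g] show ?case by (subst poly_fun.simps) blast
qed

lemma poly_fun_mono: "poly_fun d f \<Longrightarrow> d \<le> e \<Longrightarrow> poly_fun e f"
  by (induction e rule: nat_induct) (auto simp: le_Suc_eq intro: poly_fun_Suc simp del: poly_fun.simps(2))

lemma poly_fun_add:
  "poly_fun d f \<Longrightarrow> poly_fun d g \<Longrightarrow> poly_fun d (\<lambda>x. f x \<oplus> g x)"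
proof (induction d arbitrary: f g)
  case (Suc d)
  then obtain c f' e g' where *: "c \<in> carrier R" "poly_fun d f'"
      "\<forall>x\<in>carrier R. f x = c \<oplus> x \<otimes> f' x"
      "e \<in> carrier R" "poly_fun d g'" "\<forall>x\<in>carrier R. g x = e \<oplus> x \<otimes> g' x"
    by auto
  have "f x \<oplus> g x = (c \<oplus> e) \<oplus> x \<otimes> (f' x \<oplus> g' x)" if "x \<in> carrier R" for x
  proof -
    have "f' x \<in> carrier R" "g' x \<in> carrier R"
      using * that poly_fun_closed by auto
    moreover have "f x = c \<oplus> x \<otimes> f' x" "g x = e \<oplus> x \<otimes> g' x"
      using * that by auto
    ultimately show ?thesis using *(1,4) that by (simp only:) algebra
  qed
  moreover have "c \<oplus> e \<in> carrier R" using * by auto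
  ultimately show ?case using Suc.IH[OF *(2) *(5)] by (subst poly_fun.simps) blast
qed auto

lemma poly_fun_scale:
  "poly_fun d f \<Longrightarrow> a \<in> carrier R \<Longrightarrow> poly_fun d (\<lambda>x. a \<otimes> f x)"
proof (induction d arbitrary: f)
  case (Suc d)
  then obtain c f' where *: "c \<in> carrier R" "poly_fun d f'"
      "\<forall>x\<in>carrier R. f x = c \<oplus> x \<otimes> f' x"
    by auto
  have "a \<otimes> f x = (a \<otimes> c) \<oplus> x \<otimes> (a \<otimes> f' x)" if "x \<in> carrier R" for x
  proof -
    have "f' x \<in> carrier R" using * that poly_fun_closed by auto
    moreover have "f x = c \<oplus> x \<otimes> f' x" using * that by auto
    ultimately show ?thesis using *(1) Suc.prems that by (simp only:) algebra
  qed
  moreover have "a \<otimes> c \<in> carrier R" using * Suc.prems by auto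
  ultimately show ?case using Suc.IH[OF *(2) Suc.prems(2)] by (subst poly_fun.simps) blast
qed auto

lemma poly_fun_const: "c \<in> carrier R \<Longrightarrow> poly_fun (Suc d) (\<lambda>_. c)"
proof (rule poly_fun_mono[of 1])
  assume c: "c \<in> carrier R"
  have "poly_fun 0 (\<lambda>_. \<zero>)" "\<forall>x\<in>carrier R. c = c \<oplus> x \<otimes> \<zero>"
    using c by auto
  with c show "poly_fun 1 (\<lambda>_. c)"
    unfolding One_nat_def poly_fun.simps(2) by blast
qed auto

lemma poly_fun_times_var: "poly_fun d f \<Longrightarrow> poly_fun (Suc d) (\<lambda>x. x \<otimes> f x)"
proof -
  assume f: "poly_fun d f"
  then have "\<forall>x\<in>carrier R. x \<otimes> f x = \<zero> \<oplus> x \<otimes> f x"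
    using poly_fun_closed by auto
  with f show ?thesis unfolding poly_fun.simps(2) by blast
qed

lemma poly_fun_times_linear:
  assumes "poly_fun d f" "a \<in> carrier R"
  shows "poly_fun (Suc d) (\<lambda>x. (x \<oplus> a) \<otimes> f x)"
  by (rule poly_fun_cong[OF poly_fun_add[OF poly_fun_times_var[OF assms(1)]
        poly_fun_Suc[OF poly_fun_scale[OF assms]]]])
     (use assms poly_fun_closed in \<open>auto simp: l_distr\<close>)

lemma poly_fun_power: "poly_fun (Suc d) (\<lambda>x. x [^] d)"
proof (induction d)
  case 0
  then show ?case using poly_fun_const[of \<one> 0] by simp
next
  case (Suc d)
  show ?case
    by (rule poly_fun_cong[OF poly_fun_times_var[OF Suc.IH]]) (auto simp: m_comm)
qed

text \<open>Division by x - a with remainder f(a), performed along the Horner form: if f = c + x g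
  and g = g(a) + (x - a) h, then the quotient of f is g + a h.\<close>

lemma poly_fun_factor:
  assumes "poly_fun (Suc d) f" "a \<in> carrier R"
  shows "\<exists>g. poly_fun d g \<and> (\<forall>x\<in>carrier R. f x = f a \<oplus> (x \<ominus> a) \<otimes> g x)"
  using assms(1)
proof (induction d arbitrary: f)
  case 0
  then obtain c g where "c \<in> carrier R" "\<forall>x\<in>carrier R. g x = \<zero>"
      "\<forall>x\<in>carrier R. f x = c \<oplus> x \<otimes> g x" by auto
  then show ?case using assms(2) by (intro exI[of _ "\<lambda>_. \<zero>"]) auto
next
  case (Suc d)
  then obtain c g where *: "c \<in> carrier R" "poly_fun (Suc d) g"
      "\<forall>x\<in>carrier R. f x = c \<oplus> x \<otimes> g x" by (metis poly_fun.simps(2))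
  then obtain h where h: "poly_fun d h" "\<forall>x\<in>carrier R. g x = g a \<oplus> (x \<ominus> a) \<otimes> h x"
    using Suc.IH by blast
  have "f x = f a \<oplus> (x \<ominus> a) \<otimes> (g x \<oplus> a \<otimes> h x)" if "x \<in> carrier R" for x
  proof -
    have cl: "g a \<in> carrier R" "h x \<in> carrier R"
      using * h(1) that assms(2) poly_fun_closed by auto
    have "g x = g a \<oplus> (x \<ominus> a) \<otimes> h x" "f x = c \<oplus> x \<otimes> g x" "f a = c \<oplus> a \<otimes> g a"
      using h(2) that * assms(2) by blast+
    moreover have "c \<oplus> x \<otimes> (u \<oplus> (x \<ominus> a) \<otimes> v)
        = (c \<oplus> a \<otimes> u) \<oplus> (x \<ominus> a) \<otimes> ((u \<oplus> (x \<ominus> a) \<otimes> v) \<oplus> a \<otimes> v)"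
      if "u \<in> carrier R" "v \<in> carrier R" for u v
      using that \<open>x \<in> carrier R\<close> *(1) assms(2) by algebra
    ultimately show ?thesis using cl by metis
  qed
  moreover have "poly_fun (Suc d) (\<lambda>x. g x \<oplus> a \<otimes> h x)"
    by (intro poly_fun_add[OF *(2)] poly_fun_Suc poly_fun_scale h assms)
  ultimately show ?case by blast
qed

end

text \<open>A root a splits off a factor x - a, and in a domain the quotient, whose index is one
  less, vanishes on the remaining roots. The strict degree bound in \<open>poly_fun\<close> is why
  \<open>d\<close> roots suffice for index \<open>d\<close>.\<close>

lemma (in domain) poly_fun_eq_zero:
  assumes "poly_fun d f" "finite Z" "Z \<subseteq> carrier R" "d \<le> card Z"
    and "\<And>z. z \<in> Z \<Longrightarrow> f z = \<zero>" and "x \<in> carrier R"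
  shows "f x = \<zero>"
  using assms
proof (induction d arbitrary: f Z x)
  case (Suc d)
  then obtain a where a: "a \<in> Z" by fastforce
  then have aR: "a \<in> carrier R" using Suc.prems by auto
  obtain g where g: "poly_fun d g" "\<forall>x\<in>carrier R. f x = f a \<oplus> (x \<ominus> a) \<otimes> g x"
    using poly_fun_factor[OF Suc.prems(1) aR] by blast
  have fg: "f y = (y \<ominus> a) \<otimes> g y" if "y \<in> carrier R" for y
  proof -
    have "f y = f a \<oplus> (y \<ominus> a) \<otimes> g y" using g(2) that by blast
    then show ?thesis
      using that aR Suc.prems(5)[OF a] poly_fun_closed[OF g(1) that] by simp
  qed
  have "g z = \<zero>" if "z \<in> Z - {a}" for z
  proof -
    have zR: "z \<in> carrier R" using that Suc.prems by auto
    have "(z \<ominus> a) \<otimes> g z = \<zero>" using fg[OF zR] that Suc.prems(5) by auto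
    moreover have "z \<ominus> a \<noteq> \<zero>" using that zR aR by auto
    ultimately show ?thesis
      using integral_iff zR aR poly_fun_closed[OF g(1) zR] by (metis minus_closed)
  qed
  moreover have "finite (Z - {a})" "Z - {a} \<subseteq> carrier R" "d \<le> card (Z - {a})"
    using Suc.prems(2-4) a by auto
  ultimately have "g x = \<zero>" using Suc.IH[OF g(1)] Suc.prems(6) by blast
  then show ?case using fg[OF Suc.prems(6)] Suc.prems(6) aR by simp
qed auto

text \<open>Here the index is the degree itself, while the lower part g has degree less than
  \<open>d\<close>. Two monic functions of the same degree thus differ by a \<open>poly_fun\<close>
  of that index, to which the root count applies with \<open>d\<close> roots.\<close>

definition (in ring) monic_fun :: "nat \<Rightarrow> ('a \<Rightarrow> 'a) \<Rightarrow> bool" where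
  "monic_fun d f \<longleftrightarrow> (\<exists>g. poly_fun d g \<and> (\<forall>x\<in>carrier R. f x = x [^] d \<oplus> g x))"

context cring
begin

lemma monic_fun_times_linear:
  assumes "monic_fun d f" "a \<in> carrier R"
  shows "monic_fun (Suc d) (\<lambda>x. (x \<oplus> a) \<otimes> f x)"
proof -
  obtain g where g: "poly_fun d g" "\<forall>x\<in>carrier R. f x = x [^] d \<oplus> g x"
    using assms unfolding monic_fun_def by blast
  have "(x \<oplus> a) \<otimes> f x = x [^] Suc d \<oplus> (a \<otimes> x [^] d \<oplus> (x \<oplus> a) \<otimes> g x)"
    if x: "x \<in> carrier R" for x
  proof -
    have "g x \<in> carrier R" "x [^] d \<in> carrier R" using g x poly_fun_closed by auto
    moreover have "f x = x [^] d \<oplus> g x" using g x by auto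
    ultimately show ?thesis using x assms(2) by (simp only: nat_pow_Suc) algebra
  qed
  moreover have "poly_fun (Suc d) (\<lambda>x. a \<otimes> x [^] d \<oplus> (x \<oplus> a) \<otimes> g x)"
    by (intro poly_fun_add poly_fun_scale poly_fun_power poly_fun_times_linear g assms)
  ultimately show ?thesis unfolding monic_fun_def by blast
qed

lemma monic_fun_linear_power:
  assumes "a \<in> carrier R"
  shows "monic_fun d (\<lambda>x. (x \<oplus> a) [^] d)"
proof (induction d)
  case 0
  show ?case unfolding monic_fun_def by (auto intro!: exI[of _ "\<lambda>_. \<zero>"])
next
  case (Suc d)
  from monic_fun_times_linear[OF this assms] show ?case
    using assms unfolding monic_fun_def by (auto simp: m_comm)
qed

lemma monic_fun_finprod:
  assumes "finite Z" "Z \<subseteq> carrier R"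
  shows "monic_fun (card Z) (\<lambda>x. \<Otimes>c\<in>Z. x \<ominus> c)"
  using assms
proof (induction Z rule: finite_induct)
  case empty
  show ?case unfolding monic_fun_def by (auto intro!: exI[of _ "\<lambda>_. \<zero>"])
next
  case (insert a Z)
  have "(\<Otimes>c\<in>insert a Z. x \<ominus> c) = (x \<oplus> \<ominus> a) \<otimes> (\<Otimes>c\<in>Z. x \<ominus> c)"
    if "x \<in> carrier R" for x
    using insert that by (subst finprod_insert) (auto simp: minus_eq)
  moreover have "monic_fun (card (insert a Z)) (\<lambda>x. (x \<oplus> \<ominus> a) \<otimes> (\<Otimes>c\<in>Z. x \<ominus> c))"
    using insert monic_fun_times_linear[of "card Z" _ "\<ominus> a"] by auto
  ultimately show ?case unfolding monic_fun_def by auto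
qed

lemma monic_fun_diff:
  assumes "monic_fun d f" "monic_fun d g"
  shows "poly_fun d (\<lambda>x. f x \<ominus> g x)"
proof -
  obtain f' g' where *: "poly_fun d f'" "\<forall>x\<in>carrier R. f x = x [^] d \<oplus> f' x"
     "poly_fun d g'" "\<forall>x\<in>carrier R. g x = x [^] d \<oplus> g' x"
    using assms unfolding monic_fun_def by blast
  show ?thesis
  proof (rule poly_fun_cong[OF poly_fun_add[OF *(1) poly_fun_scale[OF *(3), of "\<ominus> \<one>"]]])
    fix x assume x: "x \<in> carrier R"
    have "f' x \<in> carrier R" "g' x \<in> carrier R" "x [^] d \<in> carrier R"
      using * x poly_fun_closed by auto
    moreover have "f x = x [^] d \<oplus> f' x" "g x = x [^] d \<oplus> g' x" using * x by auto
    ultimately show "f x \<ominus> g x = f' x \<oplus> \<ominus> \<one> \<otimes> g' x" by (simp only:) algebra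
  qed auto
qed

end

section \<open>The q-th power map for a finite subfield of order q\<close>

lemma (in field) finite_subfield_pow_card:
  assumes "subfield K R" "finite K" "c \<in> K"
  shows "c [^] card K = c"
proof -
  interpret K: field "R\<lparr>carrier := K\<rparr>" using subfield_iff(2)[OF assms(1)] .
  have KR: "K \<subseteq> carrier R" using subfieldE(3)[OF assms(1)] .
  have pos: "card K > 0" using assms by (auto simp: card_gt_0_iff)
  show ?thesis
  proof (cases "c = \<zero>")
    case True
    then show ?thesis using pos by (simp add: nat_pow_zero)
  next
    case False
    interpret G: group "Multiplicative_Group.mult_of (R\<lparr>carrier := K\<rparr>)" by (rule K.field_mult_group)
    have "order (Multiplicative_Group.mult_of (R\<lparr>carrier := K\<rparr>)) = card K - 1"
      using K.order_mult_of assms by (simp add: order_def)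
    then have "c [^]\<^bsub>R\<lparr>carrier := K\<rparr>\<^esub> (card K - 1) = \<one>"
      using G.pow_order_eq_1[of c] False assms by (simp add: Multiplicative_Group.nat_pow_mult_of)
    then have "c [^] (card K - 1) = \<one>" by (simp add: nat_pow_def)
    then show ?thesis using pos KR assms(3) by (metis Suc_diff_1 l_one nat_pow_Suc subsetD)
  qed
qed

text \<open>For \<open>c \<in> K\<close>, the polynomial \<open>x\<^sup>q - x = (\<Prod>c\<in>K. x - c)\<close> is invariant under translation by \<open>c\<close>,
  which is the claim for \<open>y \<in> K\<close>. In general the difference of the two sides is a polynomial in \<open>y\<close>
  of degree less than \<open>q\<close> with the \<open>q\<close> roots \<open>K\<close>.\<close>

lemma (in field) frobenius_add:
  assumes K: "subfield K R" "finite K" and x: "x \<in> carrier R" and y: "y \<in> carrier R"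
  shows "(x \<oplus> y) [^] card K = x [^] card K \<oplus> y [^] card K"
proof -
  let ?q = "card K"
  have KR: "K \<subseteq> carrier R" using subfieldE(3)[OF K(1)] .
  have K01: "\<zero> \<in> K" "\<one> \<in> K" "\<And>a b. a \<in> K \<Longrightarrow> b \<in> K \<Longrightarrow> a \<oplus> b \<in> K" "\<And>a. a \<in> K \<Longrightarrow> \<ominus> a \<in> K"
    using subringE[OF subfieldE(1)[OF K(1)]] by auto
  have "card {\<zero>, \<one>} \<le> ?q" using K01 K(2) by (intro card_mono) auto
  then have q2: "2 \<le> ?q" by simp
  have prod: "x [^] ?q \<ominus> x = (\<Otimes>c\<in>K. x \<ominus> c)" if x: "x \<in> carrier R" for x
  proof -
    have m: "monic_fun ?q (\<lambda>x. x [^] ?q \<ominus> x)"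
    proof -
      have "poly_fun ?q (\<lambda>x. \<ominus> \<one> \<otimes> x [^] (1::nat))"
        by (rule poly_fun_mono[OF poly_fun_scale[OF poly_fun_power]]) (use q2 in auto)
      moreover have "x [^] ?q \<ominus> x = x [^] ?q \<oplus> \<ominus> \<one> \<otimes> x [^] (1::nat)" if "x \<in> carrier R" for x
        using that by (simp add: minus_eq l_minus)
      ultimately show ?thesis unfolding monic_fun_def by blast
    qed
    \<comment> \<open>Both sides are monic of degree q, and both vanish on the q elements of
      \<open>K\<close>.\<close>
    have "(x [^] ?q \<ominus> x) \<ominus> (\<Otimes>c\<in>K. x \<ominus> c) = \<zero>"
    proof (rule poly_fun_eq_zero[OF monic_fun_diff[OF m monic_fun_finprod[OF K(2) KR]] K(2) KR _ _ x])
      fix z assume z: "z \<in> K"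
      then have zR: "z \<in> carrier R" using KR by auto
      have "(\<Otimes>c\<in>K. z \<ominus> c) = (z \<ominus> z) \<otimes> (\<Otimes>c\<in>K - {z}. z \<ominus> c)"
        using finprod_insert[of "K - {z}" z "\<lambda>c. z \<ominus> c"] K(2) KR z zR
        by (auto simp: insert_absorb)
      also have "\<dots> = \<zero>"
      proof -
        have "(\<Otimes>c\<in>K - {z}. z \<ominus> c) \<in> carrier R" using zR KR by (intro finprod_closed) auto
        then show ?thesis using zR by (simp add: a_minus_def r_neg)
      qed
      finally show "(z [^] ?q \<ominus> z) \<ominus> (\<Otimes>c\<in>K. z \<ominus> c) = \<zero>"
        using finite_subfield_pow_card[OF K z] zR by simp
    qed simp
    then show ?thesis using x KR by (subst (asm) r_right_minus_eq) (auto intro!: finprod_closed)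
  qed
  have step: "(x \<oplus> c) [^] ?q = x [^] ?q \<oplus> c" if x: "x \<in> carrier R" and c: "c \<in> K" for x c
  proof -
    have cR: "c \<in> carrier R" using c KR by auto
    have inj: "inj_on (\<lambda>d. d \<oplus> c) K"
      using cR KR unfolding inj_on_def by (metis add.r_cancel subsetD)
    have "d \<in> (\<lambda>d. d \<oplus> c) ` K" if "d \<in> K" for d
    proof
      show "d \<oplus> \<ominus> c \<in> K" using that c K01 by auto
      show "d = d \<oplus> \<ominus> c \<oplus> c" using that cR KR by (simp add: a_assoc l_neg subsetD)
    qed
    then have im: "(\<lambda>d. d \<oplus> c) ` K = K" using c K01 by auto
    have "(x \<oplus> c) [^] ?q \<ominus> (x \<oplus> c) = (\<Otimes>d\<in>(\<lambda>d. d \<oplus> c) ` K. (x \<oplus> c) \<ominus> d)"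
      using prod[of "x \<oplus> c"] x cR by (simp add: im)
    also have "\<dots> = (\<Otimes>d\<in>K. (x \<oplus> c) \<ominus> (d \<oplus> c))"
      by (rule finprod_reindex[OF _ inj]) (use x cR KR in auto)
    also have "\<dots> = (\<Otimes>d\<in>K. x \<ominus> d)"
    proof (rule finprod_cong')
      fix d assume "d \<in> K"
      then have "d \<in> carrier R" using KR by auto
      then show "(x \<oplus> c) \<ominus> (d \<oplus> c) = x \<ominus> d" using x cR by algebra
    qed (use x KR in auto)
    also have "\<dots> = x [^] ?q \<ominus> x" using prod[OF x] by simp
    finally have e: "(x \<oplus> c) [^] ?q \<ominus> (x \<oplus> c) = x [^] ?q \<ominus> x" .
    have cl: "(x \<oplus> c) [^] ?q \<in> carrier R" "x [^] ?q \<in> carrier R" using x cR by auto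
    have "(x \<oplus> c) [^] ?q = ((x \<oplus> c) [^] ?q \<ominus> (x \<oplus> c)) \<oplus> (x \<oplus> c)"
      using cl x cR by algebra
    also have "\<dots> = x [^] ?q \<oplus> c" unfolding e using cl x cR by algebra
    finally show ?thesis .
  qed
  have "(y \<oplus> x) [^] ?q \<ominus> (y [^] ?q \<oplus> x [^] ?q) = \<zero>"
  proof (rule poly_fun_eq_zero[OF monic_fun_diff[OF monic_fun_linear_power[OF x]] K(2) KR order.refl _ y])
    obtain q' where q': "?q = Suc q'" using q2 by (cases ?q) auto
    show "monic_fun ?q (\<lambda>y. y [^] ?q \<oplus> x [^] ?q)"
      unfolding monic_fun_def
      by (rule exI[of _ "\<lambda>_. x [^] ?q"]) (use poly_fun_const[of "x [^] ?q" q'] q' x in auto)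
  next
    fix z assume z: "z \<in> K"
    then have "z \<in> carrier R" using KR by auto
    then show "(z \<oplus> x) [^] ?q \<ominus> (z [^] ?q \<oplus> x [^] ?q) = \<zero>"
      using step[OF x z] finite_subfield_pow_card[OF K z] x by (simp add: a_comm)
  qed
  then show ?thesis using x y by (subst (asm) r_right_minus_eq) (auto simp: a_comm)
qed

text \<open>Lagrange in the additive group of \<open>K\<close>. This form of "the characteristic
  divides q" is all that the derivative of X^(q^n) - X requires; no prime has to be named.\<close>

lemma (in field) finite_subfield_card_eq_zero:
  assumes "subfield K R" "finite K"
  shows "[card K] \<cdot> \<one> = \<zero>"
proof -
  interpret K: field "R\<lparr>carrier := K\<rparr>" using subfield_iff(2)[OF assms(1)] .
  have "[card K] \<cdot>\<^bsub>R\<lparr>carrier := K\<rparr>\<^esub> \<one> = \<zero>"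
    using K.add.pow_order_eq_1[of \<one>] subfieldE(1)[OF assms(1)]
    by (simp add: order_def subringE(3) add_pow_def)
  then show ?thesis by (simp add: add_pow_def nat_pow_def)
qed

text \<open>Taylor expansion at \<open>y\<close> to second order, used in a polynomial ring with
  \<open>x\<close> the variable and \<open>y\<close> a constant. It takes the place of a formal
  derivative in the test for double roots.\<close>

lemma (in cring) nat_pow_Suc_expansion:
  assumes x: "x \<in> carrier R" and y: "y \<in> carrier R"
  shows "\<exists>Q\<in>carrier R. x [^] Suc N =
    y [^] Suc N \<oplus> ([Suc N] \<cdot> (y [^] N)) \<otimes> (x \<ominus> y) \<oplus> (x \<ominus> y) \<otimes> (x \<ominus> y) \<otimes> Q"
proof (induction N)
  case 0
  have "x = y \<oplus> \<one> \<otimes> (x \<ominus> y) \<oplus> (x \<ominus> y) \<otimes> (x \<ominus> y) \<otimes> \<zero>"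
    using x y by algebra
  then show ?case using x y by (intro bexI[of _ \<zero>]) auto
next
  case (Suc N)
  then obtain Q where Q: "Q \<in> carrier R" "x [^] Suc N =
      y [^] Suc N \<oplus> ([Suc N] \<cdot> (y [^] N)) \<otimes> (x \<ominus> y) \<oplus> (x \<ominus> y) \<otimes> (x \<ominus> y) \<otimes> Q"
    by blast
  let ?A = "[Suc N] \<cdot> (y [^] N)" and ?Y = "y [^] Suc N"
  have cl: "?A \<in> carrier R" "?Y \<in> carrier R" using y by auto
  have "[Suc (Suc N)] \<cdot> ?Y = [Suc N] \<cdot> ?Y \<oplus> ?Y" using cl by simp
  also have "[Suc N] \<cdot> ?Y = ?A \<otimes> y" using add_pow_ldistr[of "y [^] N" y "Suc N"] y by simp
  finally have mult: "[Suc (Suc N)] \<cdot> ?Y = ?A \<otimes> y \<oplus> ?Y" .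
  have "x [^] Suc (Suc N) = x [^] Suc N \<otimes> x" by simp
  also have "\<dots> = (?Y \<oplus> ?A \<otimes> (x \<ominus> y) \<oplus> (x \<ominus> y) \<otimes> (x \<ominus> y) \<otimes> Q) \<otimes> x"
    using Q(2) by simp
  also have "\<dots> = ?Y \<otimes> y \<oplus> (?A \<otimes> y \<oplus> ?Y) \<otimes> (x \<ominus> y)
      \<oplus> (x \<ominus> y) \<otimes> (x \<ominus> y) \<otimes> (?A \<oplus> Q \<otimes> x)"
  proof -
    have "(Y \<oplus> A \<otimes> D \<oplus> D \<otimes> D \<otimes> Q) \<otimes> (y \<oplus> D)
        = Y \<otimes> y \<oplus> (A \<otimes> y \<oplus> Y) \<otimes> D \<oplus> D \<otimes> D \<otimes> (A \<oplus> Q \<otimes> (y \<oplus> D))"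
      if "A \<in> carrier R" "Y \<in> carrier R" "D \<in> carrier R" for A Y D
      using that y Q(1) by algebra
    moreover have "y \<oplus> (x \<ominus> y) = x" using x y by algebra
    ultimately show ?thesis using cl x y by (metis minus_closed)
  qed
  also have "\<dots> = y [^] Suc (Suc N) \<oplus> ([Suc (Suc N)] \<cdot> ?Y) \<otimes> (x \<ominus> y)
      \<oplus> (x \<ominus> y) \<otimes> (x \<ominus> y) \<otimes> (?A \<oplus> Q \<otimes> x)"
    unfolding mult by simp
  finally show ?case using cl x Q(1) by (intro bexI[of _ "?A \<oplus> Q \<otimes> x"]) auto
qed

lemma (in cring) add_pow_eq_zero:
  assumes "[N] \<cdot> \<one> = \<zero>" "x \<in> carrier R"
  shows "[(N::nat)] \<cdot> x = \<zero>"
  using add_pow_ldistr[of \<one> x N] assms by simp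

text \<open>The roots of \<open>X\<^sup>M - X\<close> are simple, because its derivative is \<open>-1\<close>.\<close>

lemma (in algebraically_closed) card_fixed_points_pow:
  assumes M: "1 < M" and char: "[M] \<cdot> \<one>\<^bsub>L\<^esub> = \<zero>\<^bsub>L\<^esub>"
  shows "card {x \<in> carrier L. x [^] M = x} = M"
proof -
  interpret UP: domain "poly_ring L"
    using univ_poly_is_domain[OF carrier_is_subring] .
  interpret const: ring_hom_ring L "poly_ring L" poly_of_const
    using canonical_embedding_ring_hom[OF carrier_is_subring] by simp
  let ?U = "poly_ring L"
  have XU: "X \<in> carrier ?U" by (rule var_closed(1)[OF carrier_is_subring])
  have degX: "degree X = 1" by (simp add: var_def)
  define P where "P = X [^]\<^bsub>?U\<^esub> M \<oplus>\<^bsub>?U\<^esub> (\<ominus>\<^bsub>?U\<^esub> X)"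
  have PU: "P \<in> carrier ?U" unfolding P_def using XU by auto
  have "degree P = max (degree (X [^]\<^bsub>?U\<^esub> M)) (degree (\<ominus>\<^bsub>?U\<^esub> X))"
    unfolding P_def univ_poly_add
  proof (rule poly_add_degree_eq[OF carrier_is_subring])
    show "polynomial (carrier L) (X [^]\<^bsub>?U\<^esub> M)" "polynomial (carrier L) (\<ominus>\<^bsub>?U\<^esub> X)"
      using XU by (auto simp: univ_poly_carrier)
    show "degree (X [^]\<^bsub>?U\<^esub> M) \<noteq> degree (\<ominus>\<^bsub>?U\<^esub> X)"
      using polynomial_pow_degree[OF XU, of M] univ_poly_a_inv_degree[OF carrier_is_subring XU] M
      unfolding degX by auto
  qed
  then have degP: "degree P = M"
    using polynomial_pow_degree[OF XU, of M] univ_poly_a_inv_degree[OF carrier_is_subring XU] M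
    unfolding degX by auto
  then have Pne: "P \<noteq> []" using M by auto
  have evalP: "eval P a = a [^] M \<ominus> a" if a: "a \<in> carrier L" for a
  proof -
    interpret ev: ring_hom_ring ?U L "\<lambda>p. eval p a"
      by (rule eval_ring_hom[OF carrier_is_subring a])
    have "eval (X [^]\<^bsub>?U\<^esub> k) a = a [^] k" for k :: nat
      using XU eval_var[OF a] by (induction k) auto
    then show ?thesis unfolding P_def using XU eval_var[OF a] by (simp add: a_minus_def)
  qed
  have simple: "alg_mult P a \<le> 1" if a: "a \<in> carrier L" and root: "a [^] M = a" for a
  proof (rule ccontr)
    interpret ev: ring_hom_ring ?U L "\<lambda>p. eval p a"
      by (rule eval_ring_hom[OF carrier_is_subring a])
    let ?D = "[\<one>, \<ominus> a]" and ?A = "poly_of_const a"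
    have AU: "?A \<in> carrier ?U" using a by auto
    have DU: "?D \<in> carrier ?U"
      using a unfolding sym[OF univ_poly_carrier] polynomial_def by auto
    have "?D \<oplus>\<^bsub>?U\<^esub> ?A = X"
      using a unfolding univ_poly_add poly_of_const_def var_def by (auto simp: l_neg)
    then have D: "X \<ominus>\<^bsub>?U\<^esub> ?A = ?D" using AU DU UP.minus_eq UP.a_assoc UP.r_neg UP.r_zero
      by (metis UP.a_inv_closed)
    assume "\<not> alg_mult P a \<le> 1"
    then have "?D [^]\<^bsub>?U\<^esub> (2::nat) pdivides P"
      using le_alg_mult_imp_pdivides[OF a PU] by auto
    then obtain T where T: "T \<in> carrier ?U" "P = ?D \<otimes>\<^bsub>?U\<^esub> ?D \<otimes>\<^bsub>?U\<^esub> T"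
      using DU unfolding pdivides_def factor_def by (auto simp: numeral_2_eq_2)
    obtain N where N: "M = Suc N" using M by (cases M) auto
    obtain Q where Q: "Q \<in> carrier ?U" "X [^]\<^bsub>?U\<^esub> M = ?A [^]\<^bsub>?U\<^esub> M
        \<oplus>\<^bsub>?U\<^esub> ([M] \<cdot>\<^bsub>?U\<^esub> (?A [^]\<^bsub>?U\<^esub> N)) \<otimes>\<^bsub>?U\<^esub> ?D \<oplus>\<^bsub>?U\<^esub> ?D \<otimes>\<^bsub>?U\<^esub> ?D \<otimes>\<^bsub>?U\<^esub> Q"
      using UP.nat_pow_Suc_expansion[OF XU AU, of N] unfolding D N by blast
    have "[k] \<cdot>\<^bsub>?U\<^esub> \<one>\<^bsub>?U\<^esub> = poly_of_const ([k] \<cdot> \<one>)" for k :: nat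
      by (induction k) auto
    then have "[M] \<cdot>\<^bsub>?U\<^esub> \<one>\<^bsub>?U\<^esub> = \<zero>\<^bsub>?U\<^esub>" using char by simp
    then have zero: "[M] \<cdot>\<^bsub>?U\<^esub> (?A [^]\<^bsub>?U\<^esub> N) = \<zero>\<^bsub>?U\<^esub>"
      using UP.add_pow_eq_zero AU by blast
    have "?A [^]\<^bsub>?U\<^esub> k = poly_of_const (a [^] k)" for k :: nat
      using a by (induction k) auto
    then have AM: "?A [^]\<^bsub>?U\<^esub> M = ?A" using root by simp
    have XD: "X = ?D \<oplus>\<^bsub>?U\<^esub> ?A" using \<open>?D \<oplus>\<^bsub>?U\<^esub> ?A = X\<close> by simp
    \<comment> \<open>Since the linear term of the expansion of X^M vanishes and a^M = a, the
      polynomial \<open>P\<close> equals -(X - a) + (X - a)^2 Q. Cancelling one factor X - a against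
      P = (X - a)^2 T and evaluating at a then gives 0 = -1.\<close>
    have "P = (?A \<oplus>\<^bsub>?U\<^esub> \<zero>\<^bsub>?U\<^esub> \<otimes>\<^bsub>?U\<^esub> ?D \<oplus>\<^bsub>?U\<^esub> ?D \<otimes>\<^bsub>?U\<^esub> ?D \<otimes>\<^bsub>?U\<^esub> Q)
        \<oplus>\<^bsub>?U\<^esub> \<ominus>\<^bsub>?U\<^esub> (?D \<oplus>\<^bsub>?U\<^esub> ?A)"
      unfolding P_def using Q(2) zero AM XD by metis
    also have "\<dots> = ?D \<otimes>\<^bsub>?U\<^esub> (?D \<otimes>\<^bsub>?U\<^esub> Q \<ominus>\<^bsub>?U\<^esub> \<one>\<^bsub>?U\<^esub>)"
      using AU DU Q(1) by algebra
    finally have "?D \<otimes>\<^bsub>?U\<^esub> (?D \<otimes>\<^bsub>?U\<^esub> T) = ?D \<otimes>\<^bsub>?U\<^esub> (?D \<otimes>\<^bsub>?U\<^esub> Q \<ominus>\<^bsub>?U\<^esub> \<one>\<^bsub>?U\<^esub>)"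
      using T DU by (simp add: UP.m_assoc)
    then have "?D \<otimes>\<^bsub>?U\<^esub> T = ?D \<otimes>\<^bsub>?U\<^esub> Q \<ominus>\<^bsub>?U\<^esub> \<one>\<^bsub>?U\<^esub>"
      using DU T(1) Q(1) UP.m_lcancel[of ?D] by (auto simp: univ_poly_zero)
    then have "eval (?D \<otimes>\<^bsub>?U\<^esub> T) a = eval (?D \<otimes>\<^bsub>?U\<^esub> Q \<ominus>\<^bsub>?U\<^esub> \<one>\<^bsub>?U\<^esub>) a"
      by simp
    moreover have "eval ?D a = \<zero>" using a by (simp add: r_neg)
    ultimately have "\<zero> = \<ominus> \<one>"
      using DU T(1) Q(1) ev.hom_mult ev.hom_add ev.hom_closed ev.hom_a_inv
      by (simp del: eval.simps add: a_minus_def)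
    then show False using one_not_zero by (metis add.inv_eq_1_iff one_closed)
  qed
  have "x \<in># roots P \<longleftrightarrow> x \<in> carrier L \<and> x [^] M = x" for x
    using roots_mem_iff_is_root[OF PU, of x] evalP Pne unfolding is_root_def by auto
  then have set: "set_mset (roots P) = {x \<in> carrier L. x [^] M = x}" by auto
  \<comment> \<open>\<open>roots P\<close> is a multiset. Multiplicity one makes its size the number
    of distinct roots; algebraic closedness makes it the degree \<open>M\<close>.\<close>
  have "size (roots P) = (\<Sum>x\<in>set_mset (roots P). 1)"
    unfolding size_multiset_overloaded_eq
  proof (rule sum.cong)
    fix x assume x: "x \<in> set_mset (roots P)"
    then have "count (roots P) x \<le> 1"
      using simple set alg_mult_eq_count_roots[OF PU] by force
    with x show "count (roots P) x = 1"
      by (metis Suc_leI One_nat_def count_greater_zero_iff le_antisym)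
  qed simp
  moreover have "size (roots P) = M"
    using roots_over_carrier[OF PU] degP unfolding splitted_def by simp
  ultimately show ?thesis using set by simp
qed

section \<open>Extensions of prescribed degree of a finite field\<close>

lemma (in ring) card_Span_independent:
  assumes "subfield K R" "finite K" "independent K Us"
  shows "card (Span K Us) = card K ^ length Us"
proof -
  have "bij_betw (\<lambda>Ks. combine Ks Us) {Ks. set Ks \<subseteq> K \<and> length Ks = length Us} (Span K Us)"
  proof -
    have Span: "Span K Us = {combine Ks Us | Ks. length Ks = length Us \<and> set Ks \<subseteq> K}"
      by (rule Span_eq_combine_set_length_version[OF assms(1) independent_in_carrier[OF assms(3)]])
    have "Ks = Ks'" if "set Ks \<subseteq> K" "length Ks = length Us" "set Ks' \<subseteq> K" "length Ks' = length Us"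
        "combine Ks Us = combine Ks' Us" for Ks Ks'
      using unique_decomposition[OF assms(1,3), of "combine Ks Us"] that Span by blast
    then show ?thesis unfolding bij_betw_def inj_on_def Span by blast
  qed
  then show ?thesis using card_lists_length_eq[OF assms(2), of "length Us"] by (simp add: bij_betw_same_card[symmetric])
qed

lemma (in field) frobenius_pow_add:
  assumes K: "subfield K R" "finite K" and x: "x \<in> carrier R" and y: "y \<in> carrier R"
  shows "(x \<oplus> y) [^] (card K ^ n) = x [^] (card K ^ n) \<oplus> y [^] (card K ^ n)"
proof (induction n)
  case (Suc n)
  have pow: "z [^] (card K ^ Suc n) = (z [^] (card K ^ n)) [^] card K" if "z \<in> carrier R" for z
    using that by (simp add: nat_pow_pow mult.commute)
  show ?case using frobenius_add[OF K] Suc x y by (simp only: pow a_closed nat_pow_closed)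
qed (use x y in simp)

text \<open>The fixed points \<open>F\<close> of x^(q^n) number q^n because the roots of X^(q^n) - X
  are simple, and they form a field because that power map is additive. \<open>F\<close> is finite,
  so its multiplicative group is cyclic; a generator \<theta> satisfies K(\<theta>) = F. The powers
  of \<theta> below its degree form a basis of K(\<theta>) over \<open>K\<close>, and comparing
  orders identifies the degree as \<open>n\<close>.\<close>

lemma (in algebraic_closure) exists_Irr_degree:
  assumes fin: "finite K" and n: "0 < n"
  obtains \<theta> where "\<theta> \<in> carrier L" "degree (Irr K \<theta>) = n"
proof -
  have K: "subfield K L" by (rule subfield_axioms)
  let ?q = "card K" and ?M = "card K ^ n"
  have KL: "K \<subseteq> carrier L" using subfieldE(3)[OF K] .
  have K01: "\<zero> \<in> K" "\<one> \<in> K" "\<And>a. a \<in> K \<Longrightarrow> \<ominus> a \<in> K"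
    using subringE[OF subfieldE(1)[OF K]] by auto
  have "card {\<zero>, \<one>} \<le> ?q" using K01 fin by (intro card_mono) auto
  then have q2: "1 < ?q" by simp
  then have M1: "1 < ?M" using n one_less_power by blast
  have "[?M] \<cdot> \<one> = [(?q ^ (n - 1))] \<cdot> ([?q] \<cdot> \<one>)"
    using n by (simp add: add.nat_pow_pow power_eq_if)
  then have char: "[?M] \<cdot> \<one> = \<zero>" using finite_subfield_card_eq_zero[OF K fin] by simp
  define F where "F = {x \<in> carrier L. x [^] ?M = x}"
  have cardF: "card F = ?M" unfolding F_def by (rule card_fixed_points_pow[OF M1 char])
  then have finF: "finite F" using M1 by (intro card_ge_0_finite) linarith
  have KF: "K \<subseteq> F"
  proof
    fix c assume c: "c \<in> K"
    then have cL: "c \<in> carrier L" using KL by auto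
    have "c [^] (?q ^ k) = c" for k
    proof (induction k)
      case (Suc k)
      have "c [^] (?q ^ Suc k) = (c [^] (?q ^ k)) [^] ?q"
        using cL by (simp add: nat_pow_pow mult.commute)
      then show ?case using Suc finite_subfield_pow_card[OF K fin c] by simp
    qed (use cL in simp)
    then show "c \<in> F" using cL unfolding F_def by simp
  qed
  have F_mult: "x \<otimes> y \<in> F" if "x \<in> F" "y \<in> F" for x y
    using that unfolding F_def by (auto simp: nat_pow_distrib)
  have F_sub: "subfield F L"
  proof (rule subfieldI')
    show "subring F L"
    proof (rule subringI)
      show "F \<subseteq> carrier L" unfolding F_def by auto
      show "\<one> \<in> F" using K01(2) KF by blast
      show "\<ominus> x \<in> F" if "x \<in> F" for x
      proof -
        have "\<ominus> \<one> \<otimes> x \<in> F" using F_mult[OF _ that, of "\<ominus> \<one>"] K01 KF by blast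
        moreover have "x \<in> carrier L" using that unfolding F_def by auto
        ultimately show ?thesis by (simp add: l_minus)
      qed
      show "x \<otimes> y \<in> F" if "x \<in> F" "y \<in> F" for x y using F_mult[OF that] .
      show "x \<oplus> y \<in> F" if "x \<in> F" "y \<in> F" for x y
        using that frobenius_pow_add[OF K fin, of x y n] unfolding F_def by auto
    qed
    fix x assume x: "x \<in> F - {\<zero>}"
    then have xL: "x \<in> Units L" and xM: "x [^] ?M = x" unfolding F_def using field_Units by auto
    then have "inv x [^] ?M \<otimes> x = \<one>"
      using nat_pow_distrib[of "inv x" x ?M] by (metis Units_closed Units_inv_closed Units_l_inv nat_pow_one)
    then have "inv x [^] ?M = inv x"
      using xL by (metis Units_closed Units_inv_closed comm_inv_char inv_unique' m_comm nat_pow_closed)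
    then show "inv x \<in> F" using xL unfolding F_def by auto
  qed
  interpret F: field "L\<lparr>carrier := F\<rparr>" using subfield_iff(2)[OF F_sub] .
  obtain \<theta> where \<theta>: "\<theta> \<in> F - {\<zero>}"
      and gen: "F - {\<zero>} = {\<theta> [^]\<^bsub>L\<lparr>carrier := F\<rparr>\<^esub> i | i::nat. i \<in> UNIV}"
    using F.finite_field_mult_group_has_gen finF
    by (auto simp: Multiplicative_Group.nat_pow_mult_of)
  have gen': "F - {\<zero>} = {\<theta> [^] i | i::nat. i \<in> UNIV}"
    using gen by (simp add: nat_pow_def)
  have \<theta>L: "\<theta> \<in> carrier L" using \<theta> unfolding F_def by auto
  let ?E = "simple_extension K \<theta>"
  have E: "subring ?E L" using simple_extension_is_subring[OF subfieldE(1)[OF K] \<theta>L] .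
  have "?E \<subseteq> F"
    using simple_extension_subring_incl[OF subfieldE(1)[OF F_sub] KF] \<theta> by auto
  moreover have "F \<subseteq> ?E"
  proof
    fix x assume "x \<in> F"
    have "\<theta> \<in> ?E" using simple_extension_mem[OF subfieldE(1)[OF K] \<theta>L] .
    then have "\<theta> [^] i \<in> ?E" for i :: nat
      using subringE(3,6)[OF E] by (induction i) auto
    moreover have "x = \<zero> \<or> (\<exists>i::nat. x = \<theta> [^] i)" using \<open>x \<in> F\<close> gen' by blast
    ultimately show "x \<in> ?E" using subringE(2)[OF E] by blast
  qed
  ultimately have EF: "?E = F" by auto
  have alg: "(algebraic over K) \<theta>" using algebraic_extension[OF \<theta>L] .
  have "card ?E = ?q ^ length (exp_base \<theta> (degree (Irr K \<theta>)))"
    using card_Span_independent[OF K fin exp_base_independent[OF K \<theta>L alg]]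
      Span_exp_base[OF K \<theta>L alg] by simp
  then have "?q ^ degree (Irr K \<theta>) = ?q ^ n" using EF cardF by (simp add: exp_base_def)
  then have "degree (Irr K \<theta>) = n" using power_inject_exp[OF q2] by blast
  with \<theta>L show thesis using that by blast
qed

text \<open>Polynomials as lists start with the leading coefficient, tuples with the constant one;
  hence the reversal.\<close>

lemma (in ring) eval_map_rev_upt:
  assumes "a \<in> {..<n} \<rightarrow> carrier R" "x \<in> carrier R"
  shows "eval (map a (rev [0..<n])) x = (\<Oplus>i\<in>{..<n}. a i \<otimes> x [^] i)"
  using assms
proof (induction n)
  case (Suc n)
  then have "(\<Oplus>i\<in>{..<Suc n}. a i \<otimes> x [^] i) = a n \<otimes> x [^] n \<oplus> (\<Oplus>i\<in>{..<n}. a i \<otimes> x [^] i)"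
    unfolding lessThan_Suc by (subst add.finprod_insert) auto
  with Suc show ?case by (auto simp: Pi_iff)
qed simp

text \<open>The minimal polynomial of \<theta> is delivered as two facts about tuples: X^n - sum of
  c_i X^i vanishes at \<theta>, and no nonzero polynomial of degree less than \<open>n\<close> does.
  The field \<open>R\<close> itself sits in \<open>L\<close> only through the embedding
  \<open>h\<close>.\<close>

lemma (in field) finite_field_extension_of_degree:
  assumes fin: "finite (carrier R)" and n: "0 < (n::nat)"
  obtains L :: "(('a list \<times> nat) multiset \<Rightarrow> 'a) ring" and h \<theta> c
  where "field L" "h \<in> ring_hom R L" "\<theta> \<in> carrier L" "c \<in> {..<n} \<rightarrow> carrier R"
    and "\<theta> [^]\<^bsub>L\<^esub> n = (\<Oplus>\<^bsub>L\<^esub>i\<in>{..<n}. h (c i) \<otimes>\<^bsub>L\<^esub> \<theta> [^]\<^bsub>L\<^esub> i)"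
    and "\<And>a. a \<in> {..<n} \<rightarrow> carrier R \<Longrightarrow>
           (\<Oplus>\<^bsub>L\<^esub>i\<in>{..<n}. h (a i) \<otimes>\<^bsub>L\<^esub> \<theta> [^]\<^bsub>L\<^esub> i) = \<zero>\<^bsub>L\<^esub> \<Longrightarrow> \<forall>i<n. a i = \<zero>"
proof -
  obtain L :: "(('a list \<times> nat) multiset \<Rightarrow> 'a) ring"
    where cl: "algebraic_closure L (indexed_const ` carrier R)" and h: "indexed_const \<in> ring_hom R L"
    using exists_closure .
  let ?h = "indexed_const :: 'a \<Rightarrow> ('a list \<times> nat) multiset \<Rightarrow> 'a" and ?K = "indexed_const ` carrier R"
  interpret L: algebraic_closure L ?K by (rule cl)
  interpret h: ring_hom_ring R L ?h
    by (rule ring_hom_ringI2[OF ring_axioms L.ring_axioms h])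
  have K: "subfield ?K L" by (rule L.subfield_axioms)
  obtain \<theta> where \<theta>: "\<theta> \<in> carrier L" and deg: "degree (L.Irr ?K \<theta>) = n"
    using L.exists_Irr_degree[OF finite_imageI[OF fin] n] by blast
  have alg: "(L.algebraic over ?K) \<theta>" using L.algebraic_extension[OF \<theta>] .
  note Irr = L.IrrE[OF K \<theta> alg]
  obtain Ks where Ks: "L.Irr ?K \<theta> = \<one>\<^bsub>L\<^esub> # Ks" "length Ks = n"
    using Irr(3) deg n by (cases "L.Irr ?K \<theta>") auto
  have KsK: "set Ks \<subseteq> ?K"
    using Irr(1) Ks(1) unfolding univ_poly_carrier[symmetric] polynomial_def by auto
  \<comment> \<open>\<open>Ks\<close> holds the coefficients below the leading one in descending
    order, so \<open>k i\<close> belongs to X^i. The tuple \<open>c\<close> chosen afterwards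
    carries the opposite signs, since it expresses \<theta>^n through lower powers.\<close>
  define k where "k i = Ks ! (n - Suc i)" for i
  have kK: "k i \<in> ?K" if "i < n" for i
    using KsK Ks(2) that n unfolding k_def by (auto simp: subset_iff)
  have Ks_eq: "Ks = map k (rev [0..<n])"
    by (rule nth_equalityI) (use Ks(2) in \<open>auto simp: k_def rev_nth\<close>)
  have K_uminus: "\<ominus>\<^bsub>L\<^esub> x \<in> ?K" if "x \<in> ?K" for x
    using subringE(5)[OF subfieldE(1)[OF K]] that by auto
  have "\<forall>i. \<exists>c. i < n \<longrightarrow> c \<in> carrier R \<and> ?h c = \<ominus>\<^bsub>L\<^esub> (k i)"
    using K_uminus[OF kK] by (fastforce simp: image_iff)
  then obtain c where c: "\<And>i. i < n \<Longrightarrow> c i \<in> carrier R" "\<And>i. i < n \<Longrightarrow> ?h (c i) = \<ominus>\<^bsub>L\<^esub> (k i)"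
    by metis
  have kL: "k \<in> {..<n} \<rightarrow> carrier L" using kK by fastforce
  have cL: "(\<lambda>i. ?h (c i)) \<in> {..<n} \<rightarrow> carrier L" using c by fastforce
  let ?s = "\<Oplus>\<^bsub>L\<^esub>i\<in>{..<n}. ?h (c i) \<otimes>\<^bsub>L\<^esub> \<theta> [^]\<^bsub>L\<^esub> i" and ?t = "\<Oplus>\<^bsub>L\<^esub>i\<in>{..<n}. k i \<otimes>\<^bsub>L\<^esub> \<theta> [^]\<^bsub>L\<^esub> i"
  have st: "?s \<in> carrier L" "?t \<in> carrier L" "\<theta> [^]\<^bsub>L\<^esub> n \<in> carrier L"
    using kL cL \<theta> by (auto intro!: L.finsum_closed)
  have "\<theta> [^]\<^bsub>L\<^esub> n \<oplus>\<^bsub>L\<^esub> ?t = \<zero>\<^bsub>L\<^esub>"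
    using Irr(4) Ks L.eval_map_rev_upt[OF kL \<theta>] \<theta> unfolding Ks_eq by simp
  moreover have "?s \<oplus>\<^bsub>L\<^esub> ?t = \<zero>\<^bsub>L\<^esub>"
  proof -
    have "?s \<oplus>\<^bsub>L\<^esub> ?t = (\<Oplus>\<^bsub>L\<^esub>i\<in>{..<n}. ?h (c i) \<otimes>\<^bsub>L\<^esub> \<theta> [^]\<^bsub>L\<^esub> i \<oplus>\<^bsub>L\<^esub> k i \<otimes>\<^bsub>L\<^esub> \<theta> [^]\<^bsub>L\<^esub> i)"
      by (rule L.finsum_addf[symmetric]) (use kL cL \<theta> in auto)
    also have "\<dots> = (\<Oplus>\<^bsub>L\<^esub>i\<in>{..<n}. \<zero>\<^bsub>L\<^esub>)"
    proof (rule L.finsum_cong')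
      fix i assume "i \<in> {..<n}"
      then have "k i \<in> carrier L" "?h (c i) = \<ominus>\<^bsub>L\<^esub> (k i)" using kL c(2) by auto
      then show "?h (c i) \<otimes>\<^bsub>L\<^esub> \<theta> [^]\<^bsub>L\<^esub> i \<oplus>\<^bsub>L\<^esub> k i \<otimes>\<^bsub>L\<^esub> \<theta> [^]\<^bsub>L\<^esub> i = \<zero>\<^bsub>L\<^esub>"
        using \<theta> by (simp add: L.l_minus L.l_neg)
    qed auto
    finally show ?thesis by simp
  qed
  ultimately have rel: "\<theta> [^]\<^bsub>L\<^esub> n = ?s" using L.add.r_cancel[OF _ st(3,1,2)] by simp
  have indep: "\<forall>i<n. a i = \<zero>"
    if a: "a \<in> {..<n} \<rightarrow> carrier R"
      and zero: "(\<Oplus>\<^bsub>L\<^esub>i\<in>{..<n}. ?h (a i) \<otimes>\<^bsub>L\<^esub> \<theta> [^]\<^bsub>L\<^esub> i) = \<zero>\<^bsub>L\<^esub>" for a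
  proof -
    let ?As = "map (\<lambda>i. ?h (a i)) (rev [0..<n])"
    have "L.eval ?As \<theta> = \<zero>\<^bsub>L\<^esub>"
      using L.eval_map_rev_upt[of "\<lambda>i. ?h (a i)" n \<theta>] a \<theta> zero by (auto simp: Pi_iff)
    then have "L.combine ?As (L.exp_base \<theta> n) = \<zero>\<^bsub>L\<^esub>"
      using L.combine_eq_eval[of ?As \<theta>] by simp
    moreover have "set ?As \<subseteq> ?K" using a by auto
    ultimately have "set (take (length (L.exp_base \<theta> n)) ?As) \<subseteq> {\<zero>\<^bsub>L\<^esub>}"
      using L.independent_imp_trivial_combine[OF K L.exp_base_independent[OF K \<theta> alg]] deg by blast
    then have "?h (a i) = \<zero>\<^bsub>L\<^esub>" if "i < n" for i
      using that unfolding L.exp_base_def by (auto simp: image_subset_iff)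
    then show ?thesis
      using a indexed_const_is_inj h.hom_zero by (metis injD)
  qed
  have "c \<in> {..<n} \<rightarrow> carrier R" using c by auto
  with L.field_axioms h \<theta> rel indep show thesis using that by blast
qed

section \<open>Finite valuation rings\<close>

text \<open>A finite ring has finitely many ideals, so some proper ideal above \<open>I\<close> is
  maximal for inclusion.\<close>

lemma (in ring) exists_maximalideal_superset:
  assumes fin: "finite (carrier R)" and I: "ideal I R" "I \<noteq> carrier R"
  obtains J where "maximalideal J R" "I \<subseteq> J"
proof -
  let ?S = "{J. ideal J R \<and> I \<subseteq> J \<and> J \<noteq> carrier R}"
  have "?S \<subseteq> Pow (carrier R)"
    by (auto dest: ideal.Icarr)
  then have "finite ?S" using fin finite_subset by blast
  moreover have "I \<in> ?S" using I by auto
  ultimately obtain J where J: "J \<in> ?S" "\<And>J'. J' \<in> ?S \<Longrightarrow> J \<subseteq> J' \<Longrightarrow> J' = J"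
    using finite_has_maximal2[of ?S I] by (metis (no_types, lifting))
  have "maximalideal J R"
    using J by (intro maximalidealI) blast+
  with J(1) show thesis using that by blast
qed

locale uniformized_valuation_ring = finite_valuation_ring R
  for R :: "('a, 'm) ring_scheme" (structure) +
  fixes \<pi> :: 'a and q l :: nat
  assumes uniformizer: "uniformizer R \<pi>"
    and q_def: "q = card (carrier (R Quot (PIdl \<pi>)))"
    and l_def: "l = nilpotency_degree R \<pi>"
begin

definition \<mm> :: "'a set" where "\<mm> = PIdl \<pi>"

lemma pi_closed [simp, intro]: "\<pi> \<in> carrier R"
  and maximal: "maximalideal \<mm> R"
  using uniformizer unfolding uniformizer_def \<mm>_def by auto

sublocale mm: maximalideal \<mm> R by (rule maximal)

lemma mm_iff: "x \<in> \<mm> \<longleftrightarrow> (\<exists>y\<in>carrier R. x = \<pi> \<otimes> y)"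
  unfolding \<mm>_def cgenideal_def using m_comm by auto

lemma one_notin_mm: "\<one> \<notin> \<mm>"
  using mm.I_notcarr mm.one_imp_carrier by blast

lemma one_neq_zero: "\<one> \<noteq> \<zero>"
  using one_notin_mm mm.zero_closed by auto

text \<open>A non-unit generates a proper ideal. That ideal lies in some maximal ideal, which is
  \<open>\<mm>\<close> because the ring is local.\<close>

lemma Units_iff: "x \<in> Units R \<longleftrightarrow> x \<in> carrier R \<and> x \<notin> \<mm>"
proof
  assume x: "x \<in> Units R"
  then have "x \<notin> \<mm>"
    using one_notin_mm mm.I_l_closed[of x "inv x"] by force
  with x show "x \<in> carrier R \<and> x \<notin> \<mm>" by auto
next
  assume x: "x \<in> carrier R \<and> x \<notin> \<mm>"
  have "PIdl x = carrier R"
  proof (rule ccontr)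
    assume "PIdl x \<noteq> carrier R"
    then obtain J where J: "maximalideal J R" "PIdl x \<subseteq> J"
      using exists_maximalideal_superset[OF finite_carrier cgenideal_ideal] x by blast
    then have "J = \<mm>" using local_ring maximal by blast
    with J x show False using cgenideal_self by blast
  qed
  then obtain y where "y \<in> carrier R" "\<one> = y \<otimes> x"
    unfolding cgenideal_def using one_closed by blast
  then show "x \<in> Units R" using x unfolding Units_def by (auto simp: m_comm intro!: bexI[of _ y])
qed

text \<open>Finiteness forces \<pi>^i = \<pi>^(i+d+1) for some i and d. As \<pi>^(d+1) lies in
  \<open>\<mm>\<close>, the factor 1 - \<pi>^(d+1) is a unit, and it annihilates \<pi>^i. This makes
  the minimum in \<open>nilpotency_degree\<close> an attained one.\<close>

lemma pi_nilpotent: "\<exists>k>0. \<pi> [^] (k::nat) = \<zero>"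
proof -
  have "range (\<lambda>k::nat. \<pi> [^] k) \<subseteq> carrier R" by auto
  then have "\<not> inj (\<lambda>k::nat. \<pi> [^] k)"
    using finite_carrier finite_subset finite_imageD infinite_UNIV_nat by blast
  then obtain i j :: nat where "i \<noteq> j" "\<pi> [^] i = \<pi> [^] j"
    unfolding inj_def by auto
  then obtain i d :: nat where d: "\<pi> [^] i = \<pi> [^] (i + Suc d)"
    by (metis less_imp_Suc_add linorder_neqE_nat add_Suc_right)
  have "\<pi> [^] Suc d \<in> \<mm>" using mm.I_l_closed[of \<pi> "\<pi> [^] d"] mm_iff[of \<pi>] r_one[of \<pi>]
    by (metis nat_pow_Suc nat_pow_closed one_closed pi_closed)
  then have nm: "\<one> \<ominus> \<pi> [^] Suc d \<notin> \<mm>"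
    using one_notin_mm mm.a_closed[of "\<one> \<ominus> \<pi> [^] Suc d" "\<pi> [^] Suc d"]
    by (metis a_minus_def add.inv_solve_right' nat_pow_closed one_closed pi_closed minus_closed)
  then have u: "\<one> \<ominus> \<pi> [^] Suc d \<in> Units R" using Units_iff by auto
  have cl: "\<pi> [^] i \<in> carrier R" "\<pi> [^] Suc d \<in> carrier R" by auto
  have "\<pi> [^] i \<otimes> (\<one> \<ominus> \<pi> [^] Suc d) = \<pi> [^] i \<ominus> \<pi> [^] i \<otimes> \<pi> [^] Suc d"
    using cl by (simp add: a_minus_def r_distr r_minus)
  also have "\<pi> [^] i \<otimes> \<pi> [^] Suc d = \<pi> [^] i"
    using d nat_pow_mult[of \<pi> i "Suc d"] by simp
  also have "\<pi> [^] i \<ominus> \<pi> [^] i = \<zero>" using cl by simp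
  finally have "(\<one> \<ominus> \<pi> [^] Suc d) \<otimes> \<pi> [^] i = (\<one> \<ominus> \<pi> [^] Suc d) \<otimes> \<zero>"
    using u cl by (simp add: m_comm)
  then have "\<pi> [^] i = \<zero>" using u cl Units_l_cancel by blast
  moreover have "i \<noteq> 0" using calculation one_neq_zero by (metis nat_pow_0)
  ultimately show ?thesis by blast
qed

section \<open>Powers of the uniformizer and divisibility\<close>

lemma l_pos: "0 < l" and pi_pow_l: "\<pi> [^] l = \<zero>"
  using LeastI_ex[OF pi_nilpotent] unfolding l_def nilpotency_degree_def by auto

lemma pi_pow_eq_zero_iff: "\<pi> [^] k = \<zero> \<longleftrightarrow> l \<le> k"
proof
  assume "\<pi> [^] k = \<zero>"
  moreover have "k \<noteq> 0" using calculation one_neq_zero by (metis nat_pow_0)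
  ultimately show "l \<le> k" unfolding l_def nilpotency_degree_def by (intro Least_le) auto
next
  assume "l \<le> k"
  then have "\<pi> [^] k = \<pi> [^] l \<otimes> \<pi> [^] (k - l)" by (simp add: nat_pow_mult)
  then show "\<pi> [^] k = \<zero>" using pi_pow_l by simp
qed

lemma pi_pow_unit_decomp:
  assumes x: "x \<in> carrier R" "x \<noteq> \<zero>"
  obtains k u where "k < l" "u \<in> Units R" "x = \<pi> [^] k \<otimes> u"
proof -
  \<comment> \<open>Factors \<pi> are stripped off one at a time: either a unit appears before step
    k, or \<pi>^k still divides x. At k = l the second alternative would give x = 0.\<close>
  have "(\<exists>j<k. \<exists>u\<in>Units R. x = \<pi> [^] j \<otimes> u) \<or> (\<exists>y\<in>carrier R. x = \<pi> [^] k \<otimes> y)"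
    for k :: nat
  proof (induction k)
    case 0
    then show ?case using x by auto
  next
    case (Suc k)
    show ?case
    proof (cases "\<exists>j<k. \<exists>u\<in>Units R. x = \<pi> [^] j \<otimes> u")
      case True
      then show ?thesis using less_SucI by blast
    next
      case False
      then obtain y where y: "y \<in> carrier R" "x = \<pi> [^] k \<otimes> y" using Suc by blast
      show ?thesis
      proof (cases "y \<in> \<mm>")
        case True
        then obtain z where "z \<in> carrier R" "y = \<pi> \<otimes> z" using mm_iff by auto
        then show ?thesis using y by (auto simp: m_assoc)
      next
        case False
        then show ?thesis using y Units_iff by blast
      qed
    qed
  qed
  from this[of l] show thesis using x(2) pi_pow_l that by auto
qed

text \<open>Up to units every nonzero element is a power of \<pi>, so the one with the smaller
  exponent divides the other.\<close>

lemma divides_total: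
  assumes "x \<in> carrier R" "y \<in> carrier R"
  obtains r where "r \<in> carrier R" "x = r \<otimes> y" | r where "r \<in> carrier R" "y = r \<otimes> x"
proof -
  have *: "\<exists>r\<in>carrier R. \<pi> [^] j \<otimes> v = r \<otimes> (\<pi> [^] k \<otimes> u)"
    if "k \<le> j" "u \<in> Units R" "v \<in> Units R" for j k :: nat and u v
  proof (intro bexI)
    have "(\<pi> [^] (j - k) \<otimes> v \<otimes> inv u) \<otimes> (\<pi> [^] k \<otimes> u)
        = (\<pi> [^] k \<otimes> \<pi> [^] (j - k)) \<otimes> v \<otimes> (inv u \<otimes> u)"
    proof -
      have "a \<otimes> v \<otimes> w \<otimes> (b \<otimes> u) = b \<otimes> a \<otimes> v \<otimes> (w \<otimes> u)"
        if "a \<in> carrier R" "b \<in> carrier R" "w \<in> carrier R" for a b w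
        using that \<open>u \<in> Units R\<close> \<open>v \<in> Units R\<close> by (simp add: m_ac Units_closed)
      then show ?thesis using that by auto
    qed
    also have "\<dots> = \<pi> [^] j \<otimes> v" using that by (simp add: nat_pow_mult Units_closed)
    finally show "\<pi> [^] j \<otimes> v = (\<pi> [^] (j - k) \<otimes> v \<otimes> inv u) \<otimes> (\<pi> [^] k \<otimes> u)" by simp
  qed (use that in auto)
  show thesis
  proof (cases "x = \<zero> \<or> y = \<zero>")
    case True
    then show ?thesis using assms that(1)[of \<zero>] that(2)[of \<zero>] by auto
  next
    case False
    then have "x \<noteq> \<zero>" "y \<noteq> \<zero>" by auto
    obtain j v where v: "j < l" "v \<in> Units R" "x = \<pi> [^] j \<otimes> v"
      using pi_pow_unit_decomp[OF assms(1) \<open>x \<noteq> \<zero>\<close>] .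
    obtain k u where u: "k < l" "u \<in> Units R" "y = \<pi> [^] k \<otimes> u"
      using pi_pow_unit_decomp[OF assms(2) \<open>y \<noteq> \<zero>\<close>] .
    show ?thesis
    proof (cases "k \<le> j")
      case True
      then show ?thesis using *[OF True u(2) v(2)] that(1) u(3) v(3) by blast
    next
      case False
      then have "j \<le> k" by simp
      then show ?thesis using *[OF \<open>j \<le> k\<close> v(2) u(2)] that(2) u(3) v(3) by blast
    qed
  qed
qed

section \<open>Orders of the ideals of the ring\<close>

definition pi_ideal :: "nat \<Rightarrow> 'a set" where
  "pi_ideal k = (\<lambda>y. \<pi> [^] k \<otimes> y) ` carrier R"

lemma pi_ideal_subset: "pi_ideal k \<subseteq> carrier R"
  unfolding pi_ideal_def by auto

lemma pi_ideal_simps: "pi_ideal 0 = carrier R" "pi_ideal 1 = \<mm>" "pi_ideal l = {\<zero>}"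
  unfolding pi_ideal_def using pi_pow_l mm_iff by (auto simp: image_iff)

text \<open>Multiplication by \<open>\<pi>\<close> maps \<open>\<pi>\<^sup>kR\<close> onto \<open>\<pi>\<^bsup>k+1\<^esup>R\<close>, and for \<open>k < l\<close> its kernel is the whole annihilator
  of \<open>\<pi>\<close>, independently of \<open>k\<close>.\<close>

lemma card_pi_ideal_Suc:
  assumes k: "k < l"
  shows "card (pi_ideal k) = card {x \<in> carrier R. \<pi> \<otimes> x = \<zero>} * card (pi_ideal (Suc k))"
proof -
  let ?A = "{x \<in> carrier R. \<pi> \<otimes> x = \<zero>}"
  have fin: "finite (pi_ideal j)" for j using pi_ideal_subset finite_carrier finite_subset by blast
  have add: "x \<oplus> y \<in> pi_ideal k" if "x \<in> pi_ideal k" "y \<in> pi_ideal k" for x y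
    using that unfolding pi_ideal_def by (auto simp: r_distr[symmetric])
  have neg: "\<ominus> x \<in> pi_ideal k" if "x \<in> pi_ideal k" for x
    using that unfolding pi_ideal_def by (auto simp: r_minus[symmetric])
  \<comment> \<open>If x = \<pi>^j u is killed by \<pi>, then \<pi>^(j+1) = 0, hence j + 1 >= l > k
    and \<pi>^k divides x.\<close>
  have A: "?A \<subseteq> pi_ideal k"
  proof
    fix x assume x: "x \<in> ?A"
    show "x \<in> pi_ideal k"
    proof (cases "x = \<zero>")
      case True
      then show ?thesis unfolding pi_ideal_def by (auto intro!: image_eqI[of _ _ \<zero>])
    next
      case False
      have xR: "x \<in> carrier R" using x by simp
      obtain j u where "j < l" and u: "u \<in> Units R" "x = \<pi> [^] j \<otimes> u"
        using pi_pow_unit_decomp[OF xR False] .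
      have "\<pi> [^] Suc j \<otimes> u = \<pi> \<otimes> x"
        unfolding u(2) using u(1) by (simp add: m_ac Units_closed)
      then have "\<pi> [^] Suc j \<otimes> u = \<zero>" using x by (simp del: nat_pow_Suc)
      then have "(\<pi> [^] Suc j \<otimes> u) \<otimes> inv u = \<zero>" using u(1) by simp
      then have "\<pi> [^] Suc j = \<zero>" using u(1) by (simp add: m_assoc Units_closed del: nat_pow_Suc)
      then have "k \<le> j" using k pi_pow_eq_zero_iff[of "Suc j"] by linarith
      then have "x = \<pi> [^] k \<otimes> (\<pi> [^] (j - k) \<otimes> u)"
        unfolding u(2) using u(1) \<open>k \<le> j\<close>
        by (simp add: m_assoc[symmetric] nat_pow_mult Units_closed)
      then show ?thesis using u(1) unfolding pi_ideal_def by blast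
    qed
  qed
  have im: "(\<lambda>x. \<pi> \<otimes> x) ` pi_ideal k = pi_ideal (Suc k)"
    unfolding pi_ideal_def image_image
    by (rule image_cong[OF refl]) (simp add: m_assoc[symmetric] m_comm)
  \<comment> \<open>Nonempty fibres of multiplication by \<pi> are translates of its
    annihilator.\<close>
  have fib: "card {x \<in> pi_ideal k. \<pi> \<otimes> x = y} = card ?A" if y: "y \<in> pi_ideal (Suc k)" for y
  proof -
    obtain x0 where x0: "y = \<pi> \<otimes> x0" "x0 \<in> pi_ideal k"
      using y[folded im] by (rule imageE)
    have x0R: "x0 \<in> carrier R" using x0(2) pi_ideal_subset by blast
    have "bij_betw (\<lambda>a. x0 \<oplus> a) ?A {x \<in> pi_ideal k. \<pi> \<otimes> x = y}"
    proof (rule bij_betw_byWitness[where f' = "\<lambda>x. \<ominus> x0 \<oplus> x"])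
      show "\<forall>a\<in>?A. \<ominus> x0 \<oplus> (x0 \<oplus> a) = a" using x0R by (auto simp: r_neg1)
      show "\<forall>x\<in>{x \<in> pi_ideal k. \<pi> \<otimes> x = y}. x0 \<oplus> (\<ominus> x0 \<oplus> x) = x"
        using x0R by (auto simp: r_neg2 dest: subsetD[OF pi_ideal_subset])
      show "(\<lambda>a. x0 \<oplus> a) ` ?A \<subseteq> {x \<in> pi_ideal k. \<pi> \<otimes> x = y}"
        using x0 x0R A add by (auto simp: r_distr)
      show "(\<lambda>x. \<ominus> x0 \<oplus> x) ` {x \<in> pi_ideal k. \<pi> \<otimes> x = y} \<subseteq> ?A"
        using x0 x0R by (auto simp: r_distr r_minus l_neg dest: subsetD[OF pi_ideal_subset])
    qed
    then show ?thesis by (simp add: bij_betw_same_card)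
  qed
  have "card (pi_ideal k) = card (\<Union>y\<in>pi_ideal (Suc k). {x \<in> pi_ideal k. \<pi> \<otimes> x = y})"
    unfolding im[symmetric] by (intro arg_cong[of _ _ card]) auto
  also have "\<dots> = (\<Sum>y\<in>pi_ideal (Suc k). card {x \<in> pi_ideal k. \<pi> \<otimes> x = y})"
    using fin by (intro card_UN_disjoint) auto
  also have "\<dots> = card ?A * card (pi_ideal (Suc k))" using fib by simp
  finally show ?thesis .
qed

lemma q_times_card_mm: "q * card \<mm> = card (carrier R)"
proof -
  have "card (a_rcosets \<mm>) * card \<mm> = card (carrier R)"
    using add.lagrange_finite[of \<mm>] finite_carrier mm.a_subgroup
    unfolding A_RCOSETS_def order_def by simp
  then show ?thesis unfolding q_def \<mm>_def FactRing_def by simp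
qed

text \<open>The annihilator of \<pi> has order q: both it and the residue field have order |R| /
  |\<mm>|. Counting from the bottom, the induction starts at the zero ideal \<pi>^l R, and each step
  up multiplies the order by q.\<close>

lemma card_pi_ideal:
  assumes "j \<le> l" shows "card (pi_ideal (l - j)) = q ^ j"
proof -
  let ?A = "{x \<in> carrier R. \<pi> \<otimes> x = \<zero>}"
  have "card (carrier R) = card ?A * card \<mm>"
    using card_pi_ideal_Suc[OF l_pos] pi_ideal_simps by simp
  moreover have "card \<mm> \<noteq> 0"
    using mm.zero_closed mm.a_subset finite_carrier by (metis card_eq_0_iff empty_iff finite_subset)
  ultimately have A: "card ?A = q" using q_times_card_mm by simp
  show ?thesis using assms
  proof (induction j)
    case 0
    then show ?case by (simp add: pi_ideal_simps)
  next
    case (Suc j)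
    then show ?case using card_pi_ideal_Suc[of "l - Suc j"] A by (simp add: Suc_diff_Suc)
  qed
qed

lemma card_carrier: "card (carrier R) = q ^ l"
  using card_pi_ideal[of l] by (simp add: pi_ideal_simps)

lemma card_mm: "card \<mm> = q ^ (l - 1)"
  using card_pi_ideal[of "l - 1"] l_pos pi_ideal_simps(2) by simp

lemma q_gt_1: "1 < q"
proof -
  have "card {\<zero>, \<one>} \<le> q ^ l"
    unfolding card_carrier[symmetric] using finite_carrier by (intro card_mono) auto
  moreover have "card {\<zero>, \<one>} = 2" using one_neq_zero by auto
  ultimately have "2 \<le> q ^ l" by simp
  then show ?thesis using l_pos by (cases "q = 0 \<or> q = 1") (auto simp: power_0_left)
qed

lemma card_Units: "card (Units R) = q ^ (l - 1) * (q - 1)"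
proof -
  have "Units R = carrier R - \<mm>" using Units_iff by auto
  then have "card (Units R) = q ^ l - q ^ (l - 1)"
    using card_Diff_subset[of \<mm> "carrier R"] mm.a_subset finite_carrier finite_subset
    by (metis card_carrier card_mm)
  then show ?thesis using l_pos by (cases l) (auto simp: algebra_simps)
qed

text \<open>The additive group has odd order q^l. If 1 + 1 were 0, adding 1 to itself |R| times
  would yield 1, whereas Lagrange yields 0.\<close>

lemma one_plus_one_neq_zero:
  assumes "odd q" shows "\<one> \<oplus> \<one> \<noteq> \<zero>"
proof
  assume two: "\<one> \<oplus> \<one> = \<zero>"
  have "odd (card (carrier R))" using assms card_carrier by simp
  then obtain t where t: "card (carrier R) = Suc (2 * t)" by (auto elim: oddE)
  have "[(2 * t)] \<cdot> \<one> = \<zero>"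
    by (induction t) (use two in \<open>auto simp: a_assoc\<close>)
  moreover have "[(card (carrier R))] \<cdot> \<one> = \<zero>"
    using add.pow_order_eq_1[of \<one>] by (simp add: order_def add_pow_def)
  ultimately show False using t one_neq_zero by simp
qed

end

section \<open>Unimodular tuples and the dot product\<close>

lemma (in ideal) finsum_mem:
  "(\<And>i. i \<in> A \<Longrightarrow> f i \<in> I) \<Longrightarrow> finsum R f A \<in> I"
proof (induction A rule: infinite_finite_induct)
  case (insert x A)
  then have "f \<in> A \<rightarrow> carrier R" "f x \<in> carrier R" using Icarr by auto
  with insert show ?case by (subst finsum_insert) (auto intro: a_closed)
qed (auto simp: finsum_infinite)

context cring
begin

lemma dot_closed:
  "a \<in> {..<n} \<rightarrow> carrier R \<Longrightarrow> b \<in> {..<n} \<rightarrow> carrier R \<Longrightarrow> dot R n a b \<in> carrier R"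
  unfolding dot_def by (intro finsum_closed) auto

lemma dot_comm:
  "a \<in> {..<n} \<rightarrow> carrier R \<Longrightarrow> b \<in> {..<n} \<rightarrow> carrier R \<Longrightarrow> dot R n a b = dot R n b a"
  unfolding dot_def by (intro finsum_cong') (auto simp: m_comm Pi_iff)

lemma dot_split:
  assumes "a \<in> {..<n} \<rightarrow> carrier R" "b \<in> {..<n} \<rightarrow> carrier R" "i < n"
  shows "dot R n a b = a i \<otimes> b i \<oplus> (\<Oplus>j\<in>{..<n} - {i}. a j \<otimes> b j)"
proof -
  have "dot R n a b = finsum R (\<lambda>j. a j \<otimes> b j) (insert i ({..<n} - {i}))"
    unfolding dot_def using assms(3) by (simp add: insert_absorb)
  also have "\<dots> = a i \<otimes> b i \<oplus> (\<Oplus>j\<in>{..<n} - {i}. a j \<otimes> b j)"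
    by (rule finsum_insert) (use assms in auto)
  finally show ?thesis .
qed

lemma dot_scale_left:
  assumes "a \<in> {..<n} \<rightarrow> carrier R" "b \<in> {..<n} \<rightarrow> carrier R" "u \<in> carrier R"
  shows "dot R n (\<lambda>i\<in>{..<n}. u \<otimes> a i) b = u \<otimes> dot R n a b"
proof -
  have "u \<otimes> dot R n a b = (\<Oplus>i\<in>{..<n}. u \<otimes> (a i \<otimes> b i))"
    unfolding dot_def by (rule finsum_rdistr) (use assms in auto)
  also have "\<dots> = dot R n (\<lambda>i\<in>{..<n}. u \<otimes> a i) b"
    unfolding dot_def by (rule finsum_cong') (use assms in \<open>auto simp: m_assoc Pi_iff\<close>)
  finally show ?thesis by simp
qed

lemma dot_scale_right:
  assumes "a \<in> {..<n} \<rightarrow> carrier R" "b \<in> {..<n} \<rightarrow> carrier R" "u \<in> carrier R"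
  shows "dot R n a (\<lambda>i\<in>{..<n}. u \<otimes> b i) = u \<otimes> dot R n a b"
proof -
  have "(\<lambda>i\<in>{..<n}. u \<otimes> b i) \<in> {..<n} \<rightarrow> carrier R" using assms by (auto simp: Pi_iff)
  then show ?thesis
    using dot_scale_left[OF assms(2,1,3)] dot_comm assms by metis
qed

text \<open>The coordinates other than \<open>i\<close> range freely over \<open>I\<close> and
  determine the remaining one. An ideal is allowed in place of the whole ring because both cases
  occur: \<open>I\<close> the full ring counts all solutions, \<open>I\<close> =
  \<open>\<mm>\<close> the non-unimodular ones.\<close>

lemma card_dot_fiber:
  assumes I: "ideal I R" and a: "a \<in> {..<n} \<rightarrow> carrier R" and i: "i < n" "a i \<in> Units R"
    and t: "t \<in> I"
  shows "card {b \<in> {..<n} \<rightarrow>\<^sub>E I. dot R n a b = t} = card I ^ (n - 1)"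
proof -
  interpret I: ideal I R by (rule I)
  let ?J = "{..<n} - {i}"
  define s where "s f = (\<Oplus>j\<in>?J. a j \<otimes> f j)" for f
  define g where "g f = f(i := inv (a i) \<otimes> (t \<ominus> s f))" for f
  have aR: "a j \<in> carrier R" if "j < n" for j using a that by auto
  have sI: "s f \<in> I" if "f \<in> ?J \<rightarrow> I" for f
    unfolding s_def by (rule I.finsum_mem) (use that a I.I_l_closed in auto)
  have gI: "inv (a i) \<otimes> (t \<ominus> s f) \<in> I" if "f \<in> ?J \<rightarrow> I" for f
    using sI[OF that] t i unfolding a_minus_def by (intro I.I_l_closed) auto
  have s_cong: "s f = s f'" if "\<And>j. j \<in> ?J \<Longrightarrow> f j = f' j" "f' \<in> ?J \<rightarrow> I" for f f'
    unfolding s_def by (rule finsum_cong') (use that aR I.Icarr in \<open>auto simp: Pi_iff\<close>)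
  have dot_eq: "dot R n a b = a i \<otimes> b i \<oplus> s b" if "b \<in> {..<n} \<rightarrow> I" for b
    unfolding s_def by (rule dot_split[OF a _ i(1)]) (use that in \<open>auto intro: I.Icarr simp: Pi_iff\<close>)
  have "bij_betw g (?J \<rightarrow>\<^sub>E I) {b \<in> {..<n} \<rightarrow>\<^sub>E I. dot R n a b = t}"
  proof (rule bij_betw_byWitness[where f' = "\<lambda>b. restrict b ?J"])
    show "\<forall>f\<in>?J \<rightarrow>\<^sub>E I. restrict (g f) ?J = f"
      unfolding g_def by (auto simp: fun_eq_iff PiE_def extensional_def)
    show "\<forall>b\<in>{b \<in> {..<n} \<rightarrow>\<^sub>E I. dot R n a b = t}. g (restrict b ?J) = b"
    proof
      fix b assume b: "b \<in> {b \<in> {..<n} \<rightarrow>\<^sub>E I. dot R n a b = t}"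
      then have bI: "b \<in> {..<n} \<rightarrow> I" and ext: "b \<in> extensional {..<n}" by (auto simp: PiE_def)
      have sb: "s (restrict b ?J) = s b" by (rule s_cong) (use bI in auto)
      have biR: "b i \<in> carrier R" and sR: "s b \<in> carrier R"
        using bI i sI[of b] by (auto intro!: I.Icarr)
      have "t = a i \<otimes> b i \<oplus> s b" using dot_eq[OF bI] b by simp
      then have "t \<ominus> s b = a i \<otimes> b i"
        using biR sR aR[OF i(1)] by (simp add: a_minus_def a_assoc r_neg)
      then have "inv (a i) \<otimes> (t \<ominus> s b) = b i"
        using biR aR[OF i(1)] i(2) by (simp add: m_assoc[symmetric])
      then show "g (restrict b ?J) = b"
        unfolding g_def sb using ext i(1) by (auto simp: fun_eq_iff extensional_def)
    qed
    show "g ` (?J \<rightarrow>\<^sub>E I) \<subseteq> {b \<in> {..<n} \<rightarrow>\<^sub>E I. dot R n a b = t}"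
    proof
      fix b assume "b \<in> g ` (?J \<rightarrow>\<^sub>E I)"
      then obtain f where f: "f \<in> ?J \<rightarrow>\<^sub>E I" and b: "b = g f" by auto
      have fI: "f \<in> ?J \<rightarrow> I" using f by auto
      have bE: "b \<in> {..<n} \<rightarrow>\<^sub>E I"
        unfolding b g_def using f gI[OF fI] i(1) by (auto simp: PiE_def extensional_def)
      have bI: "b \<in> {..<n} \<rightarrow> I" using bE by auto
      have "s b = s f" by (rule s_cong) (use fI in \<open>auto simp: b g_def\<close>)
      moreover have "b i = inv (a i) \<otimes> (t \<ominus> s f)" unfolding b g_def by simp
      moreover have "a i \<otimes> (inv (a i) \<otimes> (t \<ominus> s f)) \<oplus> s f = t"
        using sI[OF fI] t I.Icarr aR[OF i(1)] i(2)
        by (simp add: m_assoc[symmetric] a_minus_def a_assoc l_neg)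
      ultimately show "b \<in> {b \<in> {..<n} \<rightarrow>\<^sub>E I. dot R n a b = t}"
        using dot_eq[OF bI] bE by simp
    qed
    show "(\<lambda>b. restrict b ?J) ` {b \<in> {..<n} \<rightarrow>\<^sub>E I. dot R n a b = t} \<subseteq> ?J \<rightarrow>\<^sub>E I"
      by (intro image_subsetI) (simp add: restrict_PiE_iff PiE_iff)
  qed
  then have "card {b \<in> {..<n} \<rightarrow>\<^sub>E I. dot R n a b = t} = card (?J \<rightarrow>\<^sub>E I)"
    by (simp add: bij_betw_same_card)
  then show ?thesis using i(1) by (simp add: card_PiE)
qed

end

context uniformized_valuation_ring
begin

text \<open>If no entry is a unit, all entries lie in the proper ideal \<open>\<mm>\<close>;
  conversely a single unit already generates the ring.\<close>

lemma unimodular_iff: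
  "a \<in> unimodular R n \<longleftrightarrow> a \<in> {..<n} \<rightarrow>\<^sub>E carrier R \<and> (\<exists>i<n. a i \<in> Units R)"
proof (intro iffI conjI)
  assume a: "a \<in> unimodular R n"
  then show aE: "a \<in> {..<n} \<rightarrow>\<^sub>E carrier R" unfolding unimodular_def by auto
  show "\<exists>i<n. a i \<in> Units R"
  proof (rule ccontr)
    assume "\<not> ?thesis"
    then have "a ` {..<n} \<subseteq> \<mm>" using aE Units_iff by auto
    then have "Idl (a ` {..<n}) \<subseteq> \<mm>" using genideal_minimal mm.is_ideal by blast
    then show False using a one_notin_mm unfolding unimodular_def by auto
  qed
next
  assume "a \<in> {..<n} \<rightarrow>\<^sub>E carrier R \<and> (\<exists>i<n. a i \<in> Units R)"
  then obtain i where a: "a \<in> {..<n} \<rightarrow>\<^sub>E carrier R" and i: "i < n" "a i \<in> Units R" by auto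
  have sub: "a ` {..<n} \<subseteq> carrier R" using a by auto
  interpret J: ideal "Idl (a ` {..<n})" R by (rule genideal_ideal[OF sub])
  have "a i \<in> Idl (a ` {..<n})" using genideal_self[OF sub] i by auto
  then have "inv (a i) \<otimes> a i \<in> Idl (a ` {..<n})" using i by (intro J.I_l_closed) auto
  then have "Idl (a ` {..<n}) = carrier R" using i J.one_imp_carrier by simp
  with a show "a \<in> unimodular R n" unfolding unimodular_def by auto
qed

lemma unimodular_PiE: "a \<in> unimodular R n \<Longrightarrow> a \<in> {..<n} \<rightarrow>\<^sub>E carrier R"
  and unimodular_Pi: "a \<in> unimodular R n \<Longrightarrow> a \<in> {..<n} \<rightarrow> carrier R"
  unfolding unimodular_def by auto

lemma unimodular_eq_Diff: "unimodular R n = ({..<n} \<rightarrow>\<^sub>E carrier R) - ({..<n} \<rightarrow>\<^sub>E \<mm>)"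
  by (rule Set.set_eqI) (simp add: unimodular_iff Units_iff PiE_iff, blast)

lemma finite_PiE_carrier: "finite ({..<n::nat} \<rightarrow>\<^sub>E carrier R)"
  using finite_carrier by (intro finite_PiE) auto

lemma finite_unimodular: "finite (unimodular R n)"
  using finite_PiE_carrier unimodular_PiE by (meson finite_subset subsetI)

lemma mm_PiE_subset: "({..<n::nat} \<rightarrow>\<^sub>E \<mm>) \<subseteq> {..<n} \<rightarrow>\<^sub>E carrier R"
  using mm.a_subset by (intro PiE_mono) auto

lemma card_unimodular: "card (unimodular R n) = q ^ (n * l) - q ^ (n * (l - 1))"
  unfolding unimodular_eq_Diff
  using card_Diff_subset[OF finite_subset[OF mm_PiE_subset finite_PiE_carrier] mm_PiE_subset, of n]
  by (simp add: card_PiE card_carrier card_mm power_mult[symmetric] mult.commute)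

lemma dot_mem_mm: "a \<in> {..<n} \<rightarrow> carrier R \<Longrightarrow> b \<in> {..<n} \<rightarrow> \<mm> \<Longrightarrow> dot R n a b \<in> \<mm>"
  unfolding dot_def by (intro mm.finsum_mem mm.I_l_closed) auto

text \<open>A tuple over \<open>R\<close> that is not unimodular has all entries in
  \<open>\<mm>\<close>, and so do its dot products. Later tuples are recognized as unimodular by one
  unit dot product instead of by a unit entry.\<close>

lemma unimodular_of_dot_Unit:
  assumes "a \<in> {..<n} \<rightarrow> carrier R" "b \<in> {..<n} \<rightarrow>\<^sub>E carrier R" "dot R n a b \<in> Units R"
  shows "b \<in> unimodular R n"
  using assms dot_mem_mm[of a n b] Units_iff unfolding unimodular_eq_Diff by auto

lemma card_dot_eq_one:
  assumes "a \<in> unimodular R n"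
  shows "card {b \<in> unimodular R n. dot R n a b = \<one>} = q ^ ((n - 1) * l)"
proof -
  obtain i where i: "i < n" "a i \<in> Units R" using assms unimodular_iff by auto
  have "{b \<in> unimodular R n. dot R n a b = \<one>} = {b \<in> {..<n} \<rightarrow>\<^sub>E carrier R. dot R n a b = \<one>}"
    using unimodular_of_dot_Unit[OF unimodular_Pi[OF assms]] unimodular_PiE by auto
  then show ?thesis
    using card_dot_fiber[OF oneideal unimodular_Pi[OF assms] i one_closed]
    by (simp add: card_carrier power_mult[symmetric] mult.commute)
qed

text \<open>Unlike for the value 1, tuples over \<open>\<mm>\<close> also solve the equation, and
  their number has to be subtracted.\<close>

lemma card_dot_eq_zero:
  assumes "a \<in> unimodular R n"
  shows "card {b \<in> unimodular R n. dot R n a b = \<zero>} = q ^ ((n - 1) * l) - q ^ ((n - 1) * (l - 1))"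
proof -
  obtain i where i: "i < n" "a i \<in> Units R" using assms unimodular_iff by auto
  let ?B = "\<lambda>I. {b \<in> {..<n} \<rightarrow>\<^sub>E I. dot R n a b = \<zero>}"
  have "{b \<in> unimodular R n. dot R n a b = \<zero>} = ?B (carrier R) - ?B \<mm>"
    unfolding unimodular_eq_Diff by auto
  moreover have sub: "?B \<mm> \<subseteq> ?B (carrier R)" using mm_PiE_subset[of n] by blast
  moreover have "finite (?B \<mm>)"
    by (rule finite_subset[OF sub]) (use finite_PiE_carrier in simp)
  ultimately have "card {b \<in> unimodular R n. dot R n a b = \<zero>} = card (?B (carrier R)) - card (?B \<mm>)"
    using card_Diff_subset by simp
  then show ?thesis
    using card_dot_fiber[OF oneideal unimodular_Pi[OF assms] i zero_closed]
      card_dot_fiber[OF mm.is_ideal unimodular_Pi[OF assms] i mm.zero_closed]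
    by (simp add: card_carrier card_mm power_mult[symmetric] mult.commute)
qed

end

section \<open>Bipartite graphs and generalized dihedral groups\<close>

lemma half_size_bipartite_graph: "half_size (bipartite_graph V E) = card V"
  unfolding half_size_def bipartite_graph_def by (auto simp: Plus_def intro: arg_cong[of _ _ card])

lemma out_degree_bipartite_graph:
  "out_degree (with_proj (bipartite_graph V E)) (Inl a) = card {b. (a, b) \<in> E}"
  "out_degree (with_proj (bipartite_graph V E)) (Inr b) = card {a. (a, b) \<in> E}"
proof -
  have "out_arcs (with_proj (bipartite_graph V E)) (Inl a) = (\<lambda>b. (Inl a, Inr b)) ` {b. (a, b) \<in> E}"
    "out_arcs (with_proj (bipartite_graph V E)) (Inr b) = (\<lambda>a. (Inr b, Inl a)) ` {a. (a, b) \<in> E}"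
    unfolding out_arcs_def bipartite_graph_def by auto
  then show "out_degree (with_proj (bipartite_graph V E)) (Inl a) = card {b. (a, b) \<in> E}"
    "out_degree (with_proj (bipartite_graph V E)) (Inr b) = card {a. (a, b) \<in> E}"
    unfolding out_degree_def by (simp_all add: card_image inj_on_def)
qed

lemma pair_wf_digraph_bipartite_graph:
  "E \<subseteq> V \<times> V \<Longrightarrow> pair_wf_digraph (bipartite_graph V E)"
  by unfold_locales (auto simp: bipartite_graph_def)

lemma awalk_with_proj_iff:
  "pre_digraph.awalk (with_proj G) u p v \<longleftrightarrow> u \<in> pverts G \<and> set p \<subseteq> parcs G \<and> pcas u p v"
  unfolding pre_digraph.awalk_def by (simp add: cas_with_proj_eq)

lemma graph_diameter_eqI:
  assumes wf: "pair_wf_digraph G"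
    and le: "\<And>u v. u \<in> pverts G \<Longrightarrow> v \<in> pverts G \<Longrightarrow>
      \<exists>p. pre_digraph.awalk (with_proj G) u p v \<and> length p \<le> k"
    and u: "u \<in> pverts G" and v: "v \<in> pverts G"
    and ge: "\<And>p. pre_digraph.awalk (with_proj G) u p v \<Longrightarrow> k \<le> length p"
  shows "graph_diameter G = ereal (real k)"
proof -
  interpret G: pair_wf_digraph G by (rule wf)
  have cost: "G.awalk_cost (\<lambda>_. 1) p = real (length p)" for p
    unfolding G.awalk_cost_def by (induction p) auto
  have "G.\<mu> (\<lambda>_. 1) x y \<le> ereal (real k)" if xy: "x \<in> pverts G" "y \<in> pverts G" for x y
  proof -
    obtain p where p: "G.awalk x p y" "length p \<le> k" using le[OF xy] by auto
    have "G.\<mu> (\<lambda>_. 1) x y \<le> ereal (G.awalk_cost (\<lambda>_. 1) p)"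
      by (rule G.min_cost_le_walk_cost[OF p(1)])
    also have "\<dots> \<le> ereal (real k)" using p(2) cost by simp
    finally show ?thesis .
  qed
  moreover have "ereal (real k) \<le> G.\<mu> (\<lambda>_. 1) u v"
    unfolding G.\<mu>_def by (rule INF_greatest) (use ge cost in auto)
  ultimately show ?thesis
    unfolding graph_diameter_def
    by (intro antisym SUP_least SUP_upper2[OF u] SUP_upper2[OF v]) auto
qed

lemma awalk_bipartite_graph_parity:
  assumes "pre_digraph.awalk (with_proj (bipartite_graph V E)) u p v"
  shows "even (length p) \<longleftrightarrow> isl u = isl v"
proof -
  have "set p \<subseteq> parcs (bipartite_graph V E)" "pcas u p v"
    using assms by (auto simp: awalk_with_proj_iff)
  then show ?thesis
    by (induction p arbitrary: u) (auto simp: bipartite_graph_def)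
qed

text \<open>By \<open>path\<close>, opposite sides are joined by three arcs; one more arc joins
  vertices of the same side. From \<open>a\<^sub>1\<close> to \<open>a\<^sub>2\<close> walks have
  even length, and lengths 0 and 2 are excluded by distinctness and \<open>far\<close>.\<close>

lemma graph_diameter_bipartite_eq_4:
  assumes E: "E \<subseteq> V \<times> V"
    and path: "\<And>a b. a \<in> V \<Longrightarrow> b \<in> V \<Longrightarrow> \<exists>c d. (a, c) \<in> E \<and> (d, c) \<in> E \<and> (d, b) \<in> E"
    and V: "a\<^sub>1 \<in> V" "a\<^sub>2 \<in> V" "a\<^sub>1 \<noteq> a\<^sub>2"
    and far: "\<And>c. (a\<^sub>1, c) \<in> E \<Longrightarrow> (a\<^sub>2, c) \<notin> E"
  shows "graph_diameter (bipartite_graph V E) = 4"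
proof -
  let ?G = "bipartite_graph V E"
  have "graph_diameter ?G = ereal (real 4)"
  proof (rule graph_diameter_eqI[OF pair_wf_digraph_bipartite_graph[OF E]])
    fix u v assume "u \<in> pverts ?G" "v \<in> pverts ?G"
    then consider (ll) a b where "a \<in> V" "b \<in> V" "u = Inl a" "v = Inl b"
      | (lr) a b where "a \<in> V" "b \<in> V" "u = Inl a" "v = Inr b"
      | (rl) a b where "a \<in> V" "b \<in> V" "u = Inr b" "v = Inl a"
      | (rr) a b where "a \<in> V" "b \<in> V" "u = Inr a" "v = Inr b"
      by (auto simp: bipartite_graph_def)
    then show "\<exists>p. pre_digraph.awalk (with_proj ?G) u p v \<and> length p \<le> 4"
    proof cases
      case ll
      \<comment> \<open>\<open>path\<close> from b to b is used only for its first arc, which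
        supplies some neighbour of b.\<close>
      obtain x where x: "(b, x) \<in> E" using path[OF \<open>b \<in> V\<close> \<open>b \<in> V\<close>] by auto
      then have "x \<in> V" using E by auto
      then obtain c d where "(a, c) \<in> E" "(d, c) \<in> E" "(d, x) \<in> E" using path \<open>a \<in> V\<close> by blast
      with x ll show ?thesis
        by (intro exI[of _ "[(Inl a, Inr c), (Inr c, Inl d), (Inl d, Inr x), (Inr x, Inl b)]"])
           (auto simp: awalk_with_proj_iff bipartite_graph_def)
    next
      case lr
      obtain c d where "(a, c) \<in> E" "(d, c) \<in> E" "(d, b) \<in> E" using path lr by blast
      with lr show ?thesis
        by (intro exI[of _ "[(Inl a, Inr c), (Inr c, Inl d), (Inl d, Inr b)]"])
           (auto simp: awalk_with_proj_iff bipartite_graph_def)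
    next
      case rl
      obtain c d where "(a, c) \<in> E" "(d, c) \<in> E" "(d, b) \<in> E" using path rl by blast
      with rl show ?thesis
        by (intro exI[of _ "[(Inr b, Inl d), (Inl d, Inr c), (Inr c, Inl a)]"])
           (auto simp: awalk_with_proj_iff bipartite_graph_def)
    next
      case rr
      obtain x where x: "(x, a) \<in> E" using path[OF \<open>a \<in> V\<close> \<open>a \<in> V\<close>] by auto
      then have "x \<in> V" using E by auto
      then obtain c d where "(x, c) \<in> E" "(d, c) \<in> E" "(d, b) \<in> E" using path \<open>b \<in> V\<close> by blast
      with x rr show ?thesis
        by (intro exI[of _ "[(Inr a, Inl x), (Inl x, Inr c), (Inr c, Inl d), (Inl d, Inr b)]"])
           (auto simp: awalk_with_proj_iff bipartite_graph_def)
    qed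
  next
    show "Inl a\<^sub>1 \<in> pverts ?G" "Inl a\<^sub>2 \<in> pverts ?G" using V by (auto simp: bipartite_graph_def)
    fix p assume p: "pre_digraph.awalk (with_proj ?G) (Inl a\<^sub>1) p (Inl a\<^sub>2)"
    show "4 \<le> length p"
    proof (rule ccontr)
      assume "\<not> 4 \<le> length p"
      moreover have "even (length p)" using awalk_bipartite_graph_parity[OF p] by simp
      ultimately have "length p = 0 \<or> length p = 2" by presburger
      then consider "p = []" | e f where "p = [e, f]" by (auto simp: length_Suc_conv numeral_2_eq_2)
      then show False
      proof cases
        case 1
        then show ?thesis using p V(3) by (simp add: awalk_with_proj_iff)
      next
        case 2
        then show ?thesis using p far by (auto simp: awalk_with_proj_iff bipartite_graph_def)
      qed
    qed
  qed
  then show ?thesis by simp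
qed

text \<open>Common neighbours settle vertices of the same side. For opposite vertices a and b, some
  neighbour d of b is taken first and then a common neighbour of a and d. A non-adjacent opposite
  pair excludes length 1, and parity excludes 0 and 2.\<close>

lemma graph_diameter_bipartite_eq_3:
  assumes E: "E \<subseteq> V \<times> V"
    and common: "\<And>a b. a \<in> V \<Longrightarrow> b \<in> V \<Longrightarrow> \<exists>c. (a, c) \<in> E \<and> (b, c) \<in> E"
      "\<And>a b. a \<in> V \<Longrightarrow> b \<in> V \<Longrightarrow> \<exists>c. (c, a) \<in> E \<and> (c, b) \<in> E"
    and V: "a\<^sub>0 \<in> V" "b\<^sub>0 \<in> V" "(a\<^sub>0, b\<^sub>0) \<notin> E"
  shows "graph_diameter (bipartite_graph V E) = 3"
proof -
  let ?G = "bipartite_graph V E"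
  have path: "\<exists>c d. (a, c) \<in> E \<and> (d, c) \<in> E \<and> (d, b) \<in> E" if a: "a \<in> V" and b: "b \<in> V" for a b
  proof -
    obtain d where d: "(d, b) \<in> E" using common(2)[OF b b] by auto
    then have "d \<in> V" using E by auto
    then show ?thesis using common(1)[OF a] d by blast
  qed
  have "graph_diameter ?G = ereal (real 3)"
  proof (rule graph_diameter_eqI[OF pair_wf_digraph_bipartite_graph[OF E]])
    fix u v assume "u \<in> pverts ?G" "v \<in> pverts ?G"
    then consider (ll) a b where "a \<in> V" "b \<in> V" "u = Inl a" "v = Inl b"
      | (lr) a b where "a \<in> V" "b \<in> V" "u = Inl a" "v = Inr b"
      | (rl) a b where "a \<in> V" "b \<in> V" "u = Inr b" "v = Inl a"
      | (rr) a b where "a \<in> V" "b \<in> V" "u = Inr a" "v = Inr b"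
      by (auto simp: bipartite_graph_def)
    then show "\<exists>p. pre_digraph.awalk (with_proj ?G) u p v \<and> length p \<le> 3"
    proof cases
      case ll
      obtain c where "(a, c) \<in> E" "(b, c) \<in> E" using common(1) ll by blast
      with ll show ?thesis
        by (intro exI[of _ "[(Inl a, Inr c), (Inr c, Inl b)]"])
           (auto simp: awalk_with_proj_iff bipartite_graph_def)
    next
      case lr
      obtain c d where "(a, c) \<in> E" "(d, c) \<in> E" "(d, b) \<in> E" using path lr by blast
      with lr show ?thesis
        by (intro exI[of _ "[(Inl a, Inr c), (Inr c, Inl d), (Inl d, Inr b)]"])
           (auto simp: awalk_with_proj_iff bipartite_graph_def)
    next
      case rl
      obtain c d where "(a, c) \<in> E" "(d, c) \<in> E" "(d, b) \<in> E" using path rl by blast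
      with rl show ?thesis
        by (intro exI[of _ "[(Inr b, Inl d), (Inl d, Inr c), (Inr c, Inl a)]"])
           (auto simp: awalk_with_proj_iff bipartite_graph_def)
    next
      case rr
      obtain c where "(c, a) \<in> E" "(c, b) \<in> E" using common(2) rr by blast
      with rr show ?thesis
        by (intro exI[of _ "[(Inr a, Inl c), (Inl c, Inr b)]"])
           (auto simp: awalk_with_proj_iff bipartite_graph_def)
    qed
  next
    show "Inl a\<^sub>0 \<in> pverts ?G" "Inr b\<^sub>0 \<in> pverts ?G" using V by (auto simp: bipartite_graph_def)
    fix p assume p: "pre_digraph.awalk (with_proj ?G) (Inl a\<^sub>0) p (Inr b\<^sub>0)"
    show "3 \<le> length p"
    proof (rule ccontr)
      assume "\<not> 3 \<le> length p"
      moreover have "odd (length p)" using awalk_bipartite_graph_parity[OF p] by simp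
      ultimately have "length p = 1" by presburger
      then obtain e where "p = [e]" by (auto simp: length_Suc_conv)
      then show False using p V(3) by (auto simp: awalk_with_proj_iff bipartite_graph_def)
    qed
  qed
  then show ?thesis by simp
qed

text \<open>With s = \<open>Inr \<one>\<close>, an involution that inverts every rotation
  \<open>Inl b\<close>, the reflection \<open>Inr a\<close> stands for the product of
  \<open>Inl a\<close> and s. Each \<open>Inr a\<close> is its own inverse.\<close>

definition dihedral :: "('g, 'm) monoid_scheme \<Rightarrow> ('g + 'g) monoid" where
  "dihedral A = \<lparr>carrier = carrier A <+> carrier A,
     monoid.mult = (\<lambda>x y. case x of
         Inl a \<Rightarrow> (case y of Inl b \<Rightarrow> Inl (a \<otimes>\<^bsub>A\<^esub> b) | Inr b \<Rightarrow> Inr (a \<otimes>\<^bsub>A\<^esub> b))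
       | Inr a \<Rightarrow> (case y of Inl b \<Rightarrow> Inr (a \<otimes>\<^bsub>A\<^esub> inv\<^bsub>A\<^esub> b) | Inr b \<Rightarrow> Inl (a \<otimes>\<^bsub>A\<^esub> inv\<^bsub>A\<^esub> b))),
     monoid.one = Inl \<one>\<^bsub>A\<^esub>\<rparr>"

lemma dihedral_simps [simp]:
  "carrier (dihedral A) = carrier A <+> carrier A"
  "\<one>\<^bsub>dihedral A\<^esub> = Inl \<one>\<^bsub>A\<^esub>"
  "Inl a \<otimes>\<^bsub>dihedral A\<^esub> Inl b = Inl (a \<otimes>\<^bsub>A\<^esub> b)"
  "Inl a \<otimes>\<^bsub>dihedral A\<^esub> Inr b = Inr (a \<otimes>\<^bsub>A\<^esub> b)"
  "Inr a \<otimes>\<^bsub>dihedral A\<^esub> Inl b = Inr (a \<otimes>\<^bsub>A\<^esub> inv\<^bsub>A\<^esub> b)"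
  "Inr a \<otimes>\<^bsub>dihedral A\<^esub> Inr b = Inl (a \<otimes>\<^bsub>A\<^esub> inv\<^bsub>A\<^esub> b)"
  by (simp_all add: dihedral_def)

section \<open>Bipartite graphs defined by products in an abelian group\<close>

context comm_group
begin

lemma dihedral_is_group: "group (dihedral G)"
proof (rule groupI)
  fix x y assume "x \<in> carrier (dihedral G)" "y \<in> carrier (dihedral G)"
  then show "x \<otimes>\<^bsub>dihedral G\<^esub> y \<in> carrier (dihedral G)" by (auto simp: Plus_def)
next
  fix x y z
  assume "x \<in> carrier (dihedral G)" "y \<in> carrier (dihedral G)" "z \<in> carrier (dihedral G)"
  then show "x \<otimes>\<^bsub>dihedral G\<^esub> y \<otimes>\<^bsub>dihedral G\<^esub> z = x \<otimes>\<^bsub>dihedral G\<^esub> (y \<otimes>\<^bsub>dihedral G\<^esub> z)"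
    by (auto simp: m_assoc inv_mult)
next
  fix x assume x: "x \<in> carrier (dihedral G)"
  then show "\<one>\<^bsub>dihedral G\<^esub> \<otimes>\<^bsub>dihedral G\<^esub> x = x" by auto
  show "\<exists>y\<in>carrier (dihedral G). y \<otimes>\<^bsub>dihedral G\<^esub> x = \<one>\<^bsub>dihedral G\<^esub>"
  proof (cases x)
    case (Inl a)
    then show ?thesis using x by (intro bexI[of _ "Inl (inv a)"]) auto
  next
    case (Inr a)
    then show ?thesis using x by (intro bexI[of _ "Inr a"]) auto
  qed
qed auto

lemma inv_dihedral:
  "a \<in> carrier G \<Longrightarrow> inv\<^bsub>dihedral G\<^esub> (Inl a) = Inl (inv a)"
  "a \<in> carrier G \<Longrightarrow> inv\<^bsub>dihedral G\<^esub> (Inr a) = Inr a"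
  by (rule group.inv_equality[OF dihedral_is_group]; auto)+

text \<open>A left vertex a is placed at the rotation by the inverse of a, a right vertex b at the
  reflection \<open>Inr (g b)\<close>. The quotient of the two, in either direction, is the
  reflection indexed by the product of a and \<open>g b\<close>. So adjacency is membership in the
  set of reflections indexed by \<open>T\<close>, while two vertices of the same side differ by a
  rotation and are never joined. The bijection \<open>g\<close> leaves room for a change of
  coordinates on one side.\<close>

lemma is_cayley_graph_bipartite:
  assumes g: "bij_betw g (carrier G) (carrier G)"
    and E: "E = {(a, b). a \<in> carrier G \<and> b \<in> carrier G \<and> a \<otimes> g b \<in> T}"
  shows "is_cayley_graph (bipartite_graph (carrier G) E)"
proof -
  let ?B = "bipartite_graph (carrier G) E" and ?S = "Inr ` (T \<inter> carrier G)"
  let ?C = "cayley_graph (dihedral G) ?S"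
  define f where "f = case_sum (\<lambda>a. Inl (inv a)) (\<lambda>b. Inr (g b))"
  have f_simps: "f (Inl a) = Inl (inv a)" "f (Inr b) = Inr (g b)" for a b
    by (simp_all add: f_def)
  have g_closed: "g b \<in> carrier G" if "b \<in> carrier G" for b using g that bij_betwE by blast
  have bij_inv: "bij_betw (\<lambda>a. inv a) (carrier G) (carrier G)"
    by (rule bij_betw_byWitness[where f' = "\<lambda>a. inv a"]) auto
  have f_inj: "inj_on f (carrier G <+> carrier G)"
  proof (rule inj_onI)
    fix x y assume "x \<in> carrier G <+> carrier G" "y \<in> carrier G <+> carrier G" "f x = f y"
    then show "x = y"
      using bij_betw_imp_inj_on[OF g] bij_betw_imp_inj_on[OF bij_inv]
      by (auto simp: f_simps dest: inj_onD)
  qed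
  have f_im: "f ` (carrier G <+> carrier G) = carrier G <+> carrier G"
  proof -
    have "f ` (carrier G <+> carrier G)
        = Inl ` ((\<lambda>a. inv a) ` carrier G) \<union> Inr ` (g ` carrier G)"
      unfolding Plus_def image_Un image_image f_simps by simp
    then show ?thesis
      unfolding Plus_def bij_betw_imp_surj_on[OF g] bij_betw_imp_surj_on[OF bij_inv] .
  qed
  have arc_iff: "(f x, f y) \<in> parcs ?C \<longleftrightarrow> (x, y) \<in> parcs ?B"
    if xy: "x \<in> carrier G <+> carrier G" "y \<in> carrier G <+> carrier G" for x y
  proof -
    have mem: "Inl z \<notin> ?S" "Inr z \<in> ?S \<longleftrightarrow> z \<in> T \<and> z \<in> carrier G" for z by auto
    have C: "(u, v) \<in> parcs ?C \<longleftrightarrow> inv\<^bsub>dihedral G\<^esub> u \<otimes>\<^bsub>dihedral G\<^esub> v \<in> ?S"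
      if "u \<in> carrier G <+> carrier G" "v \<in> carrier G <+> carrier G" for u v
      using that by (simp add: cayley_graph_def)
    have B: "(Inl a, Inl b) \<notin> parcs ?B" "(Inr a, Inr b) \<notin> parcs ?B"
      "(Inl a, Inr b) \<in> parcs ?B \<longleftrightarrow> (a, b) \<in> E" "(Inr b, Inl a) \<in> parcs ?B \<longleftrightarrow> (a, b) \<in> E" for a b
      by (auto simp: bipartite_graph_def)
    have E_iff: "(a, b) \<in> E \<longleftrightarrow> a \<in> carrier G \<and> b \<in> carrier G \<and> a \<otimes> g b \<in> T" for a b
      unfolding E by simp
    have "f x \<in> carrier G <+> carrier G" "f y \<in> carrier G <+> carrier G" using f_im xy by blast+
    note C' = C[OF this]
    consider (ll) a b where "x = Inl a" "y = Inl b" "a \<in> carrier G" "b \<in> carrier G"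
      | (lr) a b where "x = Inl a" "y = Inr b" "a \<in> carrier G" "b \<in> carrier G"
      | (rl) a b where "x = Inr b" "y = Inl a" "a \<in> carrier G" "b \<in> carrier G"
      | (rr) a b where "x = Inr a" "y = Inr b" "a \<in> carrier G" "b \<in> carrier G"
      using xy by (auto simp: Plus_def)
    then show ?thesis
    proof cases
      case ll
      then show ?thesis unfolding C' by (simp only: f_simps) (simp add: mem B inv_dihedral)
    next
      case lr
      then show ?thesis unfolding C' using g_closed
        by (simp only: f_simps) (simp add: mem B inv_dihedral E_iff)
    next
      case rl
      then show ?thesis unfolding C' using g_closed
        by (simp only: f_simps) (simp add: mem B inv_dihedral E_iff m_comm)
    next
      case rr
      then show ?thesis unfolding C' using g_closed
        by (simp only: f_simps) (simp add: mem B inv_dihedral)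
    qed
  qed
  have parcs_B: "parcs ?B \<subseteq> (carrier G <+> carrier G) \<times> (carrier G <+> carrier G)"
    unfolding bipartite_graph_def E by auto
  have parcs_C: "parcs ?C \<subseteq> (carrier G <+> carrier G) \<times> (carrier G <+> carrier G)"
    unfolding cayley_graph_def by auto
  have parcs_im: "map_prod f f ` parcs ?B = parcs ?C"
  proof (intro equalityI subsetI)
    fix e assume "e \<in> map_prod f f ` parcs ?B"
    then obtain x y where xy: "(x, y) \<in> parcs ?B" "e = (f x, f y)" by auto
    then have "x \<in> carrier G <+> carrier G" "y \<in> carrier G <+> carrier G" using parcs_B by blast+
    then show "e \<in> parcs ?C" using arc_iff xy by simp
  next
    fix e assume e: "e \<in> parcs ?C"
    then obtain u v where uv: "e = (u, v)" "u \<in> f ` (carrier G <+> carrier G)"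
        "v \<in> f ` (carrier G <+> carrier G)"
      unfolding f_im using parcs_C by (cases e) blast
    obtain x y where xy: "x \<in> carrier G <+> carrier G" "y \<in> carrier G <+> carrier G"
        "u = f x" "v = f y"
      using uv(2,3) by (elim imageE)
    with e uv(1) have "(x, y) \<in> parcs ?B" using arc_iff[OF xy(1,2)] by simp
    then show "e \<in> map_prod f f ` parcs ?B" using uv(1) xy(3,4) by (intro image_eqI) auto
  qed
  define hom where "hom = \<lparr>iso_verts = f, iso_arcs = map_prod f f, iso_head = snd, iso_tail = fst\<rparr>"
  have wf: "wf_digraph (with_proj ?B)"
    using parcs_B unfolding wf_digraph_def by (auto simp: bipartite_graph_def)
  have "pre_digraph.digraph_isomorphism (with_proj ?B) hom"
    unfolding pre_digraph.digraph_isomorphism_def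
  proof (intro conjI)
    show "inj_on (iso_verts hom) (verts (with_proj ?B))"
      using f_inj by (simp add: hom_def bipartite_graph_def)
    show "inj_on (iso_arcs hom) (arcs (with_proj ?B))"
      using inj_on_subset[OF map_prod_inj_on[OF f_inj f_inj] parcs_B] by (simp add: hom_def)
  qed (use wf in \<open>auto simp: hom_def\<close>)
  moreover have "with_proj ?C = app_iso hom (with_proj ?B)"
    unfolding app_iso_def using parcs_im f_im
    by (simp add: hom_def with_proj_def) (simp add: cayley_graph_def bipartite_graph_def)
  ultimately have "digraph_iso (with_proj ?B) (with_proj ?C)"
    unfolding digraph_iso_def by blast
  moreover have "\<forall>s\<in>?S. inv\<^bsub>dihedral G\<^esub> s \<in> ?S" by (auto simp: inv_dihedral)
  moreover have "?S \<subseteq> carrier (dihedral G)" "\<one>\<^bsub>dihedral G\<^esub> \<notin> ?S" by auto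
  ultimately show ?thesis unfolding is_cayley_graph_def using dihedral_is_group by blast
qed

end

section \<open>Multiplication of tuples modulo a monic polynomial\<close>

text \<open>Tuples stand for elements of \<open>R[X]/(X\<^sup>n - (\<Sum>i<n. c i X\<^sup>i))\<close> in the basis of the powers of \<open>X\<close>;
  \<open>shift\<close> is multiplication by \<open>X\<close>, and \<open>vmult\<close> is the product.\<close>

definition shift :: "('a, 'm) ring_scheme \<Rightarrow> nat \<Rightarrow> (nat \<Rightarrow> 'a) \<Rightarrow> (nat \<Rightarrow> 'a) \<Rightarrow> nat \<Rightarrow> 'a" where
  "shift R n c b = (\<lambda>i\<in>{..<n}.
     (if i = 0 then \<zero>\<^bsub>R\<^esub> else b (i - 1)) \<oplus>\<^bsub>R\<^esub> c i \<otimes>\<^bsub>R\<^esub> b (n - 1))"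

definition lincomb :: "('a, 'm) ring_scheme \<Rightarrow> nat \<Rightarrow> nat \<Rightarrow> (nat \<Rightarrow> 'a) \<Rightarrow> (nat \<Rightarrow> nat \<Rightarrow> 'a) \<Rightarrow> nat \<Rightarrow> 'a"
  where "lincomb R n k a v = (\<lambda>j\<in>{..<n}. \<Oplus>\<^bsub>R\<^esub>i\<in>{..<k}. a i \<otimes>\<^bsub>R\<^esub> v i j)"

definition vmult :: "('a, 'm) ring_scheme \<Rightarrow> nat \<Rightarrow> (nat \<Rightarrow> 'a) \<Rightarrow> (nat \<Rightarrow> 'a) \<Rightarrow> (nat \<Rightarrow> 'a) \<Rightarrow> nat \<Rightarrow> 'a"
  where "vmult R n c a b = lincomb R n n a (\<lambda>i. (shift R n c ^^ i) b)"

definition unit_vec :: "('a, 'm) ring_scheme \<Rightarrow> nat \<Rightarrow> nat \<Rightarrow> nat \<Rightarrow> 'a" where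
  "unit_vec R n k = (\<lambda>i\<in>{..<n}. if i = k then \<one>\<^bsub>R\<^esub> else \<zero>\<^bsub>R\<^esub>)"

text \<open>Additivity and homogeneity are merged into one condition matching the step from k to k +
  1 in a linear combination. The restricted lambdas keep all tuples extensional, so that equality of
  tuples is equality of functions.\<close>

definition linear_endo :: "('a, 'm) ring_scheme \<Rightarrow> nat \<Rightarrow> ((nat \<Rightarrow> 'a) \<Rightarrow> nat \<Rightarrow> 'a) \<Rightarrow> bool" where
  "linear_endo R n f \<longleftrightarrow>
     (\<forall>v\<in>{..<n} \<rightarrow>\<^sub>E carrier R. f v \<in> {..<n} \<rightarrow>\<^sub>E carrier R) \<and>
     (\<forall>s\<in>carrier R. \<forall>v\<in>{..<n} \<rightarrow>\<^sub>E carrier R. \<forall>w\<in>{..<n} \<rightarrow>\<^sub>E carrier R.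
        f (\<lambda>j\<in>{..<n}. v j \<oplus>\<^bsub>R\<^esub> s \<otimes>\<^bsub>R\<^esub> w j) = (\<lambda>j\<in>{..<n}. f v j \<oplus>\<^bsub>R\<^esub> s \<otimes>\<^bsub>R\<^esub> f w j))"

lemma linear_endoD:
  assumes "linear_endo R n f" "s \<in> carrier R"
    and "v \<in> {..<n} \<rightarrow>\<^sub>E carrier R" "w \<in> {..<n} \<rightarrow>\<^sub>E carrier R"
  shows "f (\<lambda>j\<in>{..<n}. v j \<oplus>\<^bsub>R\<^esub> s \<otimes>\<^bsub>R\<^esub> w j) = (\<lambda>j\<in>{..<n}. f v j \<oplus>\<^bsub>R\<^esub> s \<otimes>\<^bsub>R\<^esub> f w j)"
  using assms unfolding linear_endo_def by blast

context cring
begin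

lemma finsum_lessThan_Suc:
  "f \<in> {..<Suc k} \<rightarrow> carrier R \<Longrightarrow> (\<Oplus>i\<in>{..<Suc k}. f i) = (\<Oplus>i\<in>{..<k}. f i) \<oplus> f k"
  unfolding lessThan_Suc by (subst finsum_insert) (auto simp: a_comm Pi_iff)

lemma lincomb_closed:
  assumes "a \<in> {..<k} \<rightarrow> carrier R" "\<And>i. i < k \<Longrightarrow> v i \<in> {..<n} \<rightarrow>\<^sub>E carrier R"
  shows "lincomb R n k a v \<in> {..<n} \<rightarrow>\<^sub>E carrier R"
  unfolding lincomb_def using assms by (fastforce intro!: finsum_closed restrict_PiE_iff[THEN iffD2])

lemma lincomb_Suc:
  assumes "a \<in> {..<Suc k} \<rightarrow> carrier R" "\<And>i. i < Suc k \<Longrightarrow> v i \<in> {..<n} \<rightarrow>\<^sub>E carrier R"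
  shows "lincomb R n (Suc k) a v = (\<lambda>j\<in>{..<n}. lincomb R n k a v j \<oplus> a k \<otimes> v k j)"
  unfolding lincomb_def
proof (rule restrict_ext)
  fix j assume j: "j \<in> {..<n}"
  have "(\<lambda>i. a i \<otimes> v i j) \<in> {..<Suc k} \<rightarrow> carrier R"
  proof
    fix i assume "i \<in> {..<Suc k}"
    then have "a i \<in> carrier R" "v i j \<in> carrier R" using assms(1) assms(2)[of i] j by auto
    then show "a i \<otimes> v i j \<in> carrier R" by simp
  qed
  from finsum_lessThan_Suc[OF this] j
  show "(\<Oplus>i\<in>{..<Suc k}. a i \<otimes> v i j)
      = (\<lambda>j\<in>{..<n}. \<Oplus>i\<in>{..<k}. a i \<otimes> v i j) j \<oplus> a k \<otimes> v k j" by simp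
qed

lemma linear_endo_zero:
  assumes f: "linear_endo R n f"
  shows "f (\<lambda>j\<in>{..<n}. \<zero>) = (\<lambda>j\<in>{..<n}. \<zero>)"
proof -
  let ?z = "\<lambda>j\<in>{..<n}. \<zero>"
  have z: "?z \<in> {..<n} \<rightarrow>\<^sub>E carrier R" by auto
  have fz: "f ?z \<in> {..<n} \<rightarrow>\<^sub>E carrier R" using f z unfolding linear_endo_def by blast
  \<comment> \<open>The zero tuple is 0 + (-1) 0, so its image is f 0 - f 0.\<close>
  have "(\<lambda>j\<in>{..<n}. ?z j \<oplus> \<ominus> \<one> \<otimes> ?z j) = ?z" by (rule restrict_ext) simp
  then have "f ?z = f (\<lambda>j\<in>{..<n}. ?z j \<oplus> \<ominus> \<one> \<otimes> ?z j)" by simp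
  also have "\<dots> = (\<lambda>j\<in>{..<n}. f ?z j \<oplus> \<ominus> \<one> \<otimes> f ?z j)"
    by (rule linear_endoD[OF f _ z z]) simp
  also have "\<dots> = ?z"
  proof (rule restrict_ext)
    fix j assume "j \<in> {..<n}"
    then have "f ?z j \<in> carrier R" using fz by auto
    then show "f ?z j \<oplus> \<ominus> \<one> \<otimes> f ?z j = \<zero>" by (simp add: l_minus r_neg)
  qed
  finally show ?thesis .
qed

lemma linear_endo_lincomb:
  assumes f: "linear_endo R n f"
    and "a \<in> {..<k} \<rightarrow> carrier R" "\<And>i. i < k \<Longrightarrow> v i \<in> {..<n} \<rightarrow>\<^sub>E carrier R"
  shows "f (lincomb R n k a v) = lincomb R n k a (\<lambda>i. f (v i))"
  using assms(2,3)
proof (induction k)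
  case 0
  then show ?case using linear_endo_zero[OF f] by (simp only: lincomb_def lessThan_0 finsum_empty)
next
  case (Suc k)
  have ak: "a k \<in> carrier R" "a \<in> {..<k} \<rightarrow> carrier R" using Suc.prems(1) by auto
  have vk: "v k \<in> {..<n} \<rightarrow>\<^sub>E carrier R" and vi: "\<And>i. i < k \<Longrightarrow> v i \<in> {..<n} \<rightarrow>\<^sub>E carrier R"
    using Suc.prems(2) by auto
  have fv: "\<And>i. i < Suc k \<Longrightarrow> f (v i) \<in> {..<n} \<rightarrow>\<^sub>E carrier R"
    using f Suc.prems(2) unfolding linear_endo_def by blast
  have cl: "lincomb R n k a v \<in> {..<n} \<rightarrow>\<^sub>E carrier R"
    by (rule lincomb_closed[OF ak(2) vi])
  have expand: "lincomb R n (Suc k) a v = (\<lambda>j\<in>{..<n}. lincomb R n k a v j \<oplus> a k \<otimes> v k j)"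
    by (rule lincomb_Suc) (rule Suc.prems(1), erule Suc.prems(2))
  have expand_f: "lincomb R n (Suc k) a (\<lambda>i. f (v i))
      = (\<lambda>j\<in>{..<n}. lincomb R n k a (\<lambda>i. f (v i)) j \<oplus> a k \<otimes> f (v k) j)"
    by (rule lincomb_Suc) (rule Suc.prems(1), erule fv)
  have "f (lincomb R n (Suc k) a v)
      = (\<lambda>j\<in>{..<n}. f (lincomb R n k a v) j \<oplus> a k \<otimes> f (v k) j)"
    unfolding expand
    by (rule linear_endoD[OF f ak(1) cl vk])
  also have "\<dots> = lincomb R n (Suc k) a (\<lambda>i. f (v i))"
    unfolding expand_f using Suc.IH[OF ak(2) vi] by simp
  finally show ?case .
qed

lemma linear_endo_comp:
  "linear_endo R n f \<Longrightarrow> linear_endo R n g \<Longrightarrow> linear_endo R n (\<lambda>v. f (g v))"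
  unfolding linear_endo_def by auto

lemma linear_endo_funpow: "linear_endo R n f \<Longrightarrow> linear_endo R n (f ^^ k)"
proof (induction k)
  case 0
  show ?case unfolding linear_endo_def by auto
next
  case (Suc k)
  then show ?case using linear_endo_comp[of n f "f ^^ k"] by (simp add: comp_def)
qed

lemma linear_endo_shift:
  assumes "c \<in> {..<n} \<rightarrow> carrier R" "0 < n"
  shows "linear_endo R n (shift R n c)"
  unfolding linear_endo_def
proof (intro conjI ballI)
  fix v assume v: "v \<in> {..<n} \<rightarrow>\<^sub>E carrier R"
  have "v i \<in> carrier R" "c i \<in> carrier R" if "i < n" for i using v assms that by auto
  then show "shift R n c v \<in> {..<n} \<rightarrow>\<^sub>E carrier R"
    unfolding shift_def using assms(2) by (auto simp: restrict_PiE_iff)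
next
  fix s v w assume s: "s \<in> carrier R"
    and v: "v \<in> {..<n} \<rightarrow>\<^sub>E carrier R" and w: "w \<in> {..<n} \<rightarrow>\<^sub>E carrier R"
  have cl: "v i \<in> carrier R" "w i \<in> carrier R" "c i \<in> carrier R" if "i < n" for i
    using v w assms that by auto
  let ?u = "\<lambda>j\<in>{..<n}. v j \<oplus> s \<otimes> w j"
  show "shift R n c ?u = (\<lambda>j\<in>{..<n}. shift R n c v j \<oplus> s \<otimes> shift R n c w j)"
    unfolding shift_def
  proof (rule restrict_ext)
    fix j assume "j \<in> {..<n}"
    then have j: "j < n" by simp
    have n1: "n - 1 < n" using assms(2) by simp
    have "x \<oplus> s \<otimes> y \<oplus> e \<otimes> (p \<oplus> s \<otimes> r) = (x \<oplus> e \<otimes> p) \<oplus> s \<otimes> (y \<oplus> e \<otimes> r)"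
      if "x \<in> carrier R" "y \<in> carrier R" "e \<in> carrier R" "p \<in> carrier R" "r \<in> carrier R" for x y e p r
      using that s by algebra
    note eq = this
    have "(if j = 0 then \<zero> else ?u (j - 1))
        = (if j = 0 then \<zero> else v (j - 1)) \<oplus> s \<otimes> (if j = 0 then \<zero> else w (j - 1))"
      using j s by auto
    then show "(if j = 0 then \<zero> else ?u (j - 1)) \<oplus> c j \<otimes> ?u (n - 1)
      = (\<lambda>j\<in>{..<n}. (if j = 0 then \<zero> else v (j - 1)) \<oplus> c j \<otimes> v (n - 1)) j
        \<oplus> s \<otimes> (\<lambda>j\<in>{..<n}. (if j = 0 then \<zero> else w (j - 1)) \<oplus> c j \<otimes> w (n - 1)) j"
      using eq[of "if j = 0 then \<zero> else v (j - 1)" "if j = 0 then \<zero> else w (j - 1)" "c j" "v (n - 1)" "w (n - 1)"]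
        cl j n1 by auto
  qed
qed

lemma unit_vec_closed: "unit_vec R n k \<in> {..<n} \<rightarrow>\<^sub>E carrier R"
  unfolding unit_vec_def by auto

text \<open>Below exponent \<open>n\<close> no reduction modulo the polynomial takes place: X^k is a
  basis vector.\<close>

lemma shift_pow_unit_vec:
  assumes c: "c \<in> {..<n} \<rightarrow> carrier R" and "k < n"
  shows "(shift R n c ^^ k) (unit_vec R n 0) = unit_vec R n k"
  using assms(2)
proof (induction k)
  case (Suc k)
  then have "(shift R n c ^^ Suc k) (unit_vec R n 0) = shift R n c (unit_vec R n k)" by simp
  also have "\<dots> = unit_vec R n (Suc k)"
    unfolding shift_def unit_vec_def
    by (rule restrict_ext) (use Suc.prems c in \<open>auto simp: Pi_iff\<close>)
  finally show ?case .
qed simp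

end

section \<open>The commutative ring structure on tuples\<close>

locale companion = cring R for R (structure) +
  fixes n :: nat and c :: "nat \<Rightarrow> 'a"
  assumes c: "c \<in> {..<n} \<rightarrow> carrier R" and n: "0 < n"
begin

abbreviation "M \<equiv> {..<n} \<rightarrow>\<^sub>E carrier R"
abbreviation "C \<equiv> shift R n c"
abbreviation "mul \<equiv> vmult R n c"
abbreviation "e\<^sub>0 \<equiv> unit_vec R n 0"

lemma linear_C_pow: "linear_endo R n (C ^^ k)"
  by (rule linear_endo_funpow[OF linear_endo_shift[OF c n]])

lemma C_pow_closed: "v \<in> M \<Longrightarrow> (C ^^ k) v \<in> M"
  using linear_C_pow unfolding linear_endo_def by blast

lemma Pi_of_M: "v \<in> M \<Longrightarrow> v \<in> {..<n} \<rightarrow> carrier R" by auto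

lemma mul_closed: "a \<in> M \<Longrightarrow> b \<in> M \<Longrightarrow> mul a b \<in> M"
  unfolding vmult_def by (intro lincomb_closed C_pow_closed Pi_of_M)

lemma mul_apply: "j < n \<Longrightarrow> mul a b j = (\<Oplus>i\<in>{..<n}. a i \<otimes> (C ^^ i) b j)"
  unfolding vmult_def lincomb_def by simp

lemma C_pow_mul:
  assumes "a \<in> M" "b \<in> M" shows "(C ^^ k) (mul a b) = mul a ((C ^^ k) b)"
proof -
  have "(C ^^ k) (mul a b) = lincomb R n n a (\<lambda>i. (C ^^ k) ((C ^^ i) b))"
    unfolding vmult_def
    by (rule linear_endo_lincomb[OF linear_C_pow Pi_of_M]) (use assms C_pow_closed in auto)
  also have "(\<lambda>i. (C ^^ k) ((C ^^ i) b)) = (\<lambda>i. (C ^^ i) ((C ^^ k) b))"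
    by (metis add.commute comp_apply funpow_add)
  finally show ?thesis unfolding vmult_def .
qed

lemma linear_mul:
  assumes a: "a \<in> M" shows "linear_endo R n (mul a)"
  unfolding linear_endo_def
proof (intro conjI ballI)
  show "mul a v \<in> M" if "v \<in> M" for v using mul_closed a that .
next
  fix s v w assume s: "s \<in> carrier R" and v: "v \<in> M" and w: "w \<in> M"
  let ?u = "\<lambda>j\<in>{..<n}. v j \<oplus> s \<otimes> w j"
  have lin: "(C ^^ i) ?u = (\<lambda>j\<in>{..<n}. (C ^^ i) v j \<oplus> s \<otimes> (C ^^ i) w j)" for i
    by (rule linear_endoD[OF linear_C_pow s v w])
  show "mul a ?u = (\<lambda>j\<in>{..<n}. mul a v j \<oplus> s \<otimes> mul a w j)"
    unfolding vmult_def lincomb_def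
  proof (rule restrict_ext)
    fix j assume j: "j \<in> {..<n}"
    have cl: "(C ^^ i) v j \<in> carrier R" "(C ^^ i) w j \<in> carrier R" for i
      using C_pow_closed[OF v, of i] C_pow_closed[OF w, of i] j by auto
    have ai: "a i \<in> carrier R" if "i < n" for i using a that by auto
    have "(\<Oplus>i\<in>{..<n}. a i \<otimes> (C ^^ i) ?u j)
        = (\<Oplus>i\<in>{..<n}. a i \<otimes> (C ^^ i) v j \<oplus> s \<otimes> (a i \<otimes> (C ^^ i) w j))"
    proof (rule finsum_cong')
      fix i assume "i \<in> {..<n}"
      then have "a i \<in> carrier R" using ai by simp
      then show "a i \<otimes> (C ^^ i) ?u j = a i \<otimes> (C ^^ i) v j \<oplus> s \<otimes> (a i \<otimes> (C ^^ i) w j)"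
        unfolding lin using j cl s by (simp add: r_distr m_lcomm)
    qed (use ai cl s in auto)
    also have "\<dots> = (\<Oplus>i\<in>{..<n}. a i \<otimes> (C ^^ i) v j) \<oplus> (\<Oplus>i\<in>{..<n}. s \<otimes> (a i \<otimes> (C ^^ i) w j))"
      by (rule finsum_addf) (use ai cl s in auto)
    also have "(\<Oplus>i\<in>{..<n}. s \<otimes> (a i \<otimes> (C ^^ i) w j)) = s \<otimes> (\<Oplus>i\<in>{..<n}. a i \<otimes> (C ^^ i) w j)"
      by (rule finsum_rdistr[symmetric]) (use ai cl s in auto)
    finally show "(\<Oplus>i\<in>{..<n}. a i \<otimes> (C ^^ i) ?u j)
      = (\<lambda>j\<in>{..<n}. \<Oplus>i\<in>{..<n}. a i \<otimes> (C ^^ i) v j) j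
        \<oplus> s \<otimes> (\<lambda>j\<in>{..<n}. \<Oplus>i\<in>{..<n}. a i \<otimes> (C ^^ i) w j) j"
      using j by (simp only: restrict_apply')
  qed
qed

text \<open>\<open>mul b\<close> is a polynomial in the shift, and \<open>mul a\<close> is linear
  and commutes with the shift. Commutativity follows by taking \<open>x\<close> to be the unit
  element, and associativity from the two together.\<close>

lemma mul_left_commute:
  assumes "a \<in> M" "b \<in> M" "x \<in> M"
  shows "mul a (mul b x) = mul b (mul a x)"
proof -
  have "mul a (mul b x) = lincomb R n n b (\<lambda>i. mul a ((C ^^ i) x))"
    unfolding vmult_def[of R n c b]
    by (rule linear_endo_lincomb[OF linear_mul Pi_of_M]) (use assms C_pow_closed in auto)
  also have "\<dots> = lincomb R n n b (\<lambda>i. (C ^^ i) (mul a x))"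
    using C_pow_mul[OF assms(1,3)] by simp
  finally show ?thesis unfolding vmult_def[of R n c b] .
qed

lemma mul_e0:
  assumes "a \<in> M" shows "mul a e\<^sub>0 = a"
proof
  fix j
  show "mul a e\<^sub>0 j = a j"
  proof (cases "j < n")
    case True
    have ai: "a i \<in> carrier R" if "i < n" for i using assms that by auto
    have "mul a e\<^sub>0 j = (\<Oplus>i\<in>{..<n}. a i \<otimes> (C ^^ i) e\<^sub>0 j)" using True by (rule mul_apply)
    also have "\<dots> = (\<Oplus>i\<in>{..<n}. if j = i then a i else \<zero>)"
      by (rule finsum_cong')
        (use shift_pow_unit_vec[OF c] True ai in \<open>auto simp: unit_vec_def\<close>)
    also have "\<dots> = a j" by (rule finsum_singleton) (use True ai in auto)
    finally show ?thesis .
  next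
    case False
    \<comment> \<open>Outside the index range both tuples have the same extensional default
      value.\<close>
    then show ?thesis using mul_closed[OF assms unit_vec_closed] assms
      by (metis PiE_E lessThan_iff)
  qed
qed

lemma mul_comm: "a \<in> M \<Longrightarrow> b \<in> M \<Longrightarrow> mul a b = mul b a"
  using mul_left_commute[of a b e\<^sub>0] mul_e0 unit_vec_closed by metis

lemma mul_assoc:
  assumes "a \<in> M" "b \<in> M" "x \<in> M"
  shows "mul (mul a b) x = mul a (mul b x)"
proof -
  have "mul (mul a b) x = mul x (mul a b)" by (rule mul_comm[OF mul_closed[OF assms(1,2)] assms(3)])
  also have "\<dots> = mul a (mul x b)" by (rule mul_left_commute[OF assms(3,1,2)])
  also have "mul x b = mul b x" by (rule mul_comm[OF assms(3,2)])
  finally show ?thesis .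
qed

lemma e0_mul: "a \<in> M \<Longrightarrow> mul e\<^sub>0 a = a"
  using mul_comm mul_e0 unit_vec_closed by metis

lemma mul_scale_right:
  assumes a: "a \<in> M" and b: "b \<in> M" and s: "s \<in> carrier R"
  shows "mul a (\<lambda>j\<in>{..<n}. s \<otimes> b j) = (\<lambda>j\<in>{..<n}. s \<otimes> mul a b j)"
proof -
  let ?z = "\<lambda>j\<in>{..<n}. \<zero>"
  have z: "?z \<in> M" by auto
  have "(\<lambda>j\<in>{..<n}. s \<otimes> b j) = (\<lambda>j\<in>{..<n}. ?z j \<oplus> s \<otimes> b j)"
    by (rule restrict_ext) (use b s in \<open>auto simp: PiE_iff\<close>)
  then have "mul a (\<lambda>j\<in>{..<n}. s \<otimes> b j) = mul a (\<lambda>j\<in>{..<n}. ?z j \<oplus> s \<otimes> b j)"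
    by (rule arg_cong)
  also have "\<dots> = (\<lambda>j\<in>{..<n}. mul a ?z j \<oplus> s \<otimes> mul a b j)"
    by (rule linear_endoD[OF linear_mul[OF a] s z b])
  also have "\<dots> = (\<lambda>j\<in>{..<n}. s \<otimes> mul a b j)"
    unfolding linear_endo_zero[OF linear_mul[OF a]]
    by (rule restrict_ext) (use mul_closed[OF a b] s in \<open>auto simp: PiE_iff\<close>)
  finally show ?thesis .
qed

end

lemma (in cring) finsum_lessThan_Suc_shift:
  "f \<in> {..<Suc k} \<rightarrow> carrier R \<Longrightarrow> (\<Oplus>i\<in>{..<Suc k}. f i) = f 0 \<oplus> (\<Oplus>i\<in>{..<k}. f (Suc i))"
proof (induction k)
  case 0
  then show ?case by (subst finsum_lessThan_Suc) (auto simp: Pi_iff)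
next
  case (Suc k)
  have cl: "f 0 \<in> carrier R" "f (Suc k) \<in> carrier R" "(\<Oplus>i\<in>{..<k}. f (Suc i)) \<in> carrier R"
    using Suc.prems by (auto intro!: finsum_closed)
  have "(\<Oplus>i\<in>{..<Suc (Suc k)}. f i) = (\<Oplus>i\<in>{..<Suc k}. f i) \<oplus> f (Suc k)"
    using Suc.prems by (rule finsum_lessThan_Suc)
  also have "(\<Oplus>i\<in>{..<Suc k}. f i) = f 0 \<oplus> (\<Oplus>i\<in>{..<k}. f (Suc i))"
    using Suc.prems by (intro Suc.IH) auto
  also have "f 0 \<oplus> (\<Oplus>i\<in>{..<k}. f (Suc i)) \<oplus> f (Suc k) = f 0 \<oplus> ((\<Oplus>i\<in>{..<k}. f (Suc i)) \<oplus> f (Suc k))"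
    by (rule a_assoc[OF cl(1,3,2)])
  also have "(\<Oplus>i\<in>{..<k}. f (Suc i)) \<oplus> f (Suc k) = (\<Oplus>i\<in>{..<Suc k}. f (Suc i))"
    using Suc.prems by (intro finsum_lessThan_Suc[symmetric]) auto
  finally show ?case .
qed

section \<open>Evaluation of tuples at a root of the polynomial\<close>

definition eval_vec :: "('b, 'k) ring_scheme \<Rightarrow> ('a \<Rightarrow> 'b) \<Rightarrow> 'b \<Rightarrow> nat \<Rightarrow> (nat \<Rightarrow> 'a) \<Rightarrow> 'b" where
  "eval_vec L h \<theta> n a = (\<Oplus>\<^bsub>L\<^esub>i\<in>{..<n}. h (a i) \<otimes>\<^bsub>L\<^esub> \<theta> [^]\<^bsub>L\<^esub> i)"

locale companion_eval = companion R n c + L: cring L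
  for R (structure) and n c and L (structure) +
  fixes h \<theta>
  assumes h: "h \<in> ring_hom R L" and \<theta>: "\<theta> \<in> carrier L"
    and rel: "\<theta> [^]\<^bsub>L\<^esub> n = eval_vec L h \<theta> n c"
begin

abbreviation "\<rho> \<equiv> eval_vec L h \<theta> n"

lemma h_closed: "x \<in> carrier R \<Longrightarrow> h x \<in> carrier L"
  using h ring_hom_closed by metis

lemma h_zero: "h \<zero> = \<zero>\<^bsub>L\<^esub>"
  using ring_hom_zero[OF h ring_axioms L.ring_axioms] .

lemma rho_term_closed: "b \<in> M \<Longrightarrow> i < n \<Longrightarrow> h (b i) \<otimes>\<^bsub>L\<^esub> \<theta> [^]\<^bsub>L\<^esub> (j::nat) \<in> carrier L"
  using \<theta> h_closed by (auto simp: PiE_iff)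

lemma rho_closed: "b \<in> M \<Longrightarrow> \<rho> b \<in> carrier L"
  unfolding eval_vec_def using rho_term_closed by (auto intro!: L.finsum_closed)

text \<open>Multiplying by \<theta> raises each exponent by one. The top term then involves
  \<theta>^n, which \<open>rel\<close> rewrites through the entries of \<open>c\<close>; this is
  exactly the wrap-around term of the shift. In the proof \<open>b'\<close> is the shifted tuple
  before that correction.\<close>

lemma rho_shift:
  assumes b: "b \<in> M"
  shows "\<rho> (C b) = \<theta> \<otimes>\<^bsub>L\<^esub> \<rho> b"
proof -
  obtain m where m: "n = Suc m" using n by (cases n) auto
  have bR: "b i \<in> carrier R" if "i < n" for i using b that by auto
  have cR: "c i \<in> carrier R" if "i < n" for i using c that by auto
  have hb: "h (b i) \<in> carrier L" "h (c i) \<in> carrier L" if "i < n" for i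
    using bR cR h_closed that by auto
  let ?t = "\<lambda>i::nat. \<theta> [^]\<^bsub>L\<^esub> i"
  have t: "?t i \<in> carrier L" for i using \<theta> by simp
  define b' where "b' i = (if i = 0 then \<zero> else b (i - 1))" for i
  have b'R: "b' i \<in> carrier R" if "i < n" for i unfolding b'_def using bR that by auto
  have hb': "h (b' i) \<in> carrier L" if "i < n" for i using b'R h_closed that by auto
  have bm: "b m \<in> carrier R" "h (b m) \<in> carrier L" using bR hb m by auto
  have "\<rho> (C b) = (\<Oplus>\<^bsub>L\<^esub>i\<in>{..<n}. h (b' i) \<otimes>\<^bsub>L\<^esub> ?t i \<oplus>\<^bsub>L\<^esub> h (b m) \<otimes>\<^bsub>L\<^esub> (h (c i) \<otimes>\<^bsub>L\<^esub> ?t i))"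
    unfolding eval_vec_def
  proof (rule L.finsum_cong')
    fix i assume "i \<in> {..<n}"
    then have i: "i < n" by simp
    have "C b i = b' i \<oplus> c i \<otimes> b m" unfolding shift_def b'_def using i m by simp
    then have "h (C b i) = h (b' i) \<oplus>\<^bsub>L\<^esub> h (c i) \<otimes>\<^bsub>L\<^esub> h (b m)"
      using b'R[OF i] cR[OF i] bm(1) by (simp add: ring_hom_add[OF h] ring_hom_mult[OF h])
    then show "h (C b i) \<otimes>\<^bsub>L\<^esub> ?t i = h (b' i) \<otimes>\<^bsub>L\<^esub> ?t i \<oplus>\<^bsub>L\<^esub> h (b m) \<otimes>\<^bsub>L\<^esub> (h (c i) \<otimes>\<^bsub>L\<^esub> ?t i)"
      using hb'[OF i] hb(2)[OF i] bm(2) t[of i] by (simp only: L.l_distr L.m_closed) (simp add: L.m_ac)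
  qed (use hb' hb bm t in auto)
  also have "\<dots> = (\<Oplus>\<^bsub>L\<^esub>i\<in>{..<n}. h (b' i) \<otimes>\<^bsub>L\<^esub> ?t i)
      \<oplus>\<^bsub>L\<^esub> (\<Oplus>\<^bsub>L\<^esub>i\<in>{..<n}. h (b m) \<otimes>\<^bsub>L\<^esub> (h (c i) \<otimes>\<^bsub>L\<^esub> ?t i))"
    by (rule L.finsum_addf) (use hb' hb bm t in auto)
  also have "(\<Oplus>\<^bsub>L\<^esub>i\<in>{..<n}. h (b m) \<otimes>\<^bsub>L\<^esub> (h (c i) \<otimes>\<^bsub>L\<^esub> ?t i))
      = h (b m) \<otimes>\<^bsub>L\<^esub> (\<Oplus>\<^bsub>L\<^esub>i\<in>{..<n}. h (c i) \<otimes>\<^bsub>L\<^esub> ?t i)"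
    by (rule L.finsum_rdistr[symmetric]) (use hb bm t in auto)
  also have "(\<Oplus>\<^bsub>L\<^esub>i\<in>{..<n}. h (c i) \<otimes>\<^bsub>L\<^esub> ?t i) = ?t (Suc m)"
    using rel unfolding eval_vec_def m by simp
  also have "(\<Oplus>\<^bsub>L\<^esub>i\<in>{..<n}. h (b' i) \<otimes>\<^bsub>L\<^esub> ?t i)
      = h (b' 0) \<otimes>\<^bsub>L\<^esub> ?t 0 \<oplus>\<^bsub>L\<^esub> (\<Oplus>\<^bsub>L\<^esub>i\<in>{..<m}. h (b' (Suc i)) \<otimes>\<^bsub>L\<^esub> ?t (Suc i))"
    unfolding m by (rule L.finsum_lessThan_Suc_shift) (use hb' t m in auto)
  also have "\<dots> = (\<Oplus>\<^bsub>L\<^esub>i\<in>{..<m}. h (b i) \<otimes>\<^bsub>L\<^esub> ?t (Suc i))"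
  proof -
    have "(\<Oplus>\<^bsub>L\<^esub>i\<in>{..<m}. h (b i) \<otimes>\<^bsub>L\<^esub> ?t (Suc i)) \<in> carrier L"
      by (rule L.finsum_closed) (use hb t m \<theta> in auto)
    then show ?thesis by (simp add: b'_def h_zero del: L.nat_pow_Suc)
  qed
  also have "(\<Oplus>\<^bsub>L\<^esub>i\<in>{..<m}. h (b i) \<otimes>\<^bsub>L\<^esub> ?t (Suc i)) \<oplus>\<^bsub>L\<^esub> h (b m) \<otimes>\<^bsub>L\<^esub> ?t (Suc m)
      = (\<Oplus>\<^bsub>L\<^esub>i\<in>{..<n}. h (b i) \<otimes>\<^bsub>L\<^esub> ?t (Suc i))"
    unfolding m by (rule L.finsum_lessThan_Suc[symmetric]) (use hb t m \<theta> in auto)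
  also have "\<dots> = (\<Oplus>\<^bsub>L\<^esub>i\<in>{..<n}. \<theta> \<otimes>\<^bsub>L\<^esub> (h (b i) \<otimes>\<^bsub>L\<^esub> ?t i))"
    by (rule L.finsum_cong') (use hb t \<theta> in \<open>auto simp: L.m_ac\<close>)
  also have "\<dots> = \<theta> \<otimes>\<^bsub>L\<^esub> \<rho> b"
    unfolding eval_vec_def by (rule L.finsum_rdistr[symmetric]) (use hb t \<theta> in auto)
  finally show ?thesis .
qed

lemma rho_shift_pow: "b \<in> M \<Longrightarrow> \<rho> ((C ^^ k) b) = \<theta> [^]\<^bsub>L\<^esub> k \<otimes>\<^bsub>L\<^esub> \<rho> b"
proof (induction k)
  case 0
  then show ?case using rho_closed by simp
next
  case (Suc k)
  have "\<rho> ((C ^^ Suc k) b) = \<theta> \<otimes>\<^bsub>L\<^esub> (\<theta> [^]\<^bsub>L\<^esub> k \<otimes>\<^bsub>L\<^esub> \<rho> b)"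
    using Suc rho_shift[OF C_pow_closed[OF Suc.prems]] by simp
  then show ?case using \<theta> rho_closed[OF Suc.prems] by (simp add: L.m_ac)
qed

lemma rho_lincomb:
  assumes "a \<in> {..<k} \<rightarrow> carrier R" "\<And>i. i < k \<Longrightarrow> v i \<in> M"
  shows "\<rho> (lincomb R n k a v) = (\<Oplus>\<^bsub>L\<^esub>i\<in>{..<k}. h (a i) \<otimes>\<^bsub>L\<^esub> \<rho> (v i))"
  using assms
proof (induction k)
  case 0
  have "\<rho> (lincomb R n 0 a v) = (\<Oplus>\<^bsub>L\<^esub>i\<in>{..<n}. \<zero>\<^bsub>L\<^esub>)"
    unfolding eval_vec_def lincomb_def
    by (rule L.finsum_cong') (use \<theta> h_zero in auto)
  then show ?case by simp
next
  case (Suc k)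
  have ak: "a k \<in> carrier R" "a \<in> {..<k} \<rightarrow> carrier R" using Suc.prems(1) by auto
  have vk: "v k \<in> M" and vi: "\<And>i. i < k \<Longrightarrow> v i \<in> M" using Suc.prems(2) by auto
  let ?w = "lincomb R n k a v"
  have wM: "?w \<in> M" by (rule lincomb_closed[OF ak(2) vi])
  have expand: "lincomb R n (Suc k) a v = (\<lambda>j\<in>{..<n}. ?w j \<oplus> a k \<otimes> v k j)"
    by (rule lincomb_Suc) (rule Suc.prems(1), erule Suc.prems(2))
  have hak: "h (a k) \<in> carrier L" using ak h_closed by simp
  have "\<rho> (lincomb R n (Suc k) a v)
      = (\<Oplus>\<^bsub>L\<^esub>i\<in>{..<n}. h (?w i) \<otimes>\<^bsub>L\<^esub> \<theta> [^]\<^bsub>L\<^esub> i \<oplus>\<^bsub>L\<^esub> h (a k) \<otimes>\<^bsub>L\<^esub> (h (v k i) \<otimes>\<^bsub>L\<^esub> \<theta> [^]\<^bsub>L\<^esub> i))"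
    unfolding eval_vec_def expand
  proof (rule L.finsum_cong')
    fix i assume i: "i \<in> {..<n}"
    have cl: "?w i \<in> carrier R" "v k i \<in> carrier R" using wM vk i by auto
    have "h (?w i \<oplus> a k \<otimes> v k i) = h (?w i) \<oplus>\<^bsub>L\<^esub> h (a k) \<otimes>\<^bsub>L\<^esub> h (v k i)"
      using cl ak(1) by (simp add: ring_hom_add[OF h] ring_hom_mult[OF h])
    then show "h ((\<lambda>j\<in>{..<n}. ?w j \<oplus> a k \<otimes> v k j) i) \<otimes>\<^bsub>L\<^esub> \<theta> [^]\<^bsub>L\<^esub> i
        = h (?w i) \<otimes>\<^bsub>L\<^esub> \<theta> [^]\<^bsub>L\<^esub> i \<oplus>\<^bsub>L\<^esub> h (a k) \<otimes>\<^bsub>L\<^esub> (h (v k i) \<otimes>\<^bsub>L\<^esub> \<theta> [^]\<^bsub>L\<^esub> i)"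
      using i cl ak(1) \<theta> h_closed by (simp add: L.l_distr L.m_assoc)
  qed (use rho_term_closed[OF wM] rho_term_closed[OF vk] hak in auto)
  also have "\<dots> = \<rho> ?w \<oplus>\<^bsub>L\<^esub> (\<Oplus>\<^bsub>L\<^esub>i\<in>{..<n}. h (a k) \<otimes>\<^bsub>L\<^esub> (h (v k i) \<otimes>\<^bsub>L\<^esub> \<theta> [^]\<^bsub>L\<^esub> i))"
    unfolding eval_vec_def
    by (rule L.finsum_addf) (use rho_term_closed[OF wM] rho_term_closed[OF vk] hak in auto)
  also have "(\<Oplus>\<^bsub>L\<^esub>i\<in>{..<n}. h (a k) \<otimes>\<^bsub>L\<^esub> (h (v k i) \<otimes>\<^bsub>L\<^esub> \<theta> [^]\<^bsub>L\<^esub> i)) = h (a k) \<otimes>\<^bsub>L\<^esub> \<rho> (v k)"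
    unfolding eval_vec_def
    by (rule L.finsum_rdistr[symmetric]) (use rho_term_closed[OF vk] hak in auto)
  also have "\<rho> ?w = (\<Oplus>\<^bsub>L\<^esub>i\<in>{..<k}. h (a i) \<otimes>\<^bsub>L\<^esub> \<rho> (v i))" by (rule Suc.IH[OF ak(2) vi])
  also have "\<dots> \<oplus>\<^bsub>L\<^esub> h (a k) \<otimes>\<^bsub>L\<^esub> \<rho> (v k) = (\<Oplus>\<^bsub>L\<^esub>i\<in>{..<Suc k}. h (a i) \<otimes>\<^bsub>L\<^esub> \<rho> (v i))"
  proof (rule L.finsum_lessThan_Suc[symmetric], rule)
    fix i assume "i \<in> {..<Suc k}"
    then have "a i \<in> carrier R" "v i \<in> M" using Suc.prems by auto
    then show "h (a i) \<otimes>\<^bsub>L\<^esub> \<rho> (v i) \<in> carrier L" using h_closed rho_closed by simp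
  qed
  finally show ?case .
qed

text \<open>\<open>mul a\<close> is the sum of the a_i times powers of the shift, and evaluation
  turns each shift into a factor \<theta>.\<close>

lemma rho_mul:
  assumes a: "a \<in> M" and b: "b \<in> M"
  shows "\<rho> (mul a b) = \<rho> a \<otimes>\<^bsub>L\<^esub> \<rho> b"
proof -
  have ha: "h (a i) \<in> carrier L" if "i < n" for i using a h_closed that by auto
  have "\<rho> (mul a b) = (\<Oplus>\<^bsub>L\<^esub>i\<in>{..<n}. h (a i) \<otimes>\<^bsub>L\<^esub> \<rho> ((C ^^ i) b))"
    unfolding vmult_def by (rule rho_lincomb[OF Pi_of_M[OF a] C_pow_closed[OF b]])
  also have "\<dots> = (\<Oplus>\<^bsub>L\<^esub>i\<in>{..<n}. (h (a i) \<otimes>\<^bsub>L\<^esub> \<theta> [^]\<^bsub>L\<^esub> i) \<otimes>\<^bsub>L\<^esub> \<rho> b)"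
    by (rule L.finsum_cong') (use ha \<theta> rho_closed[OF b] in \<open>auto simp: rho_shift_pow[OF b] L.m_assoc\<close>)
  also have "\<dots> = \<rho> a \<otimes>\<^bsub>L\<^esub> \<rho> b"
    unfolding eval_vec_def[of L h \<theta> n a]
    by (rule L.finsum_ldistr[symmetric]) (use ha \<theta> rho_closed[OF b] in auto)
  finally show ?thesis .
qed

end

text \<open>The coefficients are lifted arbitrarily from the residue field. \<open>\<rho>\<close>
  reduces a tuple modulo \<open>\<mm>\<close> and evaluates it at \<theta>; it is nonzero on
  unimodular tuples since the powers of \<theta> are independent, and zero on tuples over
  \<open>\<mm>\<close>. As \<open>\<rho>\<close> is multiplicative into a field, a product of
  unimodular tuples cannot have all its entries in \<open>\<mm>\<close>.\<close>

lemma (in uniformized_valuation_ring) exists_companion_unimodular_closed: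
  assumes n: "0 < n"
  obtains c where "c \<in> {..<n} \<rightarrow> carrier R"
    and "\<And>a b. a \<in> unimodular R n \<Longrightarrow> b \<in> unimodular R n \<Longrightarrow> vmult R n c a b \<in> unimodular R n"
proof -
  let ?k = "R Quot \<mm>"
  interpret k: field ?k by (rule mm.quotient_is_field) (rule is_cring)
  have coset: "(\<lambda>x. \<mm> +> x) \<in> ring_hom R ?k" by (rule mm.rcos_ring_hom)
  have carrier_k: "carrier ?k = (\<lambda>x. \<mm> +> x) ` carrier R"
    unfolding FactRing_def A_RCOSETS_def' by auto
  have fin: "finite (carrier ?k)" unfolding carrier_k using finite_carrier by simp
  obtain L :: "(('a set list \<times> nat) multiset \<Rightarrow> 'a set) ring" and h \<theta> d where
    L: "field L" "h \<in> ring_hom ?k L" "\<theta> \<in> carrier L" "d \<in> {..<n} \<rightarrow> carrier ?k"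
    and rel: "\<theta> [^]\<^bsub>L\<^esub> n = (\<Oplus>\<^bsub>L\<^esub>i\<in>{..<n}. h (d i) \<otimes>\<^bsub>L\<^esub> \<theta> [^]\<^bsub>L\<^esub> i)"
    and indep: "\<And>a. a \<in> {..<n} \<rightarrow> carrier ?k \<Longrightarrow>
           (\<Oplus>\<^bsub>L\<^esub>i\<in>{..<n}. h (a i) \<otimes>\<^bsub>L\<^esub> \<theta> [^]\<^bsub>L\<^esub> i) = \<zero>\<^bsub>L\<^esub> \<Longrightarrow> \<forall>i<n. a i = \<zero>\<^bsub>?k\<^esub>"
    using k.finite_field_extension_of_degree[OF fin n] by blast
  interpret L: field L by (rule L(1))
  have "\<forall>i. \<exists>x. i < n \<longrightarrow> x \<in> carrier R \<and> d i = \<mm> +> x"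
    using L(4) unfolding carrier_k by (auto simp: Pi_iff image_iff)
  then obtain c where c: "\<And>i. i < n \<Longrightarrow> c i \<in> carrier R" "\<And>i. i < n \<Longrightarrow> d i = \<mm> +> c i"
    by metis
  define H where "H x = h (\<mm> +> x)" for x
  have H: "H \<in> ring_hom R L"
    using ring_hom_trans[OF coset L(2)] unfolding H_def comp_def .
  have hd: "h (d i) \<in> carrier L" if "i < n" for i
    using ring_hom_closed[OF L(2), of "d i"] L(4) that by auto
  interpret companion_eval R n c L H \<theta>
  proof unfold_locales
    show "c \<in> {..<n} \<rightarrow> carrier R" using c by auto
    show "0 < n" by (rule n)
    show "H \<in> ring_hom R L" by (rule H)
    show "\<theta> \<in> carrier L" by (rule L(3))
    show "\<theta> [^]\<^bsub>L\<^esub> n = eval_vec L H \<theta> n c"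
      unfolding rel eval_vec_def
      by (rule L.finsum_cong') (use c hd L(3) in \<open>auto simp: H_def\<close>)
  qed
  have ker: "H x = \<zero>\<^bsub>L\<^esub>" if "x \<in> \<mm>" for x
  proof -
    have "\<mm> +> x = \<zero>\<^bsub>?k\<^esub>" using mm.a_rcos_const[OF that] by (simp add: FactRing_def)
    then show ?thesis
      unfolding H_def using ring_hom_zero[OF L(2) k.ring_axioms L.ring_axioms] by simp
  qed
  have rho_unimodular: "\<rho> a \<noteq> \<zero>\<^bsub>L\<^esub>" if a: "a \<in> unimodular R n" for a
  proof
    assume zero: "\<rho> a = \<zero>\<^bsub>L\<^esub>"
    have aR: "a i \<in> carrier R" if "i < n" for i using unimodular_Pi[OF a] that by auto
    have "(\<lambda>i. \<mm> +> a i) \<in> {..<n} \<rightarrow> carrier ?k" unfolding carrier_k using aR by auto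
    moreover have "(\<Oplus>\<^bsub>L\<^esub>i\<in>{..<n}. h (\<mm> +> a i) \<otimes>\<^bsub>L\<^esub> \<theta> [^]\<^bsub>L\<^esub> i) = \<zero>\<^bsub>L\<^esub>"
      using zero unfolding eval_vec_def H_def .
    ultimately have "\<forall>i<n. \<mm> +> a i = \<zero>\<^bsub>?k\<^esub>" by (rule indep)
    then have "a i \<in> \<mm>" if "i < n" for i
      using mm.a_rcos_self[OF aR[OF that]] that by (simp add: FactRing_def)
    moreover obtain i where "i < n" "a i \<in> Units R" using a unimodular_iff by auto
    ultimately show False using Units_iff by blast
  qed
  have "vmult R n c a b \<in> unimodular R n" if a: "a \<in> unimodular R n" and b: "b \<in> unimodular R n" for a b
  proof (rule ccontr)
    have aM: "a \<in> M" and bM: "b \<in> M" using a b unimodular_PiE by auto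
    assume "vmult R n c a b \<notin> unimodular R n"
    then have "\<forall>i<n. mul a b i \<in> \<mm>"
      using mul_closed[OF aM bM] unfolding unimodular_eq_Diff by (auto simp: PiE_iff)
    then have "\<rho> (mul a b) = (\<Oplus>\<^bsub>L\<^esub>i\<in>{..<n}. \<zero>\<^bsub>L\<^esub>)"
      unfolding eval_vec_def by (intro L.finsum_cong') (use ker L(3) in auto)
    then have "\<rho> a \<otimes>\<^bsub>L\<^esub> \<rho> b = \<zero>\<^bsub>L\<^esub>" using rho_mul[OF aM bM] by simp
    then show False
      using L.integral rho_closed aM bM rho_unimodular a b by blast
  qed
  with companion_eval_axioms c show thesis by (intro that[of c]) auto
qed

section \<open>Tuples modulo units\<close>

context uniformized_valuation_ring
begin

lemma unit_scale_unimodular: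
  assumes "a \<in> unimodular R n" "u \<in> Units R"
  shows "(\<lambda>i\<in>{..<n}. u \<otimes> a i) \<in> unimodular R n"
proof -
  obtain i where i: "i < n" "a i \<in> Units R" using assms unimodular_iff by auto
  then have "(\<lambda>i\<in>{..<n}. u \<otimes> a i) i \<in> Units R" using assms by simp
  moreover have "(\<lambda>i\<in>{..<n}. u \<otimes> a i) \<in> {..<n} \<rightarrow>\<^sub>E carrier R"
    using unimodular_Pi[OF assms(1)] assms(2) by (auto simp: restrict_PiE_iff)
  ultimately show ?thesis using i unimodular_iff by blast
qed

lemma unit_scale_scale:
  assumes "a \<in> {..<n} \<rightarrow> carrier R" "u \<in> carrier R" "v \<in> carrier R"
  shows "(\<lambda>i\<in>{..<n}. v \<otimes> (\<lambda>i\<in>{..<n}. u \<otimes> a i) i) = (\<lambda>i\<in>{..<n}. (v \<otimes> u) \<otimes> a i)"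
  by (rule restrict_ext) (use assms in \<open>auto simp: m_assoc Pi_iff\<close>)

lemma unit_scale_one:
  assumes "a \<in> {..<n} \<rightarrow>\<^sub>E carrier R"
  shows "(\<lambda>i\<in>{..<n}. \<one> \<otimes> a i) = a"
  using assms by (auto simp: fun_eq_iff PiE_iff extensional_def)

lemma unit_multiples_class:
  assumes "a \<in> unimodular R n"
  shows "unit_multiples R n `` {a} = (\<lambda>u. \<lambda>i\<in>{..<n}. u \<otimes> a i) ` Units R"
  unfolding unit_multiples_def using assms unit_scale_unimodular[OF assms] by auto

lemma equiv_unit_multiples: "equiv (unimodular R n) (unit_multiples R n)"
proof (rule equivI)
  show "unit_multiples R n \<subseteq> unimodular R n \<times> unimodular R n"
    unfolding unit_multiples_def by auto
  show "refl_on (unimodular R n) (unit_multiples R n)"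
  proof (rule refl_onI)
    fix a assume a: "a \<in> unimodular R n"
    then have "a = (\<lambda>i\<in>{..<n}. \<one> \<otimes> a i)" using unit_scale_one unimodular_PiE by metis
    then show "(a, a) \<in> unit_multiples R n" unfolding unit_multiples_def using a by blast
  qed
  show "sym (unit_multiples R n)"
  proof (rule symI)
    fix a b assume "(a, b) \<in> unit_multiples R n"
    then obtain u where a: "a \<in> unimodular R n" and b: "b \<in> unimodular R n"
      and u: "u \<in> Units R" "b = (\<lambda>i\<in>{..<n}. u \<otimes> a i)" unfolding unit_multiples_def by auto
    have "(\<lambda>i\<in>{..<n}. inv u \<otimes> b i) = (\<lambda>i\<in>{..<n}. (inv u \<otimes> u) \<otimes> a i)"
      unfolding u(2) by (rule unit_scale_scale) (use u unimodular_Pi[OF a] in auto)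
    also have "\<dots> = a" using unit_scale_one[OF unimodular_PiE[OF a]] u(1) by simp
    finally have "a = (\<lambda>i\<in>{..<n}. inv u \<otimes> b i)" by simp
    moreover have "inv u \<in> Units R" using u(1) by simp
    ultimately show "(b, a) \<in> unit_multiples R n"
      unfolding unit_multiples_def using a b by blast
  qed
  show "trans (unit_multiples R n)"
  proof (rule transI)
    fix a b d assume "(a, b) \<in> unit_multiples R n" "(b, d) \<in> unit_multiples R n"
    then obtain u v where a: "a \<in> unimodular R n" and d: "d \<in> unimodular R n"
      and u: "u \<in> Units R" "b = (\<lambda>i\<in>{..<n}. u \<otimes> a i)"
      and v: "v \<in> Units R" "d = (\<lambda>i\<in>{..<n}. v \<otimes> b i)"
      unfolding unit_multiples_def by auto
    have "d = (\<lambda>i\<in>{..<n}. (v \<otimes> u) \<otimes> a i)"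
      unfolding v(2) u(2) by (rule unit_scale_scale) (use u v unimodular_Pi[OF a] in auto)
    moreover have "v \<otimes> u \<in> Units R" using u v by simp
    ultimately show "(a, d) \<in> unit_multiples R n"
      unfolding unit_multiples_def using a d by blast
  qed
qed

text \<open>A unit entry of \<open>a\<close> makes the scaling action of the unit group free, so
  each class has as many elements as there are units.\<close>

lemma card_unit_multiples_class:
  assumes "a \<in> unimodular R n"
  shows "card (unit_multiples R n `` {a}) = q ^ (l - 1) * (q - 1)"
proof -
  obtain i where i: "i < n" "a i \<in> Units R" using assms unimodular_iff by auto
  have "inj_on (\<lambda>u. \<lambda>i\<in>{..<n}. u \<otimes> a i) (Units R)"
  proof (rule inj_onI)
    fix u v assume u: "u \<in> Units R" "v \<in> Units R"
      and "(\<lambda>i\<in>{..<n}. u \<otimes> a i) = (\<lambda>i\<in>{..<n}. v \<otimes> a i)"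
    then have "(\<lambda>i\<in>{..<n}. u \<otimes> a i) i = (\<lambda>i\<in>{..<n}. v \<otimes> a i) i" by simp
    then have "a i \<otimes> u = a i \<otimes> v" using i u by (simp add: m_comm Units_closed)
    then show "u = v" using Units_l_cancel[OF i(2), of u v] u by (simp add: Units_closed)
  qed
  then show ?thesis
    unfolding unit_multiples_class[OF assms] by (simp add: card_image card_Units)
qed

lemma dot_unit_multiples_zero_iff:
  assumes "(a, a') \<in> unit_multiples R n" "(b, b') \<in> unit_multiples R n"
  shows "dot R n a' b' = \<zero> \<longleftrightarrow> dot R n a b = \<zero>"
proof -
  obtain u v where a: "a \<in> unimodular R n" and b: "b \<in> unimodular R n"
    and u: "u \<in> Units R" "a' = (\<lambda>i\<in>{..<n}. u \<otimes> a i)"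
    and v: "v \<in> Units R" "b' = (\<lambda>i\<in>{..<n}. v \<otimes> b i)"
    using assms unfolding unit_multiples_def by auto
  have aP: "a \<in> {..<n} \<rightarrow> carrier R" and bP: "b \<in> {..<n} \<rightarrow> carrier R"
    and bP': "b' \<in> {..<n} \<rightarrow> carrier R"
    using a b unimodular_Pi unit_scale_unimodular[OF b v(1)] v(2) by auto
  have cl: "dot R n a b \<in> carrier R" using dot_closed[OF aP bP] .
  have "dot R n a' b' = u \<otimes> (v \<otimes> dot R n a b)"
    unfolding u(2) using dot_scale_left[OF aP bP', of u] dot_scale_right[OF aP bP, of v] u v
    by (auto simp: Units_closed)
  also have "\<dots> = (u \<otimes> v) \<otimes> dot R n a b" using u v cl by (simp add: m_assoc Units_closed)
  finally have eq: "dot R n a' b' = (u \<otimes> v) \<otimes> dot R n a b" .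
  have uv: "u \<otimes> v \<in> Units R" using u v by simp
  show ?thesis
    unfolding eq using Units_l_cancel[OF uv cl zero_closed] uv Units_closed[OF uv] by simp
qed

lemma class_unit_multiples_eq_iff:
  "a \<in> unimodular R n \<Longrightarrow> b \<in> unimodular R n \<Longrightarrow>
    unit_multiples R n `` {a} = unit_multiples R n `` {b} \<longleftrightarrow> (a, b) \<in> unit_multiples R n"
  using eq_equiv_class_iff[OF equiv_unit_multiples] by blast

definition Um0_edges :: "nat \<Rightarrow> (nat \<Rightarrow> 'a) set rel" where
  "Um0_edges n = {(unit_multiples R n `` {a}, unit_multiples R n `` {b}) | a b.
     a \<in> unimodular R n \<and> b \<in> unimodular R n \<and> dot R n a b = \<zero>}"

text \<open>The edge relation asks for some orthogonal representatives; rescaling by units shows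
  that then all representatives are orthogonal.\<close>

lemma Um0_edges_iff:
  assumes a: "a \<in> unimodular R n" and b: "b \<in> unimodular R n"
  shows "(unit_multiples R n `` {a}, unit_multiples R n `` {b}) \<in> Um0_edges n \<longleftrightarrow> dot R n a b = \<zero>"
proof
  assume "(unit_multiples R n `` {a}, unit_multiples R n `` {b}) \<in> Um0_edges n"
  then obtain a' b' where "a' \<in> unimodular R n" "b' \<in> unimodular R n" "dot R n a' b' = \<zero>"
    "unit_multiples R n `` {a} = unit_multiples R n `` {a'}"
    "unit_multiples R n `` {b} = unit_multiples R n `` {b'}"
    unfolding Um0_edges_def by auto
  then show "dot R n a b = \<zero>"
    using class_unit_multiples_eq_iff a b dot_unit_multiples_zero_iff by metis
next
  assume "dot R n a b = \<zero>"
  then show "(unit_multiples R n `` {a}, unit_multiples R n `` {b}) \<in> Um0_edges n"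
    unfolding Um0_edges_def using a b by blast
qed

lemma Um0_edges_subset:
  "Um0_edges n \<subseteq> (unimodular R n // unit_multiples R n) \<times> (unimodular R n // unit_multiples R n)"
  unfolding Um0_edges_def by (auto intro: quotientI)

lemma Um0_eq: "Um0 R n = bipartite_graph (unimodular R n // unit_multiples R n) (Um0_edges n)"
  unfolding Um0_def Um0_edges_def ..

text \<open>The least exponent of \<pi> among the nonzero entries is factored out; the entry
  attaining it leaves a unit behind.\<close>

lemma vec_pi_pow_decomp:
  assumes z: "z \<in> {..<n::nat} \<rightarrow>\<^sub>E carrier R" "z \<noteq> (\<lambda>i\<in>{..<n}. \<zero>)"
  obtains k u where "k < l" "u \<in> unimodular R n" "z = (\<lambda>i\<in>{..<n}. \<pi> [^] k \<otimes> u i)"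
proof -
  define P where "P k \<longleftrightarrow> k < l \<and> (\<exists>i<n. \<exists>u\<in>Units R. z i = \<pi> [^] k \<otimes> u)" for k :: nat
  have zR: "z i \<in> carrier R" if "i < n" for i using z that by auto
  obtain i where i: "i < n" "z i \<noteq> \<zero>"
    using z by (auto simp: fun_eq_iff PiE_iff extensional_def split: if_splits)
  obtain k u where "k < l" "u \<in> Units R" "z i = \<pi> [^] k \<otimes> u"
    using pi_pow_unit_decomp[OF zR[OF i(1)] i(2)] .
  then have "\<exists>k. P k" unfolding P_def using i(1) by blast
  then obtain k where k: "P k" and min: "\<And>j. P j \<Longrightarrow> k \<le> j"
    using exists_least_iff[of P] not_less by metis
  have "\<exists>y. y \<in> carrier R \<and> z j = \<pi> [^] k \<otimes> y" if "j < n" for j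
  proof (cases "z j = \<zero>")
    case True
    then show ?thesis by (intro exI[of _ \<zero>]) simp
  next
    case False
    obtain m w where w: "m < l" "w \<in> Units R" "z j = \<pi> [^] m \<otimes> w"
      using pi_pow_unit_decomp[OF zR[OF \<open>j < n\<close>] False] .
    then have "k \<le> m" using min \<open>j < n\<close> unfolding P_def by blast
    then have "z j = \<pi> [^] k \<otimes> (\<pi> [^] (m - k) \<otimes> w)"
      unfolding w(3) using w(2) \<open>k \<le> m\<close>
      by (simp add: m_assoc[symmetric] nat_pow_mult Units_closed)
    moreover have "\<pi> [^] (m - k) \<otimes> w \<in> carrier R" using w(2) by (simp add: Units_closed)
    ultimately show ?thesis by (intro exI[of _ "\<pi> [^] (m - k) \<otimes> w"] conjI)
  qed
  then obtain y where y: "\<And>j. j < n \<Longrightarrow> y j \<in> carrier R" "\<And>j. j < n \<Longrightarrow> z j = \<pi> [^] k \<otimes> y j"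
    by metis
  obtain i0 u0 where i0: "i0 < n" "u0 \<in> Units R" "z i0 = \<pi> [^] k \<otimes> u0" and kl: "k < l"
    using k unfolding P_def by blast
  \<comment> \<open>Quotients by \<pi>^k are not unique, so the entry at \<open>i0\<close> is
    replaced by the quotient already known to be a unit.\<close>
  define u where "u = (\<lambda>i\<in>{..<n}. (y(i0 := u0)) i)"
  have "u \<in> {..<n} \<rightarrow>\<^sub>E carrier R" unfolding u_def using y i0 by (auto simp: restrict_PiE_iff)
  moreover have "u i0 \<in> Units R" unfolding u_def using i0 by simp
  ultimately have "u \<in> unimodular R n" using unimodular_iff i0(1) by blast
  moreover have "z = (\<lambda>i\<in>{..<n}. \<pi> [^] k \<otimes> u i)"
    using z(1) y(2) i0 by (auto simp: u_def fun_eq_iff PiE_iff extensional_def)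
  ultimately show thesis using that kl by blast
qed

end

section \<open>The Cayley structure\<close>

locale unimodular_companion = uniformized_valuation_ring R \<pi> q l + companion R n c
  for R (structure) and \<pi> q l n c +
  assumes mul_unimodular:
    "a \<in> unimodular R n \<Longrightarrow> b \<in> unimodular R n \<Longrightarrow> vmult R n c a b \<in> unimodular R n"
begin

abbreviation "V \<equiv> unimodular R n"

lemma VM: "a \<in> V \<Longrightarrow> a \<in> M" by (rule unimodular_PiE)

lemma e0_unimodular: "e\<^sub>0 \<in> V"
  unfolding unimodular_iff using unit_vec_closed n by (auto simp: unit_vec_def intro!: exI[of _ 0])

text \<open>The difference of two tuples, written with the scalar -1 to fit the linearity condition.
  Cancellation and injectivity of the pairing both reduce to this tuple being zero.\<close>

lemma diff_vec:
  assumes "b \<in> M" "b' \<in> M"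
  obtains z where "z \<in> M"
    and "z = (\<lambda>j\<in>{..<n}. \<zero>) \<Longrightarrow> b = b'"
    and "\<And>a. a \<in> M \<Longrightarrow> mul a z = (\<lambda>j\<in>{..<n}. mul a b j \<oplus> \<ominus> \<one> \<otimes> mul a b' j)"
proof -
  have bR: "b j \<in> carrier R" "b' j \<in> carrier R" if "j < n" for j using assms that by auto
  let ?z = "\<lambda>j\<in>{..<n}. b j \<oplus> \<ominus> \<one> \<otimes> b' j"
  have zM: "?z \<in> M" using bR by (auto simp: restrict_PiE_iff)
  have eq: "b = b'" if z0: "?z = (\<lambda>j\<in>{..<n}. \<zero>)"
  proof (rule PiE_ext[OF assms])
    fix j assume "j \<in> {..<n}"
    then have j: "j < n" by simp
    have "?z j = \<zero>" unfolding z0 using j by simp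
    then have "b j \<ominus> b' j = \<zero>" using j bR[OF j] by (simp add: l_minus a_minus_def)
    then show "b j = b' j" using bR[OF j] by simp
  qed
  have "mul a ?z = (\<lambda>j\<in>{..<n}. mul a b j \<oplus> \<ominus> \<one> \<otimes> mul a b' j)" if "a \<in> M" for a
    by (rule linear_endoD[OF linear_mul[OF that] _ assms]) simp
  with zM eq show thesis using that[OF zM] by blast
qed

text \<open>A nonzero difference of \<open>b\<close> and \<open>b'\<close> is \<pi>^k u with k < l
  and u unimodular. Its product with \<open>a\<close> is \<pi>^k times the unimodular tuple
  \<open>mul a u\<close>; a unit entry there would force \<pi>^k = 0.\<close>

lemma mul_cancel:
  assumes a: "a \<in> V" and b: "b \<in> M" "b' \<in> M" and eq: "mul a b = mul a b'"
  shows "b = b'"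
proof -
  obtain z where z: "z \<in> M" "z = (\<lambda>j\<in>{..<n}. \<zero>) \<Longrightarrow> b = b'"
      "\<And>a. a \<in> M \<Longrightarrow> mul a z = (\<lambda>j\<in>{..<n}. mul a b j \<oplus> \<ominus> \<one> \<otimes> mul a b' j)"
    by (rule diff_vec[OF b]) blast
  have az: "mul a z = (\<lambda>j\<in>{..<n}. \<zero>)"
    unfolding z(3)[OF VM[OF a]] eq
  proof (rule restrict_ext)
    fix j assume "j \<in> {..<n}"
    then have "mul a b' j \<in> carrier R" using mul_closed[OF VM[OF a] b(2)] by auto
    then show "mul a b' j \<oplus> \<ominus> \<one> \<otimes> mul a b' j = \<zero>" by (simp add: l_minus r_neg)
  qed
  show ?thesis
  proof (rule ccontr)
    assume "b \<noteq> b'"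
    then have "z \<noteq> (\<lambda>j\<in>{..<n}. \<zero>)" using z(2) by blast
    then obtain k u where u: "k < l" "u \<in> V" "z = (\<lambda>i\<in>{..<n}. \<pi> [^] k \<otimes> u i)"
      using vec_pi_pow_decomp[OF z(1)] by blast
    have "mul a z = (\<lambda>j\<in>{..<n}. \<pi> [^] k \<otimes> mul a u j)"
      unfolding u(3) by (rule mul_scale_right[OF VM[OF a] VM[OF u(2)]]) simp
    moreover obtain i where i: "i < n" "mul a u i \<in> Units R"
      using mul_unimodular[OF a u(2)] unimodular_iff by auto
    ultimately have "(\<lambda>j\<in>{..<n}. \<pi> [^] k \<otimes> mul a u j) i = (\<lambda>j\<in>{..<n}. \<zero>) i"
      using az by simp
    then have "\<pi> [^] k \<otimes> mul a u i = \<zero>" using i(1) by simp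
    then have "mul a u i \<otimes> \<pi> [^] k = mul a u i \<otimes> \<zero>" using i(2) by (simp add: m_comm Units_closed)
    then have "\<pi> [^] k = \<zero>" using Units_l_cancel[OF i(2)] by simp
    then show False using pi_pow_eq_zero_iff u(1) by simp
  qed
qed

section \<open>The group of unimodular tuples and its pairing\<close>

definition A :: "(nat \<Rightarrow> 'a) monoid" where
  "A = \<lparr>carrier = V, monoid.mult = mul, monoid.one = e\<^sub>0\<rparr>"

lemma A_simps [simp]: "carrier A = V" "x \<otimes>\<^bsub>A\<^esub> y = mul x y" "\<one>\<^bsub>A\<^esub> = e\<^sub>0"
  by (simp_all add: A_def)

text \<open>Cancellation makes multiplication by a unimodular tuple injective on the finite set
  \<open>V\<close>, hence onto, so the unit element is reached.\<close>

lemma comm_group_A: "comm_group A"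
proof (rule comm_groupI; unfold A_simps)
  fix a assume a: "a \<in> V"
  have "inj_on (mul a) V" using mul_cancel[OF a] VM by (intro inj_onI) blast
  then have "mul a ` V = V"
    using mul_unimodular[OF a] finite_unimodular by (intro endo_inj_surj) auto
  then obtain b where "b \<in> V" "mul a b = e\<^sub>0" using e0_unimodular by (metis imageE)
  then show "\<exists>b\<in>V. mul b a = e\<^sub>0" using mul_comm VM a by metis
next
  show "mul (mul a b) d = mul a (mul b d)" if "a \<in> V" "b \<in> V" "d \<in> V" for a b d
    using that by (intro mul_assoc VM)
  show "mul a b = mul b a" if "a \<in> V" "b \<in> V" for a b
    using that by (intro mul_comm VM)
qed (use mul_unimodular e0_unimodular e0_mul VM in auto)

sublocale A: comm_group A by (rule comm_group_A)

text \<open>The dot product is the perfect pairing \<open>(a, y) \<mapsto> mul a y 0\<close>, up to the change of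
  coordinates \<open>pairing_map\<close> of the second argument.\<close>

definition pairing_map :: "(nat \<Rightarrow> 'a) \<Rightarrow> nat \<Rightarrow> 'a" where
  "pairing_map y = (\<lambda>i\<in>{..<n}. (C ^^ i) y 0)"

lemma dot_pairing_map:
  assumes "a \<in> M" "y \<in> M" shows "dot R n a (pairing_map y) = mul a y 0"
proof -
  have "(C ^^ i) y 0 \<in> carrier R" for i using C_pow_closed[OF assms(2), of i] n by auto
  then show ?thesis
    unfolding mul_apply[OF n] dot_def pairing_map_def
    by (intro finsum_cong') (use assms(1) in \<open>auto simp: PiE_iff\<close>)
qed

lemma pairing_map_closed: "y \<in> M \<Longrightarrow> pairing_map y \<in> M"
proof -
  assume "y \<in> M"
  then have "(C ^^ i) y 0 \<in> carrier R" for i using C_pow_closed[of y i] n by auto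
  then show ?thesis unfolding pairing_map_def by (simp add: restrict_PiE_iff)
qed

lemma e0_zero: "e\<^sub>0 0 = \<one>" using n by (simp add: unit_vec_def)

text \<open>Paired with the group inverse of \<open>y\<close>, the image gives the constant
  coefficient of the unit element, namely 1, and a unit dot product forces unimodularity.\<close>

lemma pairing_map_unimodular:
  assumes y: "y \<in> V" shows "pairing_map y \<in> V"
proof -
  have inv: "inv\<^bsub>A\<^esub> y \<in> V" "mul (inv\<^bsub>A\<^esub> y) y = e\<^sub>0"
    using A.inv_closed[of y] A.l_inv[of y] y by auto
  have "dot R n (inv\<^bsub>A\<^esub> y) (pairing_map y) = \<one>"
    using dot_pairing_map[OF VM[OF inv(1)] VM[OF y]] inv(2) e0_zero by simp
  then show ?thesis
    using unimodular_of_dot_Unit[OF unimodular_Pi[OF inv(1)] pairing_map_closed[OF VM[OF y]]] by simp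
qed

text \<open>Nondegeneracy: if the difference of two preimages is \<pi>^k u with u unimodular,
  multiplying by the inverse of u leaves the constant coefficient \<pi>^k, which is nonzero because
  k < l.\<close>

lemma inj_on_pairing_map: "inj_on pairing_map V"
proof (rule inj_onI)
  fix y y' assume y: "y \<in> V" "y' \<in> V" and eq: "pairing_map y = pairing_map y'"
  obtain z where z: "z \<in> M" "z = (\<lambda>j\<in>{..<n}. \<zero>) \<Longrightarrow> y = y'"
      "\<And>a. a \<in> M \<Longrightarrow> mul a z = (\<lambda>j\<in>{..<n}. mul a y j \<oplus> \<ominus> \<one> \<otimes> mul a y' j)"
    by (rule diff_vec[OF VM[OF y(1)] VM[OF y(2)]]) blast
  have zero: "mul a z 0 = \<zero>" if a: "a \<in> M" for a
  proof -
    have "mul a y 0 = mul a y' 0"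
      using dot_pairing_map[OF a VM[OF y(1)]] dot_pairing_map[OF a VM[OF y(2)]] eq by simp
    moreover have "mul a y' 0 \<in> carrier R" using mul_closed[OF a VM[OF y(2)]] n by auto
    ultimately show ?thesis unfolding z(3)[OF a] using n by (simp add: l_minus r_neg)
  qed
  show "y = y'"
  proof (rule ccontr)
    assume "y \<noteq> y'"
    then have "z \<noteq> (\<lambda>j\<in>{..<n}. \<zero>)" using z(2) by blast
    then obtain k u where u: "k < l" "u \<in> V" "z = (\<lambda>i\<in>{..<n}. \<pi> [^] k \<otimes> u i)"
      using vec_pi_pow_decomp[OF z(1)] by blast
    have inv: "inv\<^bsub>A\<^esub> u \<in> V" "mul (inv\<^bsub>A\<^esub> u) u = e\<^sub>0"
      using A.inv_closed[of u] A.l_inv[of u] u by auto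
    have "mul (inv\<^bsub>A\<^esub> u) z = (\<lambda>j\<in>{..<n}. \<pi> [^] k \<otimes> mul (inv\<^bsub>A\<^esub> u) u j)"
      unfolding u(3) by (rule mul_scale_right[OF VM[OF inv(1)] VM[OF u(2)]]) simp
    then have "mul (inv\<^bsub>A\<^esub> u) z 0 = \<pi> [^] k" using n inv(2) e0_zero by simp
    then have "\<pi> [^] k = \<zero>" using zero[OF VM[OF inv(1)]] by simp
    then show False using pi_pow_eq_zero_iff u(1) by simp
  qed
qed

lemma bij_pairing_map: "bij_betw pairing_map V V"
  unfolding bij_betw_def using inj_on_pairing_map pairing_map_unimodular
  by (intro conjI endo_inj_surj[OF finite_unimodular]) auto

definition dual :: "(nat \<Rightarrow> 'a) \<Rightarrow> nat \<Rightarrow> 'a" where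
  "dual = inv_into V pairing_map"

lemma bij_dual: "bij_betw dual V V"
  unfolding dual_def by (rule bij_betw_inv_into[OF bij_pairing_map])

lemma dual_closed: "b \<in> V \<Longrightarrow> dual b \<in> V"
  using bij_dual bij_betwE by blast

lemma dot_eq_mul_dual:
  assumes "a \<in> V" "b \<in> V" shows "dot R n a b = mul a (dual b) 0"
proof -
  have "pairing_map (dual b) = b"
    unfolding dual_def by (rule bij_betw_inv_into_right[OF bij_pairing_map assms(2)])
  then show ?thesis using dot_pairing_map[OF VM[OF assms(1)] VM[OF dual_closed[OF assms(2)]]] by simp
qed

lemma is_cayley_graph_Um: "is_cayley_graph (Um R n)"
proof -
  have "is_cayley_graph (bipartite_graph (carrier A)
      {(a, b). a \<in> V \<and> b \<in> V \<and> dot R n a b = \<one>})"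
  proof (rule A.is_cayley_graph_bipartite)
    show "bij_betw dual (carrier A) (carrier A)" using bij_dual by simp
    show "{(a, b). a \<in> V \<and> b \<in> V \<and> dot R n a b = \<one>}
        = {(a, b). a \<in> carrier A \<and> b \<in> carrier A \<and> a \<otimes>\<^bsub>A\<^esub> dual b \<in> {t. t 0 = \<one>}}"
      using dot_eq_mul_dual by auto
  qed
  then show ?thesis unfolding Um_def by simp
qed

section \<open>Passage to the quotient by scalars\<close>

abbreviation "scale u a \<equiv> (\<lambda>i\<in>{..<n}. u \<otimes> a i)"
abbreviation "U \<equiv> unit_multiples R n"

lemma mul_scale_left:
  assumes "a \<in> M" "b \<in> M" "u \<in> carrier R"
  shows "mul (scale u a) b = scale u (mul a b)"
proof -
  have "scale u a \<in> M" using assms by (auto simp: restrict_PiE_iff PiE_iff)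
  then have "mul (scale u a) b = mul b (scale u a)" using mul_comm assms by blast
  also have "\<dots> = scale u (mul b a)" by (rule mul_scale_right[OF assms(2,1,3)])
  also have "mul b a = mul a b" by (rule mul_comm[OF assms(2,1)])
  finally show ?thesis .
qed

text \<open>The class of \<open>e\<^sub>0\<close> is the copy of the unit group of \<open>R\<close>
  among the unimodular tuples, and multiplying by a scalar tuple is scaling.\<close>

lemma r_coset_scalars:
  assumes a: "a \<in> V"
  shows "(U `` {e\<^sub>0}) #>\<^bsub>A\<^esub> a = U `` {a}"
proof -
  have "(U `` {e\<^sub>0}) #>\<^bsub>A\<^esub> a = (\<lambda>u. mul (scale u e\<^sub>0) a) ` Units R"
    unfolding unit_multiples_class[OF e0_unimodular] r_coset_def by auto
  also have "\<dots> = (\<lambda>u. scale u a) ` Units R"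
    by (rule image_cong[OF refl])
      (simp only: mul_scale_left[OF unit_vec_closed VM[OF a] Units_closed] e0_mul[OF VM[OF a]])
  finally show ?thesis unfolding unit_multiples_class[OF a] .
qed

lemma subgroup_scalars: "subgroup (U `` {e\<^sub>0}) A"
proof (rule A.subgroupI)
  have cl: "U `` {e\<^sub>0} = (\<lambda>u. scale u e\<^sub>0) ` Units R" by (rule unit_multiples_class[OF e0_unimodular])
  have prod: "mul (scale u e\<^sub>0) (scale v e\<^sub>0) = scale (u \<otimes> v) e\<^sub>0"
    if "u \<in> Units R" "v \<in> Units R" for u v
  proof -
    have vM: "scale v e\<^sub>0 \<in> M" using unit_scale_unimodular[OF e0_unimodular that(2)] VM by blast
    have "mul (scale u e\<^sub>0) (scale v e\<^sub>0) = scale u (scale v e\<^sub>0)"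
      unfolding mul_scale_left[OF unit_vec_closed vM Units_closed[OF that(1)]] e0_mul[OF vM] ..
    also have "\<dots> = scale (u \<otimes> v) e\<^sub>0"
      by (rule unit_scale_scale) (use that unit_vec_closed in auto)
    finally show ?thesis .
  qed
  show "U `` {e\<^sub>0} \<subseteq> carrier A" unfolding cl using unit_scale_unimodular[OF e0_unimodular] by auto
  show "U `` {e\<^sub>0} \<noteq> {}" unfolding cl using Units_one_closed by blast
  fix x assume "x \<in> U `` {e\<^sub>0}"
  then obtain u where u: "u \<in> Units R" "x = scale u e\<^sub>0" unfolding cl by blast
  have "mul (scale (inv u) e\<^sub>0) x = e\<^sub>0"
    unfolding u(2) using prod[of "inv u" u] u(1) unit_scale_one[OF unit_vec_closed] by simp
  then have "inv\<^bsub>A\<^esub> x = scale (inv u) e\<^sub>0"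
    using unit_scale_unimodular[OF e0_unimodular] u by (intro A.inv_equality) auto
  then show "inv\<^bsub>A\<^esub> x \<in> U `` {e\<^sub>0}" unfolding cl using u(1) by auto
  fix y assume "y \<in> U `` {e\<^sub>0}"
  then obtain v where v: "v \<in> Units R" "y = scale v e\<^sub>0" unfolding cl by blast
  show "x \<otimes>\<^bsub>A\<^esub> y \<in> U `` {e\<^sub>0}" unfolding cl u(2) v(2) A_simps prod[OF u(1) v(1)] using u(1) v(1) by auto
qed

lemma normal_scalars: "U `` {e\<^sub>0} \<lhd> A"
  using A.subgroup_imp_normal[OF subgroup_scalars] .

text \<open>The quotient group lives on the vertex classes of \<open>Um0\<close> themselves, the
  form that \<open>is_cayley_graph_bipartite\<close> expects.\<close>

lemma carrier_A_Mod: "carrier (A Mod (U `` {e\<^sub>0})) = V // U"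
proof -
  have "carrier (A Mod (U `` {e\<^sub>0})) = (\<Union>a\<in>V. {(U `` {e\<^sub>0}) #>\<^bsub>A\<^esub> a})"
    unfolding FactGroup_def RCOSETS_def by simp
  also have "\<dots> = (\<Union>a\<in>V. {U `` {a}})" using r_coset_scalars by simp
  finally show ?thesis unfolding quotient_def .
qed

lemma mult_A_Mod:
  assumes "a \<in> V" "b \<in> V"
  shows "U `` {a} \<otimes>\<^bsub>A Mod (U `` {e\<^sub>0})\<^esub> U `` {b} = U `` {mul a b}"
  using normal.rcos_sum[OF normal_scalars, of a b] assms mul_unimodular[OF assms]
  by (simp add: FactGroup_def r_coset_scalars)

lemma pairing_map_scale:
  assumes "y \<in> M" "u \<in> carrier R"
  shows "pairing_map (scale u y) = scale u (pairing_map y)"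
proof -
  let ?z = "\<lambda>j\<in>{..<n}. \<zero>"
  have z: "?z \<in> M" by auto
  have yR: "y j \<in> carrier R" if "j < n" for j using assms that by auto
  have eq: "scale u y = (\<lambda>j\<in>{..<n}. ?z j \<oplus> u \<otimes> y j)"
    by (rule restrict_ext) (use yR assms in auto)
  have "(C ^^ i) (scale u y) 0 = u \<otimes> (C ^^ i) y 0" for i
  proof -
    have "(C ^^ i) (scale u y) = (\<lambda>j\<in>{..<n}. (C ^^ i) ?z j \<oplus> u \<otimes> (C ^^ i) y j)"
      unfolding eq by (rule linear_endoD[OF linear_C_pow assms(2) z assms(1)])
    moreover have "(C ^^ i) y 0 \<in> carrier R" using C_pow_closed[OF assms(1), of i] n by auto
    ultimately show ?thesis
      using n assms(2) linear_endo_zero[OF linear_C_pow, of i] by simp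
  qed
  then show ?thesis unfolding pairing_map_def by (auto intro!: restrict_ext)
qed

lemma image_pairing_map_class:
  assumes y: "y \<in> V" shows "pairing_map ` (U `` {y}) = U `` {pairing_map y}"
  unfolding unit_multiples_class[OF y] unit_multiples_class[OF pairing_map_unimodular[OF y]] image_image
  by (rule image_cong[OF refl]) (rule pairing_map_scale[OF VM[OF y] Units_closed])

text \<open>\<open>pairing_map\<close> commutes with scaling, so it permutes the classes; inverting
  it gives the same for \<open>dual\<close>, which therefore acts on classes by taking
  images.\<close>

lemma image_dual_class:
  assumes b: "b \<in> V" shows "dual ` (U `` {b}) = U `` {dual b}"
proof -
  have "pairing_map ` (U `` {dual b}) = U `` {b}"
    using image_pairing_map_class[OF dual_closed[OF b]]
      bij_betw_inv_into_right[OF bij_pairing_map b] unfolding dual_def by simp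
  then have "dual ` (U `` {b}) = dual ` pairing_map ` (U `` {dual b})" by simp
  also have "\<dots> = (\<lambda>x. x) ` (U `` {dual b})"
    unfolding image_image
  proof (rule image_cong[OF refl])
    fix x assume "x \<in> U `` {dual b}"
    then have "x \<in> V" unfolding unit_multiples_def by auto
    then show "dual (pairing_map x) = x"
      unfolding dual_def by (rule inv_into_f_f[OF inj_on_pairing_map])
  qed
  finally show ?thesis by simp
qed

lemma bij_image_dual: "bij_betw (image dual) (V // U) (V // U)"
proof -
  have sub: "B \<subseteq> V" if "B \<in> V // U" for B
    using that unfolding quotient_def unit_multiples_def by auto
  have "inj_on (image dual) (V // U)"
    by (rule inj_onI) (metis sub bij_dual bij_betw_imp_inj_on inj_on_image_eq_iff)
  moreover have "image dual ` (V // U) \<subseteq> V // U"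
  proof (rule image_subsetI)
    fix B assume "B \<in> V // U"
    then obtain b where "b \<in> V" "B = U `` {b}" by (rule quotientE)
    then show "dual ` B \<in> V // U" using image_dual_class dual_closed quotientI by metis
  qed
  moreover have "finite (V // U)"
    unfolding quotient_def using finite_unimodular by simp
  ultimately show ?thesis unfolding bij_betw_def by (intro conjI endo_inj_surj)
qed

text \<open>Scaling by a unit does not affect vanishing of the constant coefficient, so the
  connection set of classes can be described through any representative.\<close>

lemma class_zero_iff:
  assumes a: "a \<in> V" shows "(\<exists>t\<in>U `` {a}. t 0 = \<zero>) \<longleftrightarrow> a 0 = \<zero>"
proof -
  have a0: "a 0 \<in> carrier R" using unimodular_Pi[OF a] n by auto
  have "scale u a 0 = \<zero> \<longleftrightarrow> a 0 = \<zero>" if "u \<in> Units R" for u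
    using Units_l_cancel[OF that a0 zero_closed] that n by (simp add: Units_closed)
  then show ?thesis unfolding unit_multiples_class[OF a] using Units_one_closed by blast
qed

lemma is_cayley_graph_Um0: "is_cayley_graph (Um0 R n)"
proof -
  let ?Q = "A Mod (U `` {e\<^sub>0})"
  interpret Q: comm_group ?Q by (rule A.abelian_FactGroup[OF subgroup_scalars])
  have "is_cayley_graph (bipartite_graph (carrier ?Q) (Um0_edges n))"
  proof (rule Q.is_cayley_graph_bipartite)
    show "bij_betw (image dual) (carrier ?Q) (carrier ?Q)"
      unfolding carrier_A_Mod by (rule bij_image_dual)
    have "(B, D) \<in> Um0_edges n \<longleftrightarrow> B \<otimes>\<^bsub>?Q\<^esub> dual ` D \<in> {B. \<exists>t\<in>B. t 0 = \<zero>}"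
      if BD: "B \<in> V // U" "D \<in> V // U" for B D
    proof -
      obtain a b where a: "a \<in> V" "B = U `` {a}" and b: "b \<in> V" "D = U `` {b}"
        using BD by (auto elim!: quotientE)
      have ab: "mul a (dual b) \<in> V" using mul_unimodular[OF a(1) dual_closed[OF b(1)]] .
      show ?thesis
        unfolding a(2) b(2) image_dual_class[OF b(1)] mult_A_Mod[OF a(1) dual_closed[OF b(1)]]
          Um0_edges_iff[OF a(1) b(1)] mem_Collect_eq class_zero_iff[OF ab]
          dot_eq_mul_dual[OF a(1) b(1)] ..
    qed
    then show "Um0_edges n = {(B, D). B \<in> carrier ?Q \<and> D \<in> carrier ?Q \<and>
        B \<otimes>\<^bsub>?Q\<^esub> dual ` D \<in> {B. \<exists>t\<in>B. t 0 = \<zero>}}"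
      unfolding carrier_A_Mod using Um0_edges_subset by blast
  qed
  then show ?thesis unfolding Um0_eq carrier_A_Mod .
qed

end

lemma (in uniformized_valuation_ring) is_cayley_graph_Um_Um0:
  assumes "0 < n"
  shows "is_cayley_graph (Um R n)" "is_cayley_graph (Um0 R n)"
proof -
  obtain c where c: "c \<in> {..<n} \<rightarrow> carrier R"
      "\<And>a b. a \<in> unimodular R n \<Longrightarrow> b \<in> unimodular R n \<Longrightarrow> vmult R n c a b \<in> unimodular R n"
    using exists_companion_unimodular_closed[OF assms] by blast
  interpret unimodular_companion R \<pi> q l n c
    by unfold_locales (use c assms in auto)
  show "is_cayley_graph (Um R n)" "is_cayley_graph (Um0 R n)"
    by (rule is_cayley_graph_Um, rule is_cayley_graph_Um0)
qed

section \<open>Common neighbours\<close>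

context cring
begin

definition single :: "nat \<Rightarrow> nat \<Rightarrow> 'a \<Rightarrow> nat \<Rightarrow> 'a" where
  "single n i x = (\<lambda>j\<in>{..<n}. if j = i then x else \<zero>)"

definition vadd :: "nat \<Rightarrow> (nat \<Rightarrow> 'a) \<Rightarrow> (nat \<Rightarrow> 'a) \<Rightarrow> nat \<Rightarrow> 'a" where
  "vadd n v w = (\<lambda>j\<in>{..<n}. v j \<oplus> w j)"

lemma single_closed: "x \<in> carrier R \<Longrightarrow> single n i x \<in> {..<n} \<rightarrow>\<^sub>E carrier R"
  unfolding single_def by auto

lemma vadd_closed:
  "v \<in> {..<n} \<rightarrow>\<^sub>E carrier R \<Longrightarrow> w \<in> {..<n} \<rightarrow>\<^sub>E carrier R \<Longrightarrow> vadd n v w \<in> {..<n} \<rightarrow>\<^sub>E carrier R"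
  unfolding vadd_def by (auto simp: restrict_PiE_iff PiE_iff)

lemma dot_single:
  assumes "a \<in> {..<n} \<rightarrow> carrier R" "i < n" "x \<in> carrier R"
  shows "dot R n a (single n i x) = a i \<otimes> x"
proof -
  have aR: "a j \<in> carrier R" if "j < n" for j using assms that by auto
  have "dot R n a (single n i x) = (\<Oplus>j\<in>{..<n}. if i = j then a j \<otimes> x else \<zero>)"
    unfolding dot_def by (rule finsum_cong') (use aR assms in \<open>auto simp: single_def\<close>)
  also have "\<dots> = a i \<otimes> x" by (rule finsum_singleton) (use aR assms in auto)
  finally show ?thesis .
qed

lemma dot_vadd:
  assumes "a \<in> {..<n} \<rightarrow> carrier R" "v \<in> {..<n} \<rightarrow>\<^sub>E carrier R" "w \<in> {..<n} \<rightarrow>\<^sub>E carrier R"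
  shows "dot R n a (vadd n v w) = dot R n a v \<oplus> dot R n a w"
proof -
  have cl: "a j \<in> carrier R" "v j \<in> carrier R" "w j \<in> carrier R" if "j < n" for j
    using assms that by auto
  have "dot R n a (vadd n v w) = (\<Oplus>j\<in>{..<n}. a j \<otimes> v j \<oplus> a j \<otimes> w j)"
    unfolding dot_def by (rule finsum_cong') (use cl in \<open>auto simp: vadd_def r_distr\<close>)
  also have "\<dots> = dot R n a v \<oplus> dot R n a w"
    unfolding dot_def by (rule finsum_addf) (use cl in auto)
  finally show ?thesis .
qed

end

context uniformized_valuation_ring
begin

lemma Units_minus_mm:
  assumes "x \<in> Units R" "y \<in> \<mm>"
  shows "x \<ominus> y \<in> Units R"
proof -
  have yR: "y \<in> carrier R" and xR: "x \<in> carrier R" using assms mm.Icarr by auto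
  have "x \<ominus> y \<notin> \<mm>"
  proof
    assume "x \<ominus> y \<in> \<mm>"
    then have "(x \<ominus> y) \<oplus> y \<in> \<mm>" using assms(2) by (intro mm.a_closed)
    moreover have "(x \<ominus> y) \<oplus> y = x" using xR yR by algebra
    ultimately show False using assms(1) Units_iff by simp
  qed
  then show ?thesis using Units_iff xR yR by simp
qed

text \<open>Cramer's rule for two equations in the unknowns x_i and x_j, all other coordinates being
  zero; the assumed unit is the determinant.\<close>

lemma common_dot_eq_one:
  assumes a: "a \<in> unimodular R n" and d: "d \<in> unimodular R n"
    and ij: "i < n" "j < n" "a i \<otimes> d j \<ominus> a j \<otimes> d i \<in> Units R"
  obtains x where "x \<in> unimodular R n" "dot R n a x = \<one>" "dot R n d x = \<one>"
proof -
  define D where "D = a i \<otimes> d j \<ominus> a j \<otimes> d i"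
  have D: "D \<in> Units R" "inv D \<in> carrier R" "D \<in> carrier R" using ij(3) unfolding D_def by auto
  have aP: "a \<in> {..<n} \<rightarrow> carrier R" and dP: "d \<in> {..<n} \<rightarrow> carrier R"
    using a d unimodular_Pi by auto
  have cl: "a i \<in> carrier R" "a j \<in> carrier R" "d i \<in> carrier R" "d j \<in> carrier R"
    using aP dP ij by auto
  define x where "x = vadd n (single n i (inv D \<otimes> (d j \<ominus> a j))) (single n j (inv D \<otimes> (a i \<ominus> d i)))"
  have xM: "x \<in> {..<n} \<rightarrow>\<^sub>E carrier R"
    unfolding x_def using D cl by (intro vadd_closed single_closed) auto
  have dot: "dot R n e x = e i \<otimes> (inv D \<otimes> (d j \<ominus> a j)) \<oplus> e j \<otimes> (inv D \<otimes> (a i \<ominus> d i))"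
    if "e \<in> {..<n} \<rightarrow> carrier R" for e
    unfolding x_def using that D cl ij by (simp add: dot_vadd dot_single single_closed)
  have inv: "inv D \<otimes> D = \<one>" using D by simp
  have w: "a i \<otimes> (w \<otimes> (d j \<ominus> a j)) \<oplus> a j \<otimes> (w \<otimes> (a i \<ominus> d i)) = w \<otimes> D"
    "d i \<otimes> (w \<otimes> (d j \<ominus> a j)) \<oplus> d j \<otimes> (w \<otimes> (a i \<ominus> d i)) = w \<otimes> D"
    if "w \<in> carrier R" for w
    unfolding D_def using that cl by algebra+
  have "dot R n a x = inv D \<otimes> D" "dot R n d x = inv D \<otimes> D"
    unfolding dot[OF aP] dot[OF dP] by (rule w[OF D(2)])+
  then have *: "dot R n a x = \<one>" "dot R n d x = \<one>" using inv by auto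
  moreover have "x \<in> unimodular R n" using unimodular_of_dot_Unit[OF aP xM] * by simp
  ultimately show thesis using that by blast
qed

text \<open>It suffices to find a neighbour d of \<open>b\<close> such that some 2 by 2 minor of
  \<open>a\<close> and d is a unit, since the common neighbour x of \<open>a\<close> and d then
  comes from Cramer's rule.\<close>

lemma Um_path3:
  assumes n: "2 \<le> n" and a: "a \<in> unimodular R n" and b: "b \<in> unimodular R n"
  obtains x d where "x \<in> unimodular R n" "d \<in> unimodular R n"
    "dot R n a x = \<one>" "dot R n d x = \<one>" "dot R n d b = \<one>"
proof -
  have aP: "a \<in> {..<n} \<rightarrow> carrier R" and bP: "b \<in> {..<n} \<rightarrow> carrier R"
    using a b unimodular_Pi by auto
  note goal = that
  have aR: "a i \<in> carrier R" "b i \<in> carrier R" if "i < n" for i using aP bP that by auto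
  obtain k where k: "k < n" "b k \<in> Units R" using b unimodular_iff by auto
  have fin: thesis
    if dM: "d \<in> {..<n} \<rightarrow>\<^sub>E carrier R" and db: "dot R n b d = \<one>"
      and ij: "i < n" "j < n" "a i \<otimes> d j \<ominus> a j \<otimes> d i \<in> Units R" for d i j
  proof -
    have d: "d \<in> unimodular R n" using unimodular_of_dot_Unit[OF bP dM] db by simp
    obtain x where "x \<in> unimodular R n" "dot R n a x = \<one>" "dot R n d x = \<one>"
      using common_dot_eq_one[OF a d ij] .
    moreover have "dot R n d b = \<one>" using db dot_comm[OF bP unimodular_Pi[OF d]] by simp
    ultimately show thesis using goal d by blast
  qed
  show thesis
  proof (cases "\<exists>i<n. i \<noteq> k \<and> a i \<in> Units R")
    case True
    then obtain i where i: "i < n" "i \<noteq> k" "a i \<in> Units R" by auto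
    \<comment> \<open>With a unit of \<open>a\<close> at i different from k, a multiple of one basis
      vector is enough: the minor at i and k is a_i / b_k.\<close>
    let ?d = "single n k (inv (b k))"
    have "a i \<otimes> ?d k \<ominus> a k \<otimes> ?d i = a i \<otimes> inv (b k)"
      using i k aR by (simp add: single_def a_minus_def)
    then have u: "a i \<otimes> ?d k \<ominus> a k \<otimes> ?d i \<in> Units R" using i k by simp
    have "dot R n b ?d = \<one>" using dot_single[OF bP k(1)] k by simp
    then show ?thesis using fin[OF single_closed _ i(1) k(1) u] k by simp
  next
    case False
    then have ak: "a k \<in> Units R" using a unimodular_iff by auto
    obtain j where j: "j < n" "j \<noteq> k" using n by (metis One_nat_def less_2_cases_iff less_le_trans nat_neq_iff numeral_2_eq_2 lessI zero_less_Suc)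
    have aj: "a j \<in> \<mm>" using False j aR Units_iff by blast
    \<comment> \<open>Now \<open>a k\<close> is the only unit entry of \<open>a\<close>. The tuple d
      has entry 1 at j and s at k, with s making its dot product with \<open>b\<close> equal to 1;
      the minor a_k - a_j s is a unit minus an element of \<open>\<mm>\<close>.\<close>
    define s where "s = inv (b k) \<otimes> (\<one> \<ominus> b j)"
    have s: "s \<in> carrier R" unfolding s_def using k aR j by simp
    let ?d = "vadd n (single n j \<one>) (single n k s)"
    have dM: "?d \<in> {..<n} \<rightarrow>\<^sub>E carrier R" using s by (intro vadd_closed single_closed) auto
    have "dot R n b ?d = b j \<oplus> b k \<otimes> s"
      using j k s aR by (simp add: dot_vadd[OF bP] dot_single[OF bP] single_closed)
    also have "b k \<otimes> s = \<one> \<ominus> b j"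
      unfolding s_def using k aR j by (simp add: m_assoc[symmetric])
    also have "b j \<oplus> (\<one> \<ominus> b j) = \<one>" using aR(2)[OF j(1)] by algebra
    finally have db: "dot R n b ?d = \<one>" .
    have "?d j = \<one>" "?d k = s" using j k s by (auto simp: vadd_def single_def)
    moreover have "a k \<otimes> \<one> \<ominus> a j \<otimes> s \<in> Units R"
      using ak mm.I_r_closed[OF aj s] by (intro Units_minus_mm) (auto simp: Units_closed)
    ultimately show ?thesis using fin[OF dM db k(1) j(1)] by simp
  qed
qed

text \<open>Choose i with a_i a unit and two further coordinates j and k. Eliminating x_i by the
  first equation turns the second, multiplied by a_i, into P x_j + Q x_k = 0, where P = b_j a_i -
  b_i a_j and Q = b_k a_i - b_i a_k. Divisibility is total, so after exchanging j and k if necessary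
  P = r Q; then x_j = 1 and x_k = -r solve it, and the entry 1 makes x unimodular.\<close>

lemma common_dot_eq_zero:
  assumes n: "3 \<le> n" and a: "a \<in> unimodular R n" and b: "b \<in> unimodular R n"
  obtains x where "x \<in> unimodular R n" "dot R n a x = \<zero>" "dot R n b x = \<zero>"
proof -
  have aP: "a \<in> {..<n} \<rightarrow> carrier R" and bP: "b \<in> {..<n} \<rightarrow> carrier R"
    using a b unimodular_Pi by auto
  note goal = that
  have cl: "a i \<in> carrier R" "b i \<in> carrier R" if "i < n" for i using aP bP that by auto
  obtain i where i: "i < n" "a i \<in> Units R" using a unimodular_iff by auto
  have main: thesis
    if j: "j < n" "j \<noteq> i" and k: "k < n" "k \<noteq> i" "k \<noteq> j" and r: "r \<in> carrier R"
      and div: "b j \<otimes> a i \<ominus> b i \<otimes> a j = r \<otimes> (b k \<otimes> a i \<ominus> b i \<otimes> a k)" for j k r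
  proof -
    define y where "y = inv (a i) \<otimes> (a k \<otimes> r \<ominus> a j)"
    have yR: "y \<in> carrier R" unfolding y_def using i cl j k r by simp
    have ay: "a i \<otimes> y = a k \<otimes> r \<ominus> a j"
      unfolding y_def using i cl j k r by (simp add: m_assoc[symmetric])
    define x where "x = vadd n (single n j \<one>) (vadd n (single n k (\<ominus> r)) (single n i y))"
    have xM: "x \<in> {..<n} \<rightarrow>\<^sub>E carrier R"
      unfolding x_def using r yR by (intro vadd_closed single_closed) auto
    have "x j = \<one>" unfolding x_def using j k by (simp add: vadd_def single_def)
    then have "x j \<in> Units R" by simp
    then have x: "x \<in> unimodular R n" using xM j unimodular_iff by blast
    have dot: "dot R n e x = e j \<otimes> \<one> \<oplus> (e k \<otimes> \<ominus> r \<oplus> e i \<otimes> y)"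
      if "e \<in> {..<n} \<rightarrow> carrier R" for e
      unfolding x_def using that r yR i j k
      by (simp only: dot_vadd dot_single single_closed vadd_closed one_closed a_inv_closed)
    have cls: "a i \<in> carrier R" "a j \<in> carrier R" "a k \<in> carrier R"
      "b i \<in> carrier R" "b j \<in> carrier R" "b k \<in> carrier R" using cl i j k by auto
    have "dot R n a x = \<zero>"
      unfolding dot[OF aP] ay using cls r by algebra
    moreover have "a i \<otimes> dot R n b x = \<zero>"
    proof -
      have "a i \<otimes> dot R n b x
          = b j \<otimes> a i \<oplus> (\<ominus> (r \<otimes> (b k \<otimes> a i))) \<oplus> b i \<otimes> (a i \<otimes> y)"
        unfolding dot[OF bP] using cls r yR by algebra
      also have "\<dots> = (b j \<otimes> a i \<ominus> b i \<otimes> a j) \<ominus> r \<otimes> (b k \<otimes> a i \<ominus> b i \<otimes> a k)"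
        unfolding ay using cls r by algebra
      also have "\<dots> = \<zero>" unfolding div using cls r by simp
      finally show ?thesis .
    qed
    then have "dot R n b x = \<zero>"
      using Units_l_cancel[OF i(2) dot_closed[OF bP] zero_closed, of x] xM cls(1) by auto
    ultimately show thesis using goal x by blast
  qed
  \<comment> \<open>j and k are the two smallest indices different from i, available because n is at
    least 3.\<close>
  define j :: nat where "j = (if i = 0 then 1 else 0)"
  define k :: nat where "k = (if i \<le> 1 then 2 else 1)"
  have j: "j < n" "j \<noteq> i" and k: "k < n" "k \<noteq> i" "k \<noteq> j"
    unfolding j_def k_def using n by auto
  have "b j \<otimes> a i \<ominus> b i \<otimes> a j \<in> carrier R" "b k \<otimes> a i \<ominus> b i \<otimes> a k \<in> carrier R"
    using cl i j k by auto
  then show thesis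
  proof (cases rule: divides_total)
    case (1 r)
    then show ?thesis using main[OF j k] by blast
  next
    case (2 r)
    then show ?thesis using main[OF k(1,2) j] k(3) by metis
  qed
qed

end

section \<open>Half-size, degree and diameter\<close>

text \<open>The common arithmetic behind two counts of classes: m = n gives the half-size of
  \<open>Um0\<close>, m = n - 1 its degree. The factor in front of d is the size of a class, and N =
  q^(m (l - 1)) (q^m - 1).\<close>

lemma card_eq_of_scaled_card:
  fixes q l m d N :: nat
  assumes q: "1 < q" and m: "1 \<le> m"
    and N: "N = q ^ (m * l) - q ^ (m * (l - 1))" and d: "q ^ (l - 1) * (q - 1) * d = N" and l: "0 < l"
  shows "real d = real q ^ ((m - 1) * (l - 1)) * (real q ^ m - 1) / (real q - 1)"
proof -
  obtain l' where l': "l = Suc l'" using l by (cases l) auto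
  obtain m' where m': "m = Suc m'" using m by (cases m) auto
  have "q ^ (m * l') \<le> q ^ (m * l)" using q l' by (intro power_increasing) auto
  then have "real N = real q ^ (m * l) - real q ^ (m * l')" unfolding N l' by (simp add: of_nat_diff)
  moreover have "real (q ^ (l - 1) * (q - 1) * d) = real q ^ l' * (real q - 1) * real d"
    using q l' by (simp add: of_nat_diff)
  ultimately have "real q ^ l' * (real q - 1) * real d = real q ^ (m * l) - real q ^ (m * l')"
    unfolding d by linarith
  also have "\<dots> = real q ^ l' * (real q ^ (m' * l') * (real q ^ m - 1))"
    unfolding l' m' by (simp add: algebra_simps power_add)
  finally have "(real q - 1) * real d = real q ^ (m' * l') * (real q ^ m - 1)"
    using q by simp
  then show ?thesis using q l' m' by (simp add: field_simps)
qed

context uniformized_valuation_ring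
begin

lemma half_size_Um: "real (half_size (Um R n)) = real q ^ (n * l) - real q ^ (n * (l - 1))"
proof -
  have "q ^ (n * (l - 1)) \<le> q ^ (n * l)" using q_gt_1 by (intro power_increasing) auto
  then show ?thesis
    unfolding Um_def half_size_bipartite_graph card_unimodular by (simp add: of_nat_diff)
qed

lemma regular_Um: "regular_of_degree (Um R n) (q ^ ((n - 1) * l))"
  unfolding regular_of_degree_def
proof
  let ?V = "unimodular R n"
  let ?E = "{(a, b). a \<in> ?V \<and> b \<in> ?V \<and> dot R n a b = \<one>}"
  fix v assume "v \<in> pverts (Um R n)"
  then consider a where "a \<in> ?V" "v = Inl a" | b where "b \<in> ?V" "v = Inr b"
    unfolding Um_def bipartite_graph_def by auto
  then show "out_degree (with_proj (Um R n)) v = q ^ ((n - 1) * l)"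
  proof cases
    case 1
    then have "{b. (a, b) \<in> ?E} = {b \<in> ?V. dot R n a b = \<one>}" by auto
    then show ?thesis
      unfolding Um_def 1(2) out_degree_bipartite_graph using card_dot_eq_one[OF 1(1)] by simp
  next
    case 2
    then have "{a. (a, b) \<in> ?E} = {a \<in> ?V. dot R n b a = \<one>}"
      using dot_comm[OF unimodular_Pi unimodular_Pi] by auto
    then show ?thesis
      unfolding Um_def 2(2) out_degree_bipartite_graph using card_dot_eq_one[OF 2(1)] by simp
  qed
qed

text \<open>A set closed under unit multiples is a disjoint union of classes, all of the same
  size.\<close>

lemma card_classes:
  assumes N: "N \<subseteq> unimodular R n"
    and sat: "\<And>a b. a \<in> N \<Longrightarrow> (a, b) \<in> unit_multiples R n \<Longrightarrow> b \<in> N"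
  shows "q ^ (l - 1) * (q - 1) * card ((\<lambda>a. unit_multiples R n `` {a}) ` N) = card N"
proof -
  let ?U = "unit_multiples R n"
  let ?C = "(\<lambda>a. ?U `` {a}) ` N"
  note eq = equiv_unit_multiples[of n]
  have self: "a \<in> ?U `` {a}" if "a \<in> N" for a
    using equiv_class_self[OF eq] that N by blast
  have un: "\<Union> ?C = N"
  proof (intro equalityI subsetI)
    fix x assume "x \<in> \<Union> ?C"
    then obtain a where "a \<in> N" "(a, x) \<in> ?U" by blast
    then show "x \<in> N" by (rule sat)
  qed (use self in blast)
  have finN: "finite N" using N finite_unimodular finite_subset by blast
  have "q ^ (l - 1) * (q - 1) * card ?C = card (\<Union> ?C)"
  proof (rule card_partition)
    show "finite ?C" using finN by simp
    show "finite (\<Union> ?C)" unfolding un by (rule finN)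
    show "card c = q ^ (l - 1) * (q - 1)" if "c \<in> ?C" for c
      using that card_unit_multiples_class N by auto
    show "c \<inter> c' = {}" if "c \<in> ?C" "c' \<in> ?C" "c \<noteq> c'" for c c'
    proof -
      have "c \<in> unimodular R n // ?U" "c' \<in> unimodular R n // ?U"
        using that N by (auto intro!: quotientI)
      then show ?thesis using quotient_disj[OF eq] that(3) by blast
    qed
  qed
  then show ?thesis unfolding un .
qed

lemma half_size_Um0:
  assumes "1 \<le> n"
  shows "real (half_size (Um0 R n)) =
    real q ^ ((n - 1) * (l - 1)) * (real q ^ n - 1) / (real q - 1)"
proof (rule card_eq_of_scaled_card[OF q_gt_1 assms card_unimodular _ l_pos])
  let ?V = "unimodular R n" and ?U = "unit_multiples R n"
  have "?V // ?U = (\<lambda>a. ?U `` {a}) ` ?V" unfolding quotient_def by auto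
  moreover have "q ^ (l - 1) * (q - 1) * card ((\<lambda>a. ?U `` {a}) ` ?V) = card ?V"
    by (rule card_classes) (auto simp: unit_multiples_def)
  ultimately show "q ^ (l - 1) * (q - 1) * half_size (Um0 R n) = card ?V"
    unfolding Um0_eq half_size_bipartite_graph by simp
qed

lemma card_Um0_neighbours:
  assumes n: "2 \<le> n" and a: "a \<in> unimodular R n"
  shows "real (card {B. (unit_multiples R n `` {a}, B) \<in> Um0_edges n}) =
    real q ^ ((n - 2) * (l - 1)) * (real q ^ (n - 1) - 1) / (real q - 1)"
proof -
  let ?V = "unimodular R n" and ?U = "unit_multiples R n"
  let ?N = "{b \<in> ?V. dot R n a b = \<zero>}"
  have n1: "1 \<le> n - 1" using n by simp
  have aa: "(a, a) \<in> ?U" using equiv_class_self[OF equiv_unit_multiples a] by simp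
  have "{B. (?U `` {a}, B) \<in> Um0_edges n} = (\<lambda>b. ?U `` {b}) ` ?N"
  proof (intro equalityI subsetI)
    fix B assume "B \<in> {B. (?U `` {a}, B) \<in> Um0_edges n}"
    then have B: "(?U `` {a}, B) \<in> Um0_edges n" by simp
    then have "B \<in> ?V // ?U" using Um0_edges_subset by blast
    then obtain b where "b \<in> ?V" "B = ?U `` {b}" by (rule quotientE)
    then show "B \<in> (\<lambda>b. ?U `` {b}) ` ?N" using B Um0_edges_iff[OF a] by blast
  next
    fix B assume "B \<in> (\<lambda>b. ?U `` {b}) ` ?N"
    then show "B \<in> {B. (?U `` {a}, B) \<in> Um0_edges n}" using Um0_edges_iff[OF a] by auto
  qed
  moreover have "q ^ (l - 1) * (q - 1) * card ((\<lambda>b. ?U `` {b}) ` ?N) = card ?N"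
  proof (rule card_classes)
    fix b b' assume b: "b \<in> ?N" and bb': "(b, b') \<in> ?U"
    then have "b' \<in> ?V" unfolding unit_multiples_def by auto
    moreover have "dot R n a b' = \<zero>" using dot_unit_multiples_zero_iff[OF aa bb'] b by simp
    ultimately show "b' \<in> ?N" by simp
  qed auto
  ultimately have "q ^ (l - 1) * (q - 1) * card {B. (?U `` {a}, B) \<in> Um0_edges n} = card ?N"
    by (simp only:)
  from card_eq_of_scaled_card[OF q_gt_1 n1 card_dot_eq_zero[OF a] this l_pos]
  show ?thesis by (simp only: diff_diff_left one_add_one)
qed

lemma Um0_edges_sym: "(B, D) \<in> Um0_edges n \<longleftrightarrow> (D, B) \<in> Um0_edges n"
proof -
  have "(D, B) \<in> Um0_edges n" if "(B, D) \<in> Um0_edges n" for B D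
  proof -
    obtain a b where "a \<in> unimodular R n" "b \<in> unimodular R n" "dot R n a b = \<zero>"
      "B = unit_multiples R n `` {a}" "D = unit_multiples R n `` {b}"
      using \<open>(B, D) \<in> Um0_edges n\<close> unfolding Um0_edges_def by auto
    moreover have "dot R n b a = dot R n a b"
      using dot_comm[OF unimodular_Pi unimodular_Pi] calculation(1,2) by blast
    ultimately show ?thesis using Um0_edges_iff by simp
  qed
  then show ?thesis by blast
qed

lemma regular_Um0:
  assumes n: "2 \<le> n"
  shows "\<exists>d. regular_of_degree (Um0 R n) d \<and>
    real d = real q ^ ((n - 2) * (l - 1)) * (real q ^ (n - 1) - 1) / (real q - 1)"
proof -
  let ?V = "unimodular R n" and ?U = "unit_multiples R n"
  let ?r = "real q ^ ((n - 2) * (l - 1)) * (real q ^ (n - 1) - 1) / (real q - 1)"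
  have deg: "real (out_degree (with_proj (Um0 R n)) v) = ?r" if v: "v \<in> pverts (Um0 R n)" for v
  proof -
    obtain a where a: "a \<in> ?V" "v = Inl (?U `` {a}) \<or> v = Inr (?U `` {a})"
      using v unfolding Um0_eq bipartite_graph_def by (auto elim!: quotientE)
    then show ?thesis
      using card_Um0_neighbours[OF n a(1)]
      unfolding Um0_eq
      by (elim disjE) (simp_all add: out_degree_bipartite_graph Um0_edges_sym[of _ "?U `` {a}"])
  qed
  \<comment> \<open>The formula is real-valued but the degree must be a natural number, so it is
    read off at some vertex. The half-size formula excludes an empty vertex set.\<close>
  show ?thesis
  proof (cases "pverts (Um0 R n) = {}")
    case True
    then have "half_size (Um0 R n) = 0" unfolding half_size_def by simp
    then have "real q ^ ((n - 1) * (l - 1)) * (real q ^ n - 1) / (real q - 1) = 0"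
      using half_size_Um0[of n] n by simp
    then have "real q ^ n = 1" using q_gt_1 by auto
    moreover have "1 < real q ^ n" using q_gt_1 n by (intro one_less_power) auto
    ultimately show ?thesis by simp
  next
    case False
    then obtain v where v: "v \<in> pverts (Um0 R n)" by blast
    show ?thesis
    proof (intro exI conjI)
      show "real (out_degree (with_proj (Um0 R n)) v) = ?r" by (rule deg[OF v])
      show "regular_of_degree (Um0 R n) (out_degree (with_proj (Um0 R n)) v)"
        unfolding regular_of_degree_def using deg v by (metis of_nat_eq_iff)
    qed
  qed
qed

lemma diameter_Um:
  assumes n: "2 \<le> n" and "odd q"
  shows "graph_diameter (Um R n) = 4"
  unfolding Um_def
proof (rule graph_diameter_bipartite_eq_4)
  let ?V = "unimodular R n"
  let ?E = "{(a, b). a \<in> ?V \<and> b \<in> ?V \<and> dot R n a b = \<one>}"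
  show "?E \<subseteq> ?V \<times> ?V" by auto
  show "\<exists>c d. (a, c) \<in> ?E \<and> (d, c) \<in> ?E \<and> (d, b) \<in> ?E" if ab: "a \<in> ?V" "b \<in> ?V" for a b
  proof -
    obtain x d where "x \<in> ?V" "d \<in> ?V" "dot R n a x = \<one>" "dot R n d x = \<one>" "dot R n d b = \<one>"
      using Um_path3[OF n ab] .
    then show ?thesis using ab by blast
  qed
  have n0: "0 < n" using n by simp
  \<comment> \<open>A common neighbour of these two vertices would have first entry equal to both 1
    and -1; oddness of q makes 1 and -1 distinct.\<close>
  show e: "single n 0 \<one> \<in> ?V" "single n 0 (\<ominus> \<one>) \<in> ?V"
    unfolding unimodular_iff using n0 single_closed by (auto simp: single_def intro!: exI[of _ 0])
  have neg: "\<ominus> \<one> \<noteq> \<one>" using one_plus_one_neq_zero[OF assms(2)] r_neg[of \<one>] by auto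
  then show "single n 0 \<one> \<noteq> single n 0 (\<ominus> \<one>)"
    using n0 by (auto simp: single_def fun_eq_iff)
  fix c assume c: "(single n 0 \<one>, c) \<in> ?E"
  then have cP: "c \<in> {..<n} \<rightarrow> carrier R" using unimodular_Pi by auto
  have c0: "c 0 \<in> carrier R" using cP n0 by auto
  have "dot R n (single n 0 x) c = c 0 \<otimes> x" if "x \<in> carrier R" for x
  proof -
    have "single n 0 x \<in> {..<n} \<rightarrow> carrier R" using single_closed[OF that, of n 0] by auto
    then show ?thesis using dot_single[OF cP n0 that] dot_comm[OF _ cP] by metis
  qed
  then have "c 0 = \<one>" "dot R n (single n 0 (\<ominus> \<one>)) c = \<ominus> c 0" using c c0 by (auto simp: r_minus)
  then show "(single n 0 (\<ominus> \<one>), c) \<notin> ?E" using neg by auto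
qed

lemma diameter_Um0:
  assumes n: "3 \<le> n"
  shows "graph_diameter (Um0 R n) = 3"
  unfolding Um0_eq
proof (rule graph_diameter_bipartite_eq_3[OF Um0_edges_subset])
  let ?V = "unimodular R n" and ?U = "unit_multiples R n"
  show common: "\<exists>D. (A, D) \<in> Um0_edges n \<and> (B, D) \<in> Um0_edges n"
    if AB: "A \<in> ?V // ?U" "B \<in> ?V // ?U" for A B
  proof -
    obtain a where a: "a \<in> ?V" "A = ?U `` {a}" using AB(1) by (rule quotientE)
    obtain b where b: "b \<in> ?V" "B = ?U `` {b}" using AB(2) by (rule quotientE)
    obtain x where "x \<in> ?V" "dot R n a x = \<zero>" "dot R n b x = \<zero>"
      using common_dot_eq_zero[OF n a(1) b(1)] .
    then show ?thesis unfolding a(2) b(2) using Um0_edges_iff a(1) b(1) by blast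
  qed
  show "\<exists>D. (D, A) \<in> Um0_edges n \<and> (D, B) \<in> Um0_edges n"
    if AB: "A \<in> ?V // ?U" "B \<in> ?V // ?U" for A B
    using common[OF AB] Um0_edges_sym by blast
  have n0: "0 < n" using n by simp
  have e: "single n 0 \<one> \<in> ?V"
    unfolding unimodular_iff using n0 single_closed by (auto simp: single_def intro!: exI[of _ 0])
  \<comment> \<open>The two copies of one and the same class serve as the non-adjacent pair, because
    the first basis vector has dot product 1 with itself.\<close>
  show "?U `` {single n 0 \<one>} \<in> ?V // ?U" "?U `` {single n 0 \<one>} \<in> ?V // ?U"
    using quotientI[OF e] by auto
  have "dot R n (single n 0 \<one>) (single n 0 \<one>) = \<one>"
    using dot_single[OF unimodular_Pi[OF e] n0 one_closed] n0 by (simp add: single_def)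
  then show "(?U `` {single n 0 \<one>}, ?U `` {single n 0 \<one>}) \<notin> Um0_edges n"
    using Um0_edges_iff[OF e e] one_neq_zero by simp
qed

end

theorem theorem1p7:
  fixes R :: "('a, 'm) ring_scheme" (structure)
    and \<pi> :: 'a and q l :: nat
  assumes "finite_valuation_ring R"
    and "uniformizer R \<pi>"
    and "q = card (carrier (R Quot (PIdl \<pi>)))"
    and "odd q"
    and "l = nilpotency_degree R \<pi>"
  shows
    "((\<forall>n\<ge>2.
         real (half_size (Um R n)) = real q ^ (n * l) - real q ^ (n * (l - 1)) \<and>
         regular_of_degree (Um R n) (q ^ ((n - 1) * l))) \<and>
      (\<forall>n\<ge>3.
         real (half_size (Um0 R n)) =
           real q ^ ((n - 1) * (l - 1)) * (real q ^ n - 1) / (real q - 1) \<and>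
         (\<exists>d. regular_of_degree (Um0 R n) d \<and>
           real d = real q ^ ((n - 2) * (l - 1)) * (real q ^ (n - 1) - 1) / (real q - 1)))) \<and>
     ((\<forall>n\<ge>2. is_cayley_graph (Um R n)) \<and>
      (\<forall>n\<ge>3. is_cayley_graph (Um0 R n))) \<and>
     ((\<forall>n\<ge>2. graph_diameter (Um R n) = 4) \<and>
      (\<forall>n\<ge>3. graph_diameter (Um0 R n) = 3))"
proof -
  interpret finite_valuation_ring R by (rule assms(1))
  interpret uniformized_valuation_ring R \<pi> q l
    by unfold_locales (use assms in auto)
  show ?thesis
    using half_size_Um regular_Um half_size_Um0 regular_Um0 is_cayley_graph_Um_Um0
      diameter_Um[OF _ assms(4)] diameter_Um0
    by (intro conjI allI impI) simp_all
qed

end
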